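(* Assume hypothesis $\hat C$ (stated in full in the context: the conjunction of the Riemann hypothesis RH and the conjectures C1, C3, C4, for some $\alpha\in(0,\tfrac12)$). Then $\Delta(s)\to0$ uniformly as $|s|\to\infty$ (on $\mathbb{C}$).
   Context: Notation. $\zeta$ is the Riemann zeta-function; $a(s)=\pi^{-s/2}s\,\Gamma(s/2)(s-1)$; $\xi(s)=\tfrac12a(s)\zeta(s)$ (entire); $n(s)=\sin(\pi s/4)\cdot2\xi(\tfrac12+s)$ (entire); $f(s)=1/n(s)$ (meromorphic). $c(z)=1/n'(z)$ whenever $n'(z)\ne0$ (this holds at every $z=4w$, $w\in\mathbb{Z}$). $Z_i$ is the set of nonreal zeros of $\zeta(\tfrac12+s)$, and $Z^\circ=4\mathbb{Z}\cup Z_i$. Zeta ordinates. $\gamma_1<\gamma_2<\cdots$ enumerate the distinct imaginary parts of the zeros of $\zeta$ with positive imaginary part; $\gamma_{-n}=-\gamma_n$ for $n\ge1$. For a nonzero integer $k$, $\delta_k$ is the smaller of the distances from $\gamma_k$ to its two neighbours in the ordered set $\{\gamma_j: j\in\mathbb{Z}\setminus\{0\}\}$, and $\delta_k'=\min\{1/\log|\gamma_k|,\delta_k\}$. Partial fractions. $p(s)=p_r(s)+p_i(s)$ with $p_r(s)=\frac{c(0)}{s}+\sum_{w\ge1}c(4w)\big(\frac1{s-4w}+\frac1{s+4w}\big)$ and $p_i(s)=\sum_{k\ge1}c(i\gamma_k)\big(\frac1{s-i\gamma_k}+\frac1{s+i\gamma_k}\big)$. Under $\hat C$ all nonreal zeros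 of $\zeta$ are simple, $\sum_{k\ge 1}|c(i\gamma_k)|<\infty$, and $f-p$ extends analytically from $\mathbb{C}\setminus Z^\circ$ to an entire function, denoted $\Delta$. Hypothesis $\hat C$: there is $\alpha$ with $0<\alpha<\tfrac12$ such that all of the following hold. (RH) Every nonreal zero of $\zeta$ has real part $\tfrac12$. (C1) For $t>t(1):=\gamma_1-\alpha\delta_1'$ let $s(t,\alpha)=x(t,\alpha)+it$, where $x(t,\alpha)=\sqrt{(\alpha\delta_k')^2-(t-\gamma_k)^2}$ if $|t-\gamma_k|\le\alpha\delta_k'$ for some $k\ge1$, and $x(t,\alpha)=0$ otherwise. (i) There exist $\varepsilon>0,\lambda>0$ with $|\zeta(\tfrac12+s(t,\alpha))|>\lambda t^{-\varepsilon}$ for all $t>t(1)$; let $\varepsilon_0$ be the infimum of such $\varepsilon$. (ii) $\varepsilon_0<3/4$. (C3) (i′) There is a real $\varepsilon\ge0$ such that for any $\sigma>0$ there is $K>0$ with $|\zeta'(\tfrac12+i\gamma_k)|>K\gamma_k^{-(\varepsilon+\sigma)}$ for all $k\ge1$; let $\varepsilon_1$ be the least such $\varepsilon$. (i) There is $\varepsilon\ge0$ such that for any $\sigma>0$ there is $K>0$ with $\delta_k>K\gamma_k^{-(\varepsilon+\sigma)}$ for all $k\ge1$; let $\varepsilon_2$ be the least such $\varepsilon$. (ii) $\varepsilon_1+\varepsilon_2<3/4$. (C4) Let $j_k(\alpha)=\min\{|\zeta(\tfrac12+it)/(t-\gamma_k)|: t\in\mathbb{R},\ |t-\gamma_k|\le\alpha\delta_k'\}$,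 where at $t=\gamma_k$ the quotient is read as $\zeta'(\tfrac12+i\gamma_k)$. (i) There is $\varepsilon\ge0$ such that for any $\sigma>0$ there is $K>0$ with $j_k(\alpha)>K\gamma_k^{-(\varepsilon+\sigma)}$ for all $k\ge1$; let $\tilde\varepsilon_1$ be the least such $\varepsilon$. (ii) $\tilde\varepsilon_1+\varepsilon_2\le1$. "$g(s)\to0$ uniformly as $|s|\to\infty$" means: for every $\varepsilon>0$ there is $R$ with $|g(s)|<\varepsilon$ for all $s$ with $|s|\ge R$. *)

theory Defs
  imports "HOL-Complex_Analysis.Complex_Analysis"
begin

text \<open>The Riemann zeta-function as the analytic continuation of its Dirichlet series; the value
  at the pole is pinned to \<open>0\<close> only to make the description unique.\<close>

definition zeta :: "complex \<Rightarrow> complex" where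
  "zeta = (THE g. g holomorphic_on (- {1}) \<and>
                  (\<forall>s. Re s > 1 \<longrightarrow> (\<lambda>n. 1 / of_nat (Suc n) powr s) sums g s) \<and>
                  g 1 = 0)"

definition a_fun :: "complex \<Rightarrow> complex" where
  "a_fun s = of_real pi powr (- s / 2) * s * Gamma (s / 2) * (s - 1)"

text \<open>\<open>\<xi>\<close> is entire: its formula has removable singularities at \<open>1\<close> (pole of \<open>\<zeta>\<close>) and at
  \<open>0, -2, -4, \<dots>\<close> (poles of \<open>\<Gamma>(s/2)\<close>, where \<^const>\<open>Gamma\<close> returns \<open>0\<close>).\<close>

definition xi :: "complex \<Rightarrow> complex" where
  "xi = remove_sings (\<lambda>s. 1 / 2 * a_fun s * zeta s)"

definition n_fun :: "complex \<Rightarrow> complex" where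
  "n_fun s = sin (of_real pi * s / 4) * (2 * xi (1 / 2 + s))"

definition f_fun :: "complex \<Rightarrow> complex" where
  "f_fun s = 1 / n_fun s"

definition c_coeff :: "complex \<Rightarrow> complex" where
  "c_coeff z = 1 / deriv n_fun z"

definition Z_i :: "complex set" where
  "Z_i = {s. zeta (1 / 2 + s) = 0 \<and> Im s \<noteq> 0}"

definition Z_circ :: "complex set" where
  "Z_circ = range (\<lambda>w::int. 4 * of_int w) \<union> Z_i"

definition ordinates :: "real set" where
  "ordinates = {Im \<rho> | \<rho>. zeta \<rho> = 0 \<and> Im \<rho> > 0}"

text \<open>Increasing enumeration of the ordinates, starting at index \<open>1\<close>; the infima are attained
  because the ordinates form an infinite set without finite accumulation points.\<close>

primrec pos_ordinate :: "nat \<Rightarrow> real" where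
  "pos_ordinate 0 = 0"
| "pos_ordinate (Suc n) = Inf {t \<in> ordinates. t > pos_ordinate n}"

definition gam :: "int \<Rightarrow> real" where
  "gam k = (if k \<ge> 0 then pos_ordinate (nat k) else - pos_ordinate (nat (- k)))"

text \<open>Index \<open>0\<close> is not used, so \<open>\<gamma>\<^sub>-\<^sub>1\<close> and \<open>\<gamma>\<^sub>1\<close> are neighbours.\<close>

definition next_index :: "int \<Rightarrow> int" where
  "next_index k = (if k = -1 then 1 else k + 1)"

definition prev_index :: "int \<Rightarrow> int" where
  "prev_index k = (if k = 1 then -1 else k - 1)"

definition delta :: "int \<Rightarrow> real" where
  "delta k = min (gam k - gam (prev_index k)) (gam (next_index k) - gam k)"

definition delta' :: "int \<Rightarrow> real" where
  "delta' k = min (1 / ln \<bar>gam k\<bar>) (delta k)"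

definition p_r :: "complex \<Rightarrow> complex" where
  "p_r s = c_coeff 0 / s +
     (\<Sum>w. c_coeff (4 * of_nat (Suc w)) *
        (1 / (s - 4 * of_nat (Suc w)) + 1 / (s + 4 * of_nat (Suc w))))"

definition p_i :: "complex \<Rightarrow> complex" where
  "p_i s = (\<Sum>m. let z = \<i> * of_real (gam (int (Suc m))) in
        c_coeff z * (1 / (s - z) + 1 / (s + z)))"

definition p_fun :: "complex \<Rightarrow> complex" where
  "p_fun s = p_r s + p_i s"

text \<open>The entire extension of \<open>f - p\<close>; it is unique since the complement of \<^const>\<open>Z_circ\<close> is
  dense.\<close>

definition Delta :: "complex \<Rightarrow> complex" where
  "Delta = (THE D. D holomorphic_on UNIV \<and> (\<forall>s. s \<notin> Z_circ \<longrightarrow> D s = f_fun s - p_fun s))"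

definition RH :: bool where
  "RH \<longleftrightarrow> (\<forall>\<rho>. zeta \<rho> = 0 \<and> Im \<rho> \<noteq> 0 \<longrightarrow> Re \<rho> = 1 / 2)"

definition t_one :: "real \<Rightarrow> real" where
  "t_one \<alpha> = gam 1 - \<alpha> * delta' 1"

text \<open>For \<open>\<alpha> < 1/2\<close> the intervals \<open>\<bar>t - \<gamma>\<^sub>k\<bar> \<le> \<alpha> \<delta>\<^sub>k'\<close> are disjoint, so the index below is
  unique.\<close>

definition x_path :: "real \<Rightarrow> real \<Rightarrow> real" where
  "x_path \<alpha> t =
     (if \<exists>k\<ge>1. \<bar>t - gam k\<bar> \<le> \<alpha> * delta' k
      then let k = (THE k. k \<ge> 1 \<and> \<bar>t - gam k\<bar> \<le> \<alpha> * delta' k)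
           in sqrt ((\<alpha> * delta' k)\<^sup>2 - (t - gam k)\<^sup>2)
      else 0)"

definition s_path :: "real \<Rightarrow> real \<Rightarrow> complex" where
  "s_path \<alpha> t = Complex (x_path \<alpha> t) t"

definition C1_exponents :: "real \<Rightarrow> real set" where
  "C1_exponents \<alpha> = {\<epsilon>. \<epsilon> > 0 \<and>
     (\<exists>c>0. \<forall>t>t_one \<alpha>. norm (zeta (1 / 2 + s_path \<alpha> t)) > c * t powr (- \<epsilon>))}"

definition C1 :: "real \<Rightarrow> bool" where
  "C1 \<alpha> \<longleftrightarrow> C1_exponents \<alpha> \<noteq> {} \<and> Inf (C1_exponents \<alpha>) < 3 / 4"

text \<open>The shape of lower bound shared by the conjectures C3 and C4.\<close>

definition lower_exponent :: "(int \<Rightarrow> real) \<Rightarrow> real \<Rightarrow> bool" where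
  "lower_exponent u \<epsilon> \<longleftrightarrow> \<epsilon> \<ge> 0 \<and>
     (\<forall>\<sigma>>0. \<exists>K>0. \<forall>k\<ge>1. u k > K * gam k powr (- (\<epsilon> + \<sigma>)))"

definition least_exponent :: "(int \<Rightarrow> real) \<Rightarrow> real" where
  "least_exponent u = (LEAST \<epsilon>. lower_exponent u \<epsilon>)"

definition zeta_deriv_at :: "int \<Rightarrow> real" where
  "zeta_deriv_at k = norm (deriv zeta (1 / 2 + \<i> * of_real (gam k)))"

definition C3 :: bool where
  "C3 \<longleftrightarrow> (\<exists>\<epsilon>. lower_exponent zeta_deriv_at \<epsilon>) \<and> (\<exists>\<epsilon>. lower_exponent delta \<epsilon>) \<and>
     least_exponent zeta_deriv_at + least_exponent delta < 3 / 4"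

text \<open>The infimum is over a compact interval of a function that is continuous by the choice of its
  value at \<open>\<gamma>\<^sub>k\<close> (under RH), so it is a minimum.\<close>

definition j_min :: "real \<Rightarrow> int \<Rightarrow> real" where
  "j_min \<alpha> k = (INF t\<in>{t. \<bar>t - gam k\<bar> \<le> \<alpha> * delta' k}.
     if t = gam k then norm (deriv zeta (1 / 2 + \<i> * of_real (gam k)))
     else norm (zeta (1 / 2 + \<i> * of_real t) / of_real (t - gam k)))"

definition C4 :: "real \<Rightarrow> bool" where
  "C4 \<alpha> \<longleftrightarrow> (\<exists>\<epsilon>. lower_exponent (j_min \<alpha>) \<epsilon>) \<and>
     least_exponent (j_min \<alpha>) + least_exponent delta \<le> 1"

definition hypothesis_C_hat :: bool where
  "hypothesis_C_hat \<longleftrightarrow> (\<exists>\<alpha>. 0 < \<alpha> \<and> \<alpha> < 1 / 2 \<and> RH \<and> C1 \<alpha> \<and> C3 \<and> C4 \<alpha>)"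

end

theory Submission
  imports Defs "HOL-Probability.Probability" "HOL-Real_Asymp.Real_Asymp"
begin

text \<open>
  Put \<open>E(s) = 2\<xi>(1/2 + s)\<close>. Riemann's theta integral shows that \<open>E\<close> is entire, even, nonzero on the real
  axis and of order less than \<open>2\<close>; under RH its zeros are all purely imaginary. Dividing out Blaschke
  factors on larger and larger discs shows that such a function satisfies
  \<open>\<bar>E(x + it)\<bar> / \<bar>x + it - \<rho>\<bar> \<le> \<bar>E(y + it)\<bar> / \<bar>y + it - \<rho>\<bar>\<close> for \<open>0 \<le> x \<le> y\<close> and every zero \<open>\<rho>\<close>. So the lower
  bound of C1 at a single point \<open>iT\<close> midway between consecutive ordinates, where the path of C1 runs on
  the critical line, bounds \<open>n(s) = sin(\<pi>s/4) E(s)\<close> from below by a positive power of \<open>T\<close> on the whole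
  line \<open>Im s = T\<close>, and the values of \<open>\<zeta>\<close> on \<open>Re s = 2\<close> give a similar bound on the lines
  \<open>Re s = 4N + 2\<close>. Integrating \<open>f(w)/(w - s)\<close> around the resulting boxes gives \<open>f = p\<close>, that is,
  \<open>\<Delta> = 0\<close>.
\<close>

section \<open>The theta identity\<close>

text \<open>On a box of size T the kernel 1/(w - s) has size 1/T and the perimeter has size T, so
  the contour integral tends to 0 as soon as the minimum of |n| on the box tends to infinity, at
  whatever rate. One point can control a whole horizontal side because each factor |x + it - rho|
  with rho imaginary increases in x >= 0. Working on discs makes this factorwise argument possible
  without an infinite product: each Blaschke factor is monotone, and the zero-free quotient is
  nearly constant at bounded s because ln max|E| = o(R^2). The factor |x + it - rho| that stays in
  the inequality serves the vertical sides: it carries the bound from Re s = 3/2 to Re s = X with a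
  gain of order X/(1 + |t|). On the imaginary axis the Gamma factor leaves |n(iT)| >= const * T *
  |zeta(1/2 + iT)|, and C1 allows a loss of T^epsilon with epsilon < 3/4. C3 supplies zeta' nonzero
  at the zeros, hence simple poles of f, and delta_k > 0, hence a strictly increasing and therefore
  infinite list of ordinates.\<close>

definition gauss :: "real \<Rightarrow> real \<Rightarrow> real" where
  "gauss t v = exp (- pi * t * v^2)"

abbreviation cos_mode :: "nat \<Rightarrow> real \<Rightarrow> real" where
  "cos_mode m v \<equiv> cos (2 * pi * real m * v)"

text \<open>The characteristic function of the standard normal law, rescaled: with c = sqrt(2 pi t)
  the density at c v is \<open>gauss t v\<close> / sqrt(2 pi), and the frequency 2 pi m turns into y
  = 2 pi m / c.\<close>

lemma gauss_cos_integral: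
  assumes t: "t > 0"
  shows "has_bochner_integral lborel (\<lambda>v. gauss t v * cos_mode m v)
           (gauss (1 / t) (real m) / sqrt t)"
proof -
  define c where "c = sqrt (2 * pi * t)"
  have c: "c > 0" "c^2 = 2 * pi * t" using t by (auto simp: c_def)
  define y where "y = 2 * pi * real m / c"
  interpret prob_space std_normal_distribution
    by (rule prob_space_normal_density) simp
  have "integrable std_normal_distribution (\<lambda>x. iexp (y * x))"
    by (intro integrable_const_bound[where B = 1]) auto
  moreover have "(CLINT x|std_normal_distribution. iexp (y * x)) = complex_of_real (exp (- (y^2) / 2))"
    using char_std_normal_distribution by (simp add: char_def fun_eq_iff)
  ultimately have "has_bochner_integral std_normal_distribution (\<lambda>x. iexp (y * x))
      (complex_of_real (exp (- (y^2) / 2)))"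
    by (simp add: has_bochner_integral_iff)
  hence "has_bochner_integral std_normal_distribution (\<lambda>x. Re (iexp (y * x)))
      (Re (complex_of_real (exp (- (y^2) / 2))))"
    by (rule has_bochner_integral_bounded_linear[OF bounded_linear_Re])
  hence "has_bochner_integral std_normal_distribution (\<lambda>x. cos (y * x)) (exp (- (y^2) / 2))"
    by (simp add: Re_exp)
  hence "has_bochner_integral lborel (\<lambda>x. std_normal_density x * cos (y * x)) (exp (- (y^2) / 2))"
    by (simp add: has_bochner_integral_iff integrable_density integral_density)
  hence "has_bochner_integral lborel (\<lambda>v. std_normal_density (0 + c * v) * cos (y * (0 + c * v)))
     (exp (- (y^2) / 2) /\<^sub>R \<bar>c\<bar>)"
    using c by (subst (asm) lborel_has_bochner_integral_real_affine_iff[where c = c and t = 0]) auto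
  hence "has_bochner_integral lborel (\<lambda>v. sqrt (2 * pi) * (std_normal_density (0 + c * v) * cos (y * (0 + c * v))))
     (sqrt (2 * pi) * (exp (- (y^2) / 2) /\<^sub>R \<bar>c\<bar>))"
    by (rule has_bochner_integral_mult_right)
  moreover have "sqrt (2 * pi) * (std_normal_density (0 + c * v) * cos (y * (0 + c * v)))
      = gauss t v * cos_mode m v" for v
    using c by (auto simp: normal_density_def gauss_def y_def power_mult_distrib algebra_simps)
  moreover have "sqrt (2 * pi) * (exp (- (y^2) / 2) /\<^sub>R \<bar>c\<bar>) = gauss (1 / t) (real m) / sqrt t"
  proof -
    have "y^2 / 2 = pi * (1 / t) * (real m)^2"
      unfolding y_def using c t by (simp add: power_divide power_mult_distrib power2_eq_square field_simps)
    moreover have "c = sqrt (2 * pi) * sqrt t" by (simp add: c_def real_sqrt_mult)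
    ultimately show ?thesis using c t by (simp add: gauss_def field_simps)
  qed
  ultimately show ?thesis by simp
qed

lemma has_bochner_integral_half_line_of_even:
  fixes f :: "real \<Rightarrow> real"
  assumes "has_bochner_integral lborel f I" and even: "\<And>x. f (- x) = f x"
  shows "has_bochner_integral lborel (\<lambda>x. indicator {0..} x * f x) (I / 2)"
proof -
  have "integrable lborel (\<lambda>x. indicator {0..} x * f x)"
    using integrable_mult_indicator[of "{0..}" lborel f] assms(1)
    by (auto simp: has_bochner_integral_iff)
  then obtain J where J: "has_bochner_integral lborel (\<lambda>x. indicator {0..} x * f x) J"
    by (auto simp: has_bochner_integral_iff)
  have "has_bochner_integral lborel f (2 *\<^sub>R J)"
    by (rule has_bochner_integral_even_function) (use J even in auto)
  with assms(1) have "I = 2 * J" by (auto simp: has_bochner_integral_iff)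
  with J show ?thesis by simp
qed

lemma summable_exp_square:
  assumes "a > (0::real)"
  shows "summable (\<lambda>n. exp (- a * (real n)^2))"
proof (rule summable_comparison_test)
  have "exp (- a * (real n)^2) \<le> exp (- a) ^ n" for n
  proof -
    have "real n \<le> (real n)^2" by (cases n) (auto simp: power2_eq_square)
    hence "- a * (real n)^2 \<le> real n * (- a)" using assms by (simp add: mult.commute)
    thus ?thesis by (simp add: exp_of_nat_mult[symmetric])
  qed
  thus "\<exists>N. \<forall>n\<ge>N. norm (exp (- a * (real n)^2)) \<le> exp (- a) ^ n" by auto
  show "summable (\<lambda>n. exp (- a) ^ n)" using assms by (intro summable_geometric) auto
qed

lemma summable_gauss: "t > 0 \<Longrightarrow> summable (\<lambda>n. gauss t (real n))"
  using summable_exp_square[of "pi * t"] by (simp add: gauss_def)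

section \<open>Cosine integrals over unit cells and the step version of the Gaussian\<close>

lemma half_open_cos_integral:
  assumes "a \<le> b"
  shows "has_bochner_integral lborel (\<lambda>v. indicator {a..<b} v * cos_mode m v)
           (if m = 0 then b - a
            else (sin (2 * pi * real m * b) - sin (2 * pi * real m * a)) / (2 * pi * real m))"
proof -
  define F where "F = (\<lambda>v. if m = 0 then v else sin (2 * pi * real m * v) / (2 * pi * real m))"
  have "has_bochner_integral lborel (\<lambda>v. indicator {a..b} v *\<^sub>R cos_mode m v) (F b - F a)"
  proof (rule has_bochner_integral_FTC_Icc)
    fix x
    show "(F has_vector_derivative cos_mode m x) (at x within {a..b})"
      unfolding has_real_derivative_iff_has_vector_derivative[symmetric] F_def
      by (cases "m = 0") (auto intro!: derivative_eq_intros)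
  qed (auto intro!: continuous_intros assms)
  hence "has_bochner_integral lborel (\<lambda>v. indicator {a..<b} v * cos_mode m v) (F b - F a)"
  proof (rule has_bochner_integral_cong_AE[THEN iffD1, rotated 3])
    show "AE x in lborel. indicator {a..b} x *\<^sub>R cos_mode m x = indicator {a..<b} x * cos_mode m x"
      using AE_lborel_singleton[of b] by eventually_elim (auto simp: indicator_def)
  qed auto
  moreover have "F b - F a = (if m = 0 then b - a
            else (sin (2 * pi * real m * b) - sin (2 * pi * real m * a)) / (2 * pi * real m))"
    by (auto simp: F_def diff_divide_distrib)
  ultimately show ?thesis by simp
qed

text \<open>Half-open, so that the cells partition the half-line and match the tie-breaking of
  \<open>round\<close>. Cutting at 0 leaves \<open>cell 0\<close> with length 1/2.\<close>

definition cell :: "nat \<Rightarrow> real set" where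
  "cell n = {max 0 (real n - 1/2)..<real n + 1/2}"

lemma cell_iff: "v \<in> cell n \<longleftrightarrow> v \<ge> 0 \<and> n = nat (round v)"
proof -
  have "v \<in> cell n \<longleftrightarrow> v \<ge> 0 \<and> \<lfloor>v + 1/2\<rfloor> = int n"
    by (auto simp: cell_def floor_eq_iff)
  also have "\<dots> \<longleftrightarrow> v \<ge> 0 \<and> n = nat (round v)"
    by (auto simp: round_def nat_eq_iff)
  finally show ?thesis .
qed

text \<open>The sine primitive vanishes at half-integers and at 0, so every mode m >= 1 integrates
  to 0 even on the half cell at the origin. The value 1/2 there produces the weight of the term n =
  0 in \<open>1/2 + psi t\<close>.\<close>

lemma cell_cos_integral:
  "has_bochner_integral lborel (\<lambda>v. indicator (cell n) v * cos_mode m v)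
     (if m \<noteq> 0 then 0 else if n = 0 then 1/2 else 1)"
proof -
  have s: "sin (2 * pi * real m * (real n + 1/2)) = 0" "sin (2 * pi * real m * (real n - 1/2)) = 0"
    using sin_npi[of "2*n*m + m"] sin_npi_int[of "int (2*n*m) - int m"]
    by (simp_all add: algebra_simps)
  have m: "max 0 (real n - 1/2) = (if n = 0 then 0 else real n - 1/2)" by auto
  show ?thesis unfolding cell_def
    using half_open_cos_integral[of "max 0 (real n - 1/2)" "real n + 1/2" m] s m
    by (auto split: if_splits)
qed

definition step_gauss :: "real \<Rightarrow> real \<Rightarrow> real" where
  "step_gauss t v = indicator {0..} v * gauss t (real (nat (round v)))"

lemma step_gauss_sums: "(\<lambda>n. gauss t (real n) * indicator (cell n) v) sums step_gauss t v"
proof -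
  have "(\<lambda>n. if n = nat (round v) then gauss t (real n) * indicator (cell n) v else 0) sums
       (gauss t (real (nat (round v))) * indicator (cell (nat (round v))) v)"
    by (rule sums_single)
  moreover have "(\<lambda>n. if n = nat (round v) then gauss t (real n) * indicator (cell n) v else 0) =
     (\<lambda>n. gauss t (real n) * indicator (cell n) v)"
    by (auto simp: cell_iff indicator_def fun_eq_iff)
  moreover have "gauss t (real (nat (round v))) * indicator (cell (nat (round v))) v = step_gauss t v"
    by (auto simp: step_gauss_def indicator_def cell_iff)
  ultimately show ?thesis by simp
qed

text \<open>The modes m >= 1 integrate to 0 on each cell, so they do not see the step function at
  all; the series of cell integrals is dominated by \<open>gauss t n\<close>.\<close>

lemma step_gauss_cos_integral:
  assumes t: "t > 0"
  shows "has_bochner_integral lborel (\<lambda>v. step_gauss t v * cos_mode m v)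
           (if m \<noteq> 0 then 0 else 1/2 + (\<Sum>n. gauss t (real (Suc n))))"
proof -
  let ?f = "\<lambda>n v. gauss t (real n) * (indicator (cell n) v * cos_mode m v)"
  define w where "w = (\<lambda>n::nat. if m \<noteq> 0 then 0 else if n = 0 then 1/2 else (1::real))"
  have I: "has_bochner_integral lborel (?f n) (gauss t (real n) * w n)" for n
    unfolding w_def by (intro has_bochner_integral_mult_right cell_cos_integral)
  have J: "has_bochner_integral lborel (\<lambda>v. gauss t (real n) * (indicator (cell n) v * cos_mode 0 v))
     (gauss t (real n) * (if n = 0 then 1/2 else 1))" for n
    using has_bochner_integral_mult_right[OF cell_cos_integral[of n 0]] by simp
  have S: "(\<lambda>n. ?f n v) sums (step_gauss t v * cos_mode m v)" for v
    using sums_mult2[OF step_gauss_sums[of t v]] by (simp add: mult.assoc)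
  have SN: "summable (\<lambda>n. norm (?f n v))" for v
  proof -
    have "summable (\<lambda>n. gauss t (real n) * indicator (cell n) v * \<bar>cos_mode m v\<bar>)"
      using step_gauss_sums[of t v] by (intro summable_mult2) (auto simp: sums_iff)
    moreover have "gauss t (real n) * indicator (cell n) v * \<bar>cos_mode m v\<bar> = norm (?f n v)" for n
      by (simp add: gauss_def abs_mult)
    ultimately show ?thesis by simp
  qed
  have SI: "summable (\<lambda>n. \<integral>v. norm (?f n v) \<partial>lborel)"
  proof (rule summable_comparison_test[OF _ summable_gauss[OF t]])
    have "(\<integral>v. norm (?f n v) \<partial>lborel) \<le> gauss t (real n)" for n
    proof -
      have "(\<integral>v. norm (?f n v) \<partial>lborel) \<le> (\<integral>v. gauss t (real n) * (indicator (cell n) v * cos_mode 0 v) \<partial>lborel)"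
      proof (rule integral_mono)
        show "integrable lborel (\<lambda>v. norm (?f n v))"
          using I[of n] unfolding has_bochner_integral_iff by (intro integrable_norm) simp
        show "integrable lborel (\<lambda>v. gauss t (real n) * (indicator (cell n) v * cos_mode 0 v))"
          using J[of n] unfolding has_bochner_integral_iff by simp
      qed (auto simp: gauss_def abs_mult indicator_def)
      also have "\<dots> \<le> gauss t (real n)" using J[of n] by (auto simp: has_bochner_integral_iff gauss_def)
      finally show ?thesis .
    qed
    thus "\<exists>N. \<forall>n\<ge>N. norm (\<integral>v. norm (?f n v) \<partial>lborel) \<le> gauss t (real n)"
      by simp
  qed
  have int: "integrable lborel (?f n)" for n using I by (auto simp: has_bochner_integral_iff)
  have "integrable lborel (\<lambda>v. \<Sum>n. ?f n v)"
    by (rule integrable_suminf) (use int SN SI in auto)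
  moreover have "(\<integral>v. (\<Sum>n. ?f n v) \<partial>lborel) = (\<Sum>n. \<integral>v. ?f n v \<partial>lborel)"
    by (rule integral_suminf) (use int SN SI in auto)
  moreover have "(\<Sum>n. ?f n v) = step_gauss t v * cos_mode m v" for v
    using S by (simp add: sums_iff)
  moreover have "(\<lambda>n. \<integral>v. ?f n v \<partial>lborel) = (\<lambda>n. gauss t (real n) * w n)"
    using I by (auto simp: has_bochner_integral_iff simp del: integral_mult_right_zero)
  ultimately have "has_bochner_integral lborel (\<lambda>v. step_gauss t v * cos_mode m v)
     (\<Sum>n. gauss t (real n) * w n)"
    by (simp add: has_bochner_integral_iff del: integral_mult_right_zero)
  moreover have "(\<Sum>n. gauss t (real n) * w n) =
      (if m \<noteq> 0 then 0 else 1/2 + (\<Sum>n. gauss t (real (Suc n))))"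
  proof (cases "m = 0")
    case True
    have "summable (\<lambda>n. gauss t (real n) * w n)"
      by (rule summable_comparison_test[OF _ summable_gauss[OF t]]) (auto simp: w_def gauss_def)
    hence "(\<Sum>n. gauss t (real n) * w n) = gauss t 0 * w 0 + (\<Sum>n. gauss t (real (Suc n)) * w (Suc n))"
      by (subst suminf_split_head) auto
    thus ?thesis using True by (simp add: w_def gauss_def)
  qed (simp add: w_def)
  ultimately show ?thesis by simp
qed

section \<open>Distance between the Gaussian and its step version\<close>

lemma sin_ge_linear:
  assumes "0 \<le> x" "x \<le> pi / 2"
  shows "sin x \<ge> x / pi"
proof (cases "x \<le> pi / 3")
  case True
  show ?thesis
  proof (cases "x = 0")
    case False
    obtain z where z: "0 < z" "z < x" "sin x - sin 0 = (x - 0) * cos z"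
      using MVT2[of 0 x sin cos] False assms by (auto intro: DERIV_sin)
    have "cos z \<ge> cos (pi / 3)" using z True by (intro cos_monotone_0_pi_le) auto
    hence "x * cos z \<ge> x * (1 / 2)" using assms by (intro mult_left_mono) (auto simp: cos_60)
    moreover have "x / pi \<le> x / 2" using assms pi_ge_two by (intro divide_left_mono) auto
    moreover have "sin x = x * cos z" using z by simp
    ultimately show ?thesis by linarith
  qed simp
next
  case False
  have "sin x \<ge> sin (pi / 3)" using False assms by (intro sin_monotone_2pi_le) auto
  hence "sin x \<ge> sqrt 3 / 2" by (simp add: sin_60)
  moreover have "sqrt 3 \<ge> 1" by simp
  moreover have "x / pi \<le> 1 / 2" using assms by (simp add: field_simps)
  ultimately show ?thesis by linarith
qed

text \<open>An integrable majorant 1/(1 + x^2) for the derivative of the Gaussian: |x| (1 + x^2) <=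
  1 + x^4, and exp(a x^2) >= 1 + a^2 x^4 / 2 absorbs the fourth power.\<close>

lemma gauss_deriv_bound:
  assumes "a > (0::real)"
  shows "\<bar>2 * a * x * exp (- a * x^2)\<bar> \<le> 2 * a * (1 + 2 / a^2) / (1 + x^2)"
proof -
  have "1 + a^2 * x^4 / 2 \<le> exp (a * x^2)"
  proof -
    have "1 + a * x^2 + (a * x^2)^2 / 2 \<le> exp (a * x^2)"
      using assms by (intro exp_lower_Taylor_quadratic) auto
    moreover have "(a * x^2)^2 = a^2 * x^4" by (simp add: power_mult_distrib flip: power_mult)
    moreover have "a * x^2 \<ge> 0" using assms by simp
    ultimately show ?thesis by linarith
  qed
  moreover have "\<bar>x\<bar> * (1 + x^2) \<le> 1 + x^4"
  proof -
    have *: "\<bar>x\<bar> \<le> (1 + x^2) / 2" using sum_squares_bound[of "\<bar>x\<bar>" 1] by simp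
    hence "\<bar>x\<bar> * (1 + x^2) \<le> (1 + x^2) / 2 * (1 + x^2)" by (intro mult_right_mono) auto
    also have "\<dots> \<le> 1 + x^4"
      using zero_le_power2[of "x^2 - 1"] by (simp add: power2_eq_square power4_eq_xxxx algebra_simps)
    finally show ?thesis .
  qed
  moreover have "1 + x^4 \<le> (1 + 2 / a^2) * (1 + a^2 * x^4 / 2)"
  proof -
    have "(1 + 2 / a^2) * (1 + a^2 * x^4 / 2) = 1 + x^4 + 2 / a^2 + a^2 * x^4 / 2"
      using assms by (simp add: field_simps)
    thus ?thesis using assms by simp
  qed
  moreover have "(1 + 2 / a^2) * (1 + a^2 * x^4 / 2) \<le> (1 + 2 / a^2) * exp (a * x^2)"
    using calculation(1) by (intro mult_left_mono) auto
  ultimately have "\<bar>x\<bar> * (1 + x^2) \<le> (1 + 2 / a^2) * exp (a * x^2)" by linarith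
  hence "\<bar>x\<bar> * exp (- a * x^2) \<le> (1 + 2 / a^2) / (1 + x^2)"
    by (simp add: exp_minus field_simps add_pos_nonneg)
  hence "2 * a * (\<bar>x\<bar> * exp (- a * x^2)) \<le> 2 * a * ((1 + 2 / a^2) / (1 + x^2))"
    using assms by (intro mult_left_mono) auto
  thus ?thesis using assms by (simp add: abs_mult mult.assoc)
qed

lemma abs_sin_pi_ge: "\<bar>v - real_of_int (round v)\<bar> \<le> \<bar>sin (pi * v)\<bar>"
proof -
  define u where "u = v - real_of_int (round v)"
  have u: "\<bar>u\<bar> \<le> 1/2" unfolding u_def using of_int_round_abs_le[of v] by (simp add: abs_minus_commute)
  have "sin (pi * v) = sin (pi * u + pi * real_of_int (round v))" by (simp add: u_def algebra_simps)
  also have "\<bar>\<dots>\<bar> = \<bar>sin (pi * u)\<bar>"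
  proof -
    have "\<bar>cos (pi * real_of_int (round v))\<bar> = 1"
      using sin_cos_squared_add[of "pi * real_of_int (round v)"] by (simp add: abs_square_eq_1 sin_npi_int)
    thus ?thesis by (simp add: sin_add abs_mult sin_npi_int)
  qed
  also have "\<dots> = sin (pi * \<bar>u\<bar>)"
  proof -
    have "sin (pi * \<bar>u\<bar>) \<ge> 0" using u pi_gt_zero by (intro sin_ge_zero) (auto simp: mult_le_cancel_left1)
    thus ?thesis by (cases "u \<ge> 0") auto
  qed
  also have "\<dots> \<ge> pi * \<bar>u\<bar> / pi" using u by (intro sin_ge_linear) auto
  finally show ?thesis by (simp add: u_def)
qed

text \<open>Mean value theorem between v and the nearest integer. Moving the derivative bound from
  the intermediate point x to v costs the factor 3, since |v| <= |x| + 1, and the distance to the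
  integer is at most |sin(pi v)|. This sine later cancels the bound 1/|sin(pi v)| of the Poisson
  kernel.\<close>

lemma gauss_diff_bound:
  assumes t: "t > 0"
  shows "\<exists>C\<ge>0. \<forall>v. \<bar>indicator {0..} v * gauss t v - step_gauss t v\<bar> \<le> C * \<bar>sin (pi * v)\<bar> / (1 + v^2)"
proof -
  define a where "a = pi * t"
  have a: "a > 0" using t by (simp add: a_def)
  define K where "K = 2 * a * (1 + 2 / a^2)"
  have K: "K \<ge> 0" using a by (simp add: K_def)
  have "\<bar>gauss t v - gauss t (real (nat (round v)))\<bar> \<le> (3 * K) * \<bar>sin (pi * v)\<bar> / (1 + v^2)" if v: "v \<ge> 0" for v
  proof -
    define n where "n = real_of_int (round v)"
    have n: "real (nat (round v)) = n" using v round_mono[of 0 v] by (simp add: n_def)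
    have vn: "\<bar>v - n\<bar> \<le> 1/2" unfolding n_def using of_int_round_abs_le[of v] by (simp add: abs_minus_commute)
    have "norm (gauss t v - gauss t n) \<le> (3 * K / (1 + v^2)) * norm (v - n)"
    proof (rule field_differentiable_bound)
      show "convex {n - 1/2..n + 1/2}" by simp
      show "(gauss t has_field_derivative - (2 * a * x * exp (- a * x^2))) (at x within {n - 1/2..n + 1/2})" for x
        unfolding gauss_def a_def by (auto intro!: derivative_eq_intros simp: algebra_simps power2_eq_square)
      show "v \<in> {n - 1/2..n + 1/2}" "n \<in> {n - 1/2..n + 1/2}"
        using abs_le_D1[OF vn] abs_le_D2[OF vn] by auto
      fix x assume x: "x \<in> {n - 1/2..n + 1/2}"
      have "\<bar>v\<bar> \<le> \<bar>x\<bar> + 1" using x abs_le_D1[OF vn] abs_le_D2[OF vn] by auto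
      hence "v^2 \<le> (\<bar>x\<bar> + 1)^2" by (metis abs_ge_zero power2_abs power_mono)
      also have "\<dots> \<le> 2 * x^2 + 2" using zero_le_power2[of "\<bar>x\<bar> - 1"]
        by (simp add: power2_sum power2_diff)
      finally have "1 + v^2 \<le> 3 * (1 + x^2)" using zero_le_power2[of x] unfolding distrib_left by linarith
      hence "K / (1 + x^2) \<le> 3 * K / (1 + v^2)"
        using K mult_left_mono[of "1 + v^2" "3 * (1 + x^2)" K]
        by (simp add: divide_simps add_pos_nonneg add_nonneg_eq_0_iff) (auto simp: algebra_simps)
      thus "norm (- (2 * a * x * exp (- a * x^2))) \<le> 3 * K / (1 + v^2)"
        using gauss_deriv_bound[OF a, of x] by (simp add: K_def)
    qed
    also have "\<dots> \<le> (3 * K / (1 + v^2)) * \<bar>sin (pi * v)\<bar>"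
      using abs_sin_pi_ge[of v] K by (intro mult_left_mono) (auto simp: n_def intro!: divide_nonneg_nonneg)
    finally show ?thesis by (simp add: n)
  qed
  hence "\<forall>v. \<bar>indicator {0..} v * gauss t v - step_gauss t v\<bar> \<le> (3 * K) * \<bar>sin (pi * v)\<bar> / (1 + v^2)"
    using K by (auto simp: step_gauss_def indicator_def)
  thus ?thesis using K by (intro exI[of _ "3 * K"]) auto
qed

text \<open>Real part of 2/(1 - z) - 1 at z = r exp(2 pi i v). Writing 1 - cos as twice a squared
  sine exhibits the concentration of the kernel at the integers.\<close>

lemma poisson_kernel_sums:
  assumes r: "0 \<le> r" "r < 1"
  shows "(\<lambda>m. (if m = 0 then 1 else 2) * r ^ m * cos_mode m v) sums
           ((1 - r^2) / ((1 - r)^2 + 4 * r * (sin (pi * v))^2))"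
proof -
  define z where "z = of_real r * cis (2 * pi * v)"
  define c where "c = cos (2 * pi * v)"
  have nz: "norm z < 1" using r by (simp add: z_def norm_mult)
  hence z1: "1 - z \<noteq> 0" by auto
  have "(\<lambda>m. z ^ m) sums (1 / (1 - z))" by (rule geometric_sums[OF nz])
  hence "(\<lambda>m. Re (z ^ m)) sums Re (1 / (1 - z))" by (rule sums_Re)
  moreover have "Re (z ^ m) = r ^ m * cos_mode m v" for m
    by (simp add: z_def power_mult_distrib Complex.DeMoivre flip: of_real_power) (simp add: algebra_simps)
  ultimately have S: "(\<lambda>m. r ^ m * cos_mode m v) sums Re (1 / (1 - z))" by simp
  have D: "(1 - r)^2 + 4 * r * (sin (pi * v))^2 = 1 - 2 * r * c + r^2"
  proof -
    have c: "c = 1 - 2 * (sin (pi * v))^2"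
      using cos_double_sin[of "pi * v"] by (simp add: c_def mult_ac)
    thus ?thesis unfolding c by (simp add: power2_eq_square algebra_simps)
  qed
  have "Re (1 / (1 - z)) = (1 - r * c) / (1 - 2 * r * c + r^2)"
  proof -
    have zc: "Re (1 - z) = 1 - r * c" "Im (1 - z) = - (r * sin (2 * pi * v))"
      by (simp_all add: z_def c_def)
    have "(Re (1 - z))^2 + (Im (1 - z))^2 = 1 - 2 * r * c + r^2 * (c^2 + (sin (2 * pi * v))^2)"
      unfolding zc by (simp add: power2_eq_square algebra_simps)
    also have "c^2 + (sin (2 * pi * v))^2 = 1" by (simp add: c_def)
    finally have "(Re (1 - z))^2 + (Im (1 - z))^2 = 1 - 2 * r * c + r^2" by simp
    thus ?thesis unfolding c_def by (simp add: Re_divide z_def)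
  qed
  moreover have pos: "1 - 2 * r * c + r^2 > 0"
    unfolding D[symmetric] using r by (intro add_pos_nonneg) auto
  ultimately have "2 * Re (1 / (1 - z)) - 1 = (1 - r^2) / (1 - 2 * r * c + r^2)"
    by (simp add: field_simps)
  moreover have "(\<lambda>m. 2 * (r ^ m * cos_mode m v) - (if m = 0 then 1 else 0)) sums (2 * Re (1 / (1 - z)) - 1)"
    by (intro sums_diff sums_mult S) (use sums_single[of 0 "\<lambda>_. 1::real"] in auto)
  moreover have "(\<lambda>m. 2 * (r ^ m * cos_mode m v) - (if m = 0 then 1 else 0)) =
    (\<lambda>m. (if m = 0 then 1 else 2) * r ^ m * cos_mode m v)" by (auto simp: fun_eq_iff)
  ultimately show ?thesis unfolding D by simp
qed

text \<open>A bound uniform in r: 1 - r^2 <= 2 (1 - r), and 2 (1 - r) |s| <= (1 - r)^2 + s^2, where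
  r >= 1/4 makes s^2 <= 4 r s^2.\<close>

lemma poisson_kernel_bound:
  fixes r s :: real
  assumes r: "1/4 \<le> r" "r < 1" and s: "s \<noteq> 0"
  shows "\<bar>(1 - r^2) / ((1 - r)^2 + 4 * r * s^2)\<bar> \<le> 1 / \<bar>s\<bar>"
proof -
  have "2 * (1 - r) * \<bar>s\<bar> \<le> (1 - r)^2 + s^2" using sum_squares_bound[of "1 - r" "\<bar>s\<bar>"] by simp
  moreover have "s^2 \<le> 4 * r * s^2" using r by (simp add: mult_le_cancel_right1)
  moreover have "(1 - r^2) * \<bar>s\<bar> \<le> 2 * (1 - r) * \<bar>s\<bar>"
  proof (rule mult_right_mono)
    show "1 - r^2 \<le> 2 * (1 - r)" using zero_le_power2[of "r - 1"] by (simp add: power2_diff)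
  qed auto
  moreover have "1 - r^2 \<ge> 0" using r by (simp add: power_le_one)
  moreover have "(1 - r)^2 + 4 * r * s^2 > 0" using r by (intro add_pos_nonneg) auto
  moreover from calculation have "(1 - r^2) * \<bar>s\<bar> \<le> 1 * ((1 - r)^2 + 4 * r * s^2)"
  proof -
    have "(1 - r^2) * \<bar>s\<bar> \<le> 2 * (1 - r) * \<bar>s\<bar>" by fact
    also have "\<dots> \<le> (1 - r)^2 + s^2" by fact
    also have "\<dots> \<le> (1 - r)^2 + 4 * r * s^2" using \<open>s^2 \<le> 4 * r * s^2\<close> by (rule add_left_mono)
    finally show ?thesis by (simp only: mult_1)
  qed
  ultimately have "(1 - r^2) * \<bar>s\<bar> \<le> 1 * ((1 - r)^2 + 4 * r * s^2)" "1 - r^2 \<ge> 0"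
      "(1 - r)^2 + 4 * r * s^2 > 0" by blast+
  thus ?thesis using s by (subst abs_of_nonneg) (auto simp: frac_le_eq divide_le_eq pos_le_divide_eq mult_ac)
qed

text \<open>Half of the theta series without its constant term: theta(t) = 1 + 2
  \<open>psi t\<close>.\<close>

definition psi :: "real \<Rightarrow> real" where
  "psi t = (\<Sum>n. gauss t (real (Suc n)))"

text \<open>Poisson summation by Abel means. Integrated over a cell, the Poisson kernel has the same mass as the
  point evaluation at the integer in it, so \<open>e\<close>, the Gaussian minus its step version, has the Fourier
  coefficients \<open>J m\<close> that compare the two sides. The kernel tends to \<open>0\<close> off the integers as \<open>r\<close> tends
  to \<open>1\<close>, and \<open>e\<close> vanishes at the integers to first order, which provides the dominating function.\<close>

theorem theta_identity:
  assumes t: "t > 0"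
  shows "1 + 2 * psi t = (1 + 2 * psi (1 / t)) / sqrt t"
proof -
  define e where "e = (\<lambda>v. indicator {0..} v * gauss t v - step_gauss t v)"
  define w where "w = (\<lambda>m::nat. if m = 0 then 1 else (2::real))"
  define J where "J = (\<lambda>m::nat. gauss (1 / t) (real m) / sqrt t / 2 - (if m \<noteq> 0 then 0 else 1/2 + psi t))"
  define P where "P = (\<lambda>r v. (1 - r^2) / ((1 - r)^2 + 4 * r * (sin (pi * v))^2))"
  obtain C where C: "C \<ge> 0" "\<And>v. \<bar>e v\<bar> \<le> C * \<bar>sin (pi * v)\<bar> / (1 + v^2)"
    using gauss_diff_bound[OF t] unfolding e_def by blast
  have eJ: "has_bochner_integral lborel (\<lambda>v. e v * cos_mode m v) (J m)" for m
  proof -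
    have "has_bochner_integral lborel (\<lambda>v. indicator {0..} v * (gauss t v * cos_mode m v))
        (gauss (1 / t) (real m) / sqrt t / 2)"
      by (rule has_bochner_integral_half_line_of_even[OF gauss_cos_integral[OF t]]) (simp add: gauss_def)
    from has_bochner_integral_diff[OF this step_gauss_cos_integral[OF t, of m]]
    have "has_bochner_integral lborel (\<lambda>v. indicator {0..} v * (gauss t v * cos_mode m v) -
        step_gauss t v * cos_mode m v) (J m)"
      unfolding J_def psi_def .
    thus ?thesis unfolding e_def by (simp add: left_diff_distrib mult.assoc)
  qed
  have e_int: "integrable lborel e" using eJ[of 0] by (simp add: has_bochner_integral_iff)
  have sumJ: "(\<lambda>m. w m * r ^ m * J m) sums (\<integral>v. e v * P r v \<partial>lborel)" if r: "0 \<le> r" "r < 1" for r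
  proof -
    let ?f = "\<lambda>m v. w m * r ^ m * (e v * cos_mode m v)"
    have sw: "summable (\<lambda>m. w m * r ^ m)"
      by (rule summable_comparison_test[of _ "\<lambda>m. 2 * r ^ m"])
         (use r in \<open>auto simp: w_def intro!: summable_mult summable_geometric exI[of _ 0]\<close>)
    have bd: "norm (?f m v) \<le> w m * r ^ m * \<bar>e v\<bar>" for m v
    proof -
      have "\<bar>e v\<bar> * \<bar>cos_mode m v\<bar> \<le> \<bar>e v\<bar>" by (intro mult_left_le) auto
      hence "w m * r ^ m * (\<bar>e v\<bar> * \<bar>cos_mode m v\<bar>) \<le> w m * r ^ m * \<bar>e v\<bar>"
        using r by (intro mult_left_mono) (auto simp: w_def)
      thus ?thesis using r by (simp add: w_def abs_mult)
    qed
    have i: "integrable lborel (?f m)" for m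
      using eJ[of m] by (intro integrable_mult_right) (auto simp: has_bochner_integral_iff)
    have "(\<lambda>m. integral\<^sup>L lborel (?f m)) sums (\<integral>v. (\<Sum>m. ?f m v) \<partial>lborel)"
    proof (rule sums_integral[OF i])
      show "AE v in lborel. summable (\<lambda>m. norm (?f m v))"
        using bd by (intro AE_I2 summable_comparison_test[OF _ summable_mult2[OF sw]]) (auto intro!: exI[of _ 0])
      have "(\<integral>v. norm (?f m v) \<partial>lborel) \<le> w m * r ^ m * (\<integral>v. \<bar>e v\<bar> \<partial>lborel)" for m
      proof -
        have "(\<integral>v. norm (?f m v) \<partial>lborel) \<le> (\<integral>v. w m * r ^ m * \<bar>e v\<bar> \<partial>lborel)"
          using bd i e_int by (intro integral_mono integrable_norm integrable_mult_right integrable_abs) auto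
        thus ?thesis by simp
      qed
      thus "summable (\<lambda>m. \<integral>v. norm (?f m v) \<partial>lborel)"
        by (intro summable_comparison_test[OF _ summable_mult2[OF sw]])
           (auto intro!: exI[of _ 0] simp: abs_of_nonneg integral_nonneg)
    qed
    moreover have "(\<lambda>m. integral\<^sup>L lborel (?f m)) = (\<lambda>m. w m * r ^ m * J m)"
      using eJ by (auto simp: has_bochner_integral_iff fun_eq_iff)
    moreover have "(\<Sum>m. ?f m v) = e v * P r v" for v
    proof -
      have "(\<lambda>m. e v * (w m * r ^ m * cos_mode m v)) sums (e v * P r v)"
        unfolding P_def w_def by (intro sums_mult poisson_kernel_sums r)
      thus ?thesis by (simp add: sums_iff mult_ac)
    qed
    ultimately show ?thesis by (simp del: integral_mult_right_zero)
  qed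
  \<comment> \<open>Tends to 1 from below and starts at 1/2, so the kernel bound for r >= 1/4
    applies to every k.\<close>
  define r where "r = (\<lambda>k::nat. 1 - inverse (real k + 2))"
  have r: "1/4 \<le> r k" "r k < 1" "0 \<le> r k" for k by (auto simp: r_def field_simps)
  have r1: "r \<longlonglongrightarrow> 1"
  proof -
    have "(\<lambda>k. 1 - inverse (real (k + 2))) \<longlonglongrightarrow> 1 - 0"
      by (intro tendsto_diff tendsto_const LIMSEQ_ignore_initial_segment[OF lim_inverse_n[where 'a = real]])
    thus ?thesis by (simp add: r_def add.commute)
  qed
  have "(\<lambda>k. \<integral>v. e v * P (r k) v \<partial>lborel) \<longlonglongrightarrow> (\<integral>v. 0 \<partial>(lborel :: real measure))"
  proof (rule integral_dominated_convergence[where w = "\<lambda>v. C * inverse (1 + v^2)"])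
    show "integrable lborel (\<lambda>v. C * inverse (1 + v^2))"
      using integrable_inverse_1_plus_square by (simp add: set_integrable_def)
    have em: "e \<in> borel_measurable lborel" using e_int by auto
    show "(\<lambda>v. e v * P (r k) v) \<in> borel_measurable lborel" for k
      using em unfolding P_def by measurable
    show "AE v in lborel. (\<lambda>k. e v * P (r k) v) \<longlonglongrightarrow> 0"
    proof (rule AE_I2)
      fix v :: real
      show "(\<lambda>k. e v * P (r k) v) \<longlonglongrightarrow> 0"
      proof (cases "sin (pi * v) = 0")
        case True
        hence "e v = 0" using C(2)[of v] by simp
        thus ?thesis by simp
      next
        case False
        hence "(\<lambda>k. e v * P (r k) v) \<longlonglongrightarrow> e v * ((1 - 1^2) / ((1 - 1)^2 + 4 * 1 * (sin (pi * v))^2))"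
          unfolding P_def by (intro tendsto_intros r1) auto
        thus ?thesis by simp
      qed
    qed
    show "AE v in lborel. norm (e v * P (r k) v) \<le> C * inverse (1 + v^2)" for k
    proof (rule AE_I2)
      fix v :: real
      show "norm (e v * P (r k) v) \<le> C * inverse (1 + v^2)"
      proof (cases "sin (pi * v) = 0")
        case True
        hence "e v = 0" using C(2)[of v] by simp
        thus ?thesis using C by simp
      next
        case False
        have "norm (e v * P (r k) v) \<le> (C * \<bar>sin (pi * v)\<bar> / (1 + v^2)) * (1 / \<bar>sin (pi * v)\<bar>)"
          unfolding norm_mult P_def real_norm_def abs_mult
          by (intro mult_mono C poisson_kernel_bound r False) (use C in auto)
        also have "\<dots> = C * inverse (1 + v^2)" using False by (simp add: field_simps)
        finally show ?thesis .
      qed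
    qed
  qed auto
  hence lim0: "(\<lambda>k. \<Sum>m. w m * r k ^ m * J m) \<longlonglongrightarrow> 0"
    using sumJ[OF r(3) r(2)] by (simp add: sums_iff)
  have sg: "summable (\<lambda>m. gauss (1 / t) (real m))" using t by (intro summable_gauss) auto
  have sJ: "summable (\<lambda>m. w m * \<bar>J m\<bar>)"
  proof (subst summable_iff_shift[of _ 1, symmetric])
    have "summable (\<lambda>m. gauss (1 / t) (real (m + 1)) / sqrt t)"
      using sg by (intro summable_divide) (subst summable_iff_shift)
    thus "summable (\<lambda>m. w (m + 1) * \<bar>J (m + 1)\<bar>)"
      using t by (simp add: w_def J_def gauss_def)
  qed
  \<comment> \<open>The same Abel means, now evaluated on the coefficient side: \<open>J m\<close>
    is Gaussian in m for m >= 1, so the limit may be taken termwise. Equating it with the limit 0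
    found above is the theta identity.\<close>
  have "(\<lambda>k. \<Sum>m. w m * r k ^ m * J m) \<longlonglongrightarrow> (\<Sum>m. w m * J m)"
  proof (rule tannerys_theorem[THEN conjunct2, THEN conjunct2, OF _ _ sJ])
    fix m show "(\<lambda>k. w m * r k ^ m * J m) \<longlonglongrightarrow> w m * J m"
      using tendsto_intros r1 by (auto intro!: tendsto_eq_intros r1)
  next
    have "norm (w m * r k ^ m * J m) \<le> w m * \<bar>J m\<bar>" for m k
    proof -
      have "r k ^ m \<le> 1" using r by (intro power_le_one) (auto simp: less_imp_le)
      hence "w m * r k ^ m \<le> w m * 1" by (intro mult_left_mono) (auto simp: w_def)
      hence "w m * r k ^ m * \<bar>J m\<bar> \<le> w m * \<bar>J m\<bar>" by (intro mult_right_mono) auto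
      thus ?thesis using r(3)[of k] by (simp add: abs_mult w_def)
    qed
    thus "\<forall>\<^sub>F (m, k) in sequentially \<times>\<^sub>F sequentially. norm (w m * r k ^ m * J m) \<le> w m * \<bar>J m\<bar>"
      by (intro always_eventually) auto
  qed auto
  with lim0 have "(\<Sum>m. w m * J m) = 0" by (rule LIMSEQ_unique[symmetric])
  moreover have "(\<Sum>m. w m * J m) = J 0 + (\<Sum>m. w (Suc m) * J (Suc m))"
  proof -
    have "summable (\<lambda>m. norm (w m * J m))" using sJ by (simp add: abs_mult w_def)
    hence "summable (\<lambda>m. w m * J m)" by (rule summable_norm_cancel)
    thus ?thesis by (subst suminf_split_head) (auto simp: w_def)
  qed
  moreover have "(\<Sum>m. w (Suc m) * J (Suc m)) = psi (1 / t) / sqrt t"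
  proof -
    have "summable (\<lambda>m. gauss (1 / t) (real (Suc m)))" using sg by (rule summable_Suc_iff[THEN iffD2])
    from suminf_divide[OF this, of "sqrt t"] show ?thesis by (simp add: psi_def w_def J_def)
  qed
  ultimately have "J 0 + psi (1 / t) / sqrt t = 0" by simp
  thus ?thesis using t by (simp add: J_def gauss_def field_simps)
qed

section \<open>The entire function behind \<open>\<xi>\<close>\<close>

lemma summable_gauss_Suc: "t > 0 \<Longrightarrow> summable (\<lambda>n. gauss t (real (Suc n)))"
  using summable_gauss[of t] by (subst summable_Suc_iff)

lemma psi_nonneg: "t > 0 \<Longrightarrow> psi t \<ge> 0"
  unfolding psi_def by (intro suminf_nonneg summable_gauss_Suc) (auto simp: gauss_def)

text \<open>Comparing n^2 with n gives a geometric series with ratio q = exp(-pi x), of sum at most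
  2 q. The inequalities pi x >= 2 + x and e^2 >= 4 give q <= exp(-x) / 4.\<close>

lemma psi_le:
  assumes x: "x \<ge> 1"
  shows "psi x \<le> exp (- x)"
proof -
  define q where "q = exp (- pi * x)"
  have pix: "pi * x \<ge> 2 + x"
  proof -
    have "(pi - 1) * x \<ge> 2 * 1" using x pi_gt3 by (intro mult_mono) auto
    thus ?thesis by (simp add: algebra_simps)
  qed
  have e2: "exp (2::real) \<ge> 4" using exp_lower_Taylor_quadratic[of 2] by simp
  have q: "q > 0" "q \<le> exp (- x) / 4"
  proof -
    have "q \<le> exp (- 2 - x)" unfolding q_def using pix by simp
    also have "\<dots> = exp (- x) / exp 2" by (simp add: exp_diff exp_minus field_simps)
    also have "\<dots> \<le> exp (- x) / 4" using e2 by (intro divide_left_mono) auto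
    finally show "q \<le> exp (- x) / 4" .
  qed (simp add: q_def)
  have "exp (- x) \<le> 1" using x by simp
  hence q4: "q \<le> 1 / 4" using q by linarith
  have "psi x \<le> (\<Sum>n. q * q ^ n)" unfolding psi_def
  proof (rule suminf_le)
    show "summable (\<lambda>n. gauss x (real (Suc n)))" using x by (intro summable_gauss_Suc) auto
    show "summable (\<lambda>n. q * q ^ n)" using q q4 by (intro summable_mult summable_geometric) auto
    show "gauss x (real (Suc n)) \<le> q * q ^ n" for n
    proof -
      have "real (Suc n) * 1 \<le> real (Suc n) * real (Suc n)" by (intro mult_left_mono) auto
      hence "(pi * x) * real (Suc n) \<le> (pi * x) * (real (Suc n))^2"
        using x by (intro mult_left_mono) (auto simp: power2_eq_square)
      hence "gauss x (real (Suc n)) \<le> exp (real (Suc n) * (- pi * x))" by (simp add: gauss_def mult_ac)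
      also have "\<dots> = q ^ Suc n" unfolding q_def by (rule exp_of_nat_mult)
      finally show ?thesis by simp
    qed
  qed
  also have "\<dots> = q * (1 / (1 - q))" using q q4
    by (subst suminf_mult) (auto simp: suminf_geometric intro!: summable_geometric)
  also have "\<dots> \<le> q * 2" using q q4 by (intro mult_left_mono) (auto simp: field_simps)
  also have "\<dots> \<le> exp (- x)" using q by simp
  finally show ?thesis .
qed

lemma continuous_on_psi:
  assumes "a > 0"
  shows "continuous_on {a..} psi"
proof (rule uniform_limit_theorem)
  show "uniform_limit {a..} (\<lambda>n x. \<Sum>i<n. gauss x (real (Suc i))) psi sequentially"
    unfolding psi_def
  proof (rule Weierstrass_m_test)
    show "summable (\<lambda>n. gauss a (real (Suc n)))" using assms by (rule summable_gauss_Suc)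
    show "norm (gauss x (real (Suc n))) \<le> gauss a (real (Suc n))" if "x \<in> {a..}" for n x
      using that assms by (auto simp: gauss_def intro!: mult_right_mono)
  qed
  show "\<forall>\<^sub>F n in sequentially. continuous_on {a..} (\<lambda>x. \<Sum>i<n. gauss x (real (Suc i)))"
    unfolding gauss_def by (intro always_eventually allI continuous_intros)
qed auto

text \<open>Substituting \<open>x = e\<^sup>2\<^sup>u\<close> in Riemann's integral turns the inversion \<open>x \<mapsto> 1/x\<close> into the reflection
  \<open>u \<mapsto> -u\<close>; this is the theta kernel in the variable \<open>u\<close>, Jacobian included.\<close>

definition xi_kernel :: "real \<Rightarrow> real" where
  "xi_kernel u = 2 * exp (u / 2) * psi (exp (2 * u))"

lemma xi_kernel_nonneg: "xi_kernel u \<ge> 0"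
  by (simp add: xi_kernel_def psi_nonneg)

lemma continuous_on_xi_kernel [continuous_intros]: "continuous_on A xi_kernel"
proof -
  have "isCont xi_kernel u" for u
  proof -
    have "continuous_on {exp (2 * u) / 2..} psi" by (intro continuous_on_psi) auto
    hence "continuous_on {exp (2 * u) / 2<..} psi" by (rule continuous_on_subset) auto
    hence "isCont psi (exp (2 * u))"
      by (simp add: continuous_on_eq_continuous_at)
    hence "isCont (\<lambda>u. psi (exp (2 * u))) u"
      by (intro isCont_o2[where g = psi and f = "\<lambda>u. exp (2 * u)"] continuous_intros) auto
    thus ?thesis unfolding xi_kernel_def by (intro continuous_intros) auto
  qed
  thus ?thesis by (simp add: continuous_at_imp_continuous_on)
qed

lemma borel_measurable_xi_kernel [measurable]: "xi_kernel \<in> borel_measurable borel"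
  by (intro borel_measurable_continuous_onI continuous_intros)

text \<open>The double exponential exp(-exp(2u)) beats every Gaussian: exp(2u) exceeds its cubic
  Taylor polynomial, and A u^2 <= A^3 + u^3, by cases on u <= A. Having every rate A is what later
  gives \<open>Xi_growth\<close> for every e > 0.\<close>

lemma xi_kernel_decay:
  assumes A: "A \<ge> 0"
  shows "\<exists>C\<ge>0. \<forall>u\<ge>0. xi_kernel u \<le> C * exp (- A * u^2)"
proof -
  have "xi_kernel u \<le> (2 * exp (A ^ 3)) * exp (- A * u^2)" if u: "u \<ge> 0" for u
  proof -
    have "xi_kernel u \<le> 2 * exp (u / 2) * exp (- exp (2 * u))"
      unfolding xi_kernel_def using u by (intro mult_left_mono psi_le) auto
    also have "\<dots> = 2 * exp (u / 2 - exp (2 * u))" by (simp flip: exp_add)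
    also have "u / 2 - exp (2 * u) \<le> A ^ 3 - A * u^2"
    proof -
      have "(\<Sum>i\<le>3. (2 * u) ^ i /\<^sub>R fact i) \<le> (\<Sum>i. (2 * u) ^ i /\<^sub>R fact i)"
        by (rule sum_le_suminf[OF summable_exp_generic]) (use u in auto)
      hence "(\<Sum>i\<le>3. (2 * u) ^ i /\<^sub>R fact i) \<le> exp (2 * u)" by (simp add: exp_def)
      hence "1 + 2 * u + 2 * u^2 + 4 / 3 * u ^ 3 \<le> exp (2 * u)"
        by (simp add: eval_nat_numeral fact_numeral field_simps)
      moreover have "A * u^2 \<le> A ^ 3 + u ^ 3"
      proof (cases "u \<le> A")
        case True
        hence "A * u^2 \<le> A * A^2" using u A by (intro mult_left_mono power_mono) auto
        thus ?thesis using u by (simp add: power3_eq_cube power2_eq_square add_increasing2)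
      next
        case False
        hence "A * u^2 \<le> u * u^2" using u A by (intro mult_right_mono) auto
        thus ?thesis using A by (simp add: power3_eq_cube power2_eq_square add_increasing)
      qed
      moreover have "u ^ 3 \<ge> 0" "u^2 \<ge> 0" using u by auto
      ultimately show ?thesis using u by linarith
    qed
    finally show ?thesis by (simp add: exp_diff exp_minus field_simps)
  qed
  thus ?thesis by (intro exI[of _ "2 * exp (A ^ 3)"]) auto
qed

section \<open>Riemann's integral as an entire function\<close>

lemma integrable_gauss: "a > 0 \<Longrightarrow> integrable lborel (\<lambda>u::real. exp (- a * u^2))"
  using gauss_cos_integral[of "a / pi" 0] by (simp add: has_bochner_integral_iff gauss_def)

abbreviation kernel_exp :: "real \<Rightarrow> real \<Rightarrow> real" where
  "kernel_exp r u \<equiv> indicator {0..} u * (xi_kernel u * exp (r * u))"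

lemma integrable_xi_kernel_exp:
  "integrable lborel (\<lambda>u. kernel_exp r u)"
proof -
  obtain C where C: "C \<ge> 0" "\<And>u. u \<ge> 0 \<Longrightarrow> xi_kernel u \<le> C * exp (- 2 * u^2)"
    using xi_kernel_decay[of 2] by auto
  show ?thesis
  proof (rule Bochner_Integration.integrable_bound)
    show "integrable lborel (\<lambda>u::real. C * exp (r^2 / 4) * exp (- 1 * u^2))"
      by (intro integrable_mult_right integrable_gauss) auto
    show "AE u in lborel. norm (kernel_exp r u)
       \<le> norm (C * exp (r^2 / 4) * exp (- 1 * u^2))"
    proof (intro AE_I2)
      fix u :: real
      show "norm (kernel_exp r u) \<le> norm (C * exp (r^2 / 4) * exp (- 1 * u^2))"
      proof (cases "u \<ge> 0")
        case True
        have "xi_kernel u * exp (r * u) \<le> C * exp (- 2 * u^2) * exp (r * u)"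
          using C True by (intro mult_right_mono) auto
        also have "\<dots> = C * exp (- 2 * u^2 + r * u)" by (simp flip: exp_add)
        also have "- 2 * u^2 + r * u \<le> r^2 / 4 + - 1 * u^2"
          using zero_le_power2[of "u - r / 2"] by (simp add: power2_diff power_divide algebra_simps)
        hence "C * exp (- 2 * u^2 + r * u) \<le> C * exp (r^2 / 4 + - 1 * u^2)"
          using C by (intro mult_left_mono) auto
        also have "\<dots> = C * exp (r^2 / 4) * exp (- 1 * u^2)" by (simp flip: exp_add)
        finally show ?thesis using True C by (simp add: xi_kernel_nonneg)
      qed auto
    qed
  qed measurable
qed

abbreviation xi_integrand :: "complex \<Rightarrow> real \<Rightarrow> complex" where
  "xi_integrand s u \<equiv>
     indicator {0..} u *\<^sub>R (complex_of_real (xi_kernel u) * (exp (s * of_real u) + exp (- s * of_real u)))"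

text \<open>The completed zeta-function pi^(-z/2) Gamma(z/2) zeta(z) at z = 1/2 + s, minus its polar
  part. Folding the line onto u >= 0 pairs the exponentials into 2 cosh(s u), which makes evenness
  visible.\<close>

definition xi_integral :: "complex \<Rightarrow> complex" where
  "xi_integral s = (\<integral>u. xi_integrand s u \<partial>lborel)"

lemma norm_exp_plus_exp_minus_le:
  assumes "u \<ge> 0" "\<bar>Re s\<bar> \<le> r"
  shows "norm (exp (s * of_real u) + exp (- s * of_real u)) \<le> 2 * exp (r * u)"
proof -
  have "norm (exp (s * of_real u) + exp (- s * of_real u)) \<le> exp (Re s * u) + exp (- Re s * u)"
    by (rule order_trans[OF norm_triangle_ineq]) simp
  also have "\<dots> \<le> exp (r * u) + exp (r * u)"
    using assms mult_right_mono[of "Re s" r u] mult_right_mono[of "- Re s" r u]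
    by (intro add_mono) (auto simp: abs_le_iff)
  finally show ?thesis by simp
qed

lemma integrable_xi_integrand:
  "integrable lborel (\<lambda>u. xi_integrand s u)"
proof (rule Bochner_Integration.integrable_bound)
  show "integrable lborel (\<lambda>u. 2 * (indicator {0..} u * (xi_kernel u * exp (\<bar>Re s\<bar> * u))))"
    by (intro integrable_mult_right integrable_xi_kernel_exp)
  show "AE u in lborel. norm (xi_integrand s u)
          \<le> norm (2 * (indicator {0..} u * (xi_kernel u * exp (\<bar>Re s\<bar> * u))))"
  proof (intro AE_I2)
    fix u :: real
    show "norm (xi_integrand s u)
          \<le> norm (2 * (indicator {0..} u * (xi_kernel u * exp (\<bar>Re s\<bar> * u))))"
      using mult_left_mono[OF norm_exp_plus_exp_minus_le[of u s "\<bar>Re s\<bar>"] xi_kernel_nonneg[of u]] xi_kernel_nonneg[of u]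
      by (cases "u \<ge> 0") (auto simp: norm_mult mult_ac)
  qed
qed measurable

lemma norm_xi_integral_le:
  assumes "\<bar>Re s\<bar> \<le> r"
  shows "norm (xi_integral s) \<le> 2 * (\<integral>u. kernel_exp r u \<partial>lborel)"
proof -
  have "norm (xi_integral s) \<le> (\<integral>u. norm (xi_integrand s u) \<partial>lborel)"
    unfolding xi_integral_def by (rule integral_norm_bound)
  also have "\<dots> \<le> (\<integral>u. 2 * (kernel_exp r u) \<partial>lborel)"
  proof (rule integral_mono)
    show "integrable lborel (\<lambda>u. norm (xi_integrand s u))"
      by (rule integrable_norm[OF integrable_xi_integrand])
    show "integrable lborel (\<lambda>u. 2 * (kernel_exp r u))"
      by (intro integrable_mult_right integrable_xi_kernel_exp)
    fix u :: real
    show "norm (xi_integrand s u)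
          \<le> 2 * (kernel_exp r u)"
      using mult_left_mono[OF norm_exp_plus_exp_minus_le[of u s r] xi_kernel_nonneg[of u]] assms xi_kernel_nonneg[of u]
      by (cases "u \<ge> 0") (auto simp: norm_mult mult_ac)
  qed
  finally show ?thesis by simp
qed

lemma xi_integral_even: "xi_integral (- s) = xi_integral s"
  unfolding xi_integral_def by (simp add: add.commute)

text \<open>A locally uniform limit of the integrals over [0, n], each holomorphic by
  differentiation under the integral. Near s0 all tails are dominated by the tail of the single
  convergent integral with exponent r = |Re s0| + 1.\<close>

lemma holomorphic_xi_integral: "xi_integral holomorphic_on UNIV"
proof (rule holomorphic_uniform_sequence)
  define h where "h = (\<lambda>s u. complex_of_real (xi_kernel u) * (exp (s * of_real u) + exp (- s * of_real u)))"
  define F where "F = (\<lambda>n s. integral (cbox 0 (real n)) (h s))"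
  have cont: "continuous_on A (\<lambda>u. complex_of_real (xi_kernel u))" for A
    by (intro continuous_intros)
  show "F n holomorphic_on UNIV" for n
    unfolding F_def
  proof (rule leibniz_rule_holomorphic)
    fix s :: complex and u :: real
    show "((\<lambda>s. h s u) has_field_derivative
            complex_of_real (xi_kernel u) * (of_real u * exp (s * of_real u) - of_real u * exp (- s * of_real u))) (at s within UNIV)"
      unfolding h_def by (auto intro!: derivative_eq_intros simp: algebra_simps)
    show "h s integrable_on cbox 0 (real n)"
      unfolding h_def by (intro integrable_continuous continuous_intros cont)
    have "continuous_on (UNIV \<times> cbox 0 (real n)) (\<lambda>x::complex \<times> real. xi_kernel (snd x))"
      by (intro continuous_on_compose2[OF continuous_on_xi_kernel[of UNIV]] continuous_intros) auto
    thus "continuous_on (UNIV \<times> cbox 0 (real n)) (\<lambda>(s, u). complex_of_real (xi_kernel u) * (of_real u * exp (s * of_real u) - of_real u * exp (- s * of_real u)))"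
      unfolding case_prod_beta by (intro continuous_intros)
  qed auto
  fix s0 :: complex
  define r where "r = \<bar>Re s0\<bar> + 1"
  define G where "G = (\<lambda>u. 2 * (xi_kernel u * exp (r * u)))"
  let ?I = "\<lambda>n. LINT u:{0..real n}|lborel. G u" and ?J = "LINT u:{0..}|lborel. G u"
    and ?T = "\<lambda>n::nat. LINT u:{real n<..}|lborel. G u"
  have Gint: "set_integrable lborel {0..} G"
    using integrable_mult_right[OF integrable_xi_kernel_exp[of r], of 2]
    by (simp add: set_integrable_def G_def mult_ac)
  have G0: "G u \<ge> 0" for u by (simp add: G_def xi_kernel_nonneg)
  have "((\<lambda>b. LINT u:{0..b}|lborel. G u) \<longlongrightarrow> (?J)) at_top"
    by (rule tendsto_set_lebesgue_integral_at_top[OF _ Gint]) auto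
  hence lim: "(\<lambda>n. ?I n) \<longlonglongrightarrow> (?J)"
    by (rule filterlim_compose[OF _ filterlim_real_sequentially])
  have hint: "set_integrable lborel {0..} (h s)" for s
    using integrable_xi_integrand[of s] by (simp add: set_integrable_def h_def)
  have "uniform_limit (cball s0 1) F xi_integral sequentially"
  proof (rule uniform_limitI)
    fix e :: real assume e: "e > 0"
    from lim have "eventually (\<lambda>n. dist (?I n) (?J) < e) sequentially"
      using e by (rule tendstoD)
    thus "\<forall>\<^sub>F n in sequentially. \<forall>s\<in>cball s0 1. dist (F n s) (xi_integral s) < e"
    proof eventually_elim
      case (elim n)
      show ?case
      proof
        fix s assume s: "s \<in> cball s0 1"
        hence "\<bar>Re s\<bar> \<le> r"
          unfolding r_def using abs_Re_le_cmod[of "s0 - s"] by (auto simp: dist_norm)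
        hence bd: "norm (h s u) \<le> G u" if "u \<ge> 0" for u
          using mult_left_mono[OF norm_exp_plus_exp_minus_le[OF that, of s r] xi_kernel_nonneg[of u]] xi_kernel_nonneg[of u]
          by (simp add: h_def G_def norm_mult mult_ac)
        have split: "{0..} = {0..real n} \<union> {real n<..}" by auto
        have sub: "set_integrable lborel {0..real n} (h s)" "set_integrable lborel {real n<..} (h s)"
             "set_integrable lborel {0..real n} G" "set_integrable lborel {real n<..} G"
          by (rule set_integrable_subset[OF hint] set_integrable_subset[OF Gint]; auto)+
        have "xi_integral s = (LINT u:{0..}|lborel. h s u)"
          by (simp add: xi_integral_def set_lebesgue_integral_def h_def)
        also have "\<dots> = (LINT u:{0..real n}|lborel. h s u) + (LINT u:{real n<..}|lborel. h s u)"
          unfolding split by (rule set_integral_Un) (use sub in auto)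
        also have "(LINT u:{0..real n}|lborel. h s u) = F n s"
          unfolding F_def using set_borel_integral_eq_integral(2)[OF sub(1)] by simp
        finally have "dist (F n s) (xi_integral s) = norm (LINT u:{real n<..}|lborel. h s u)"
          by (simp add: dist_norm)
        also have "\<dots> \<le> (?T n)"
          unfolding set_lebesgue_integral_def
        proof (rule Bochner_Integration.integral_norm_bound_integral)
          show "integrable lborel (\<lambda>u. indicator {real n<..} u *\<^sub>R h s u)" "integrable lborel (\<lambda>u. indicator {real n<..} u *\<^sub>R G u)"
            using sub unfolding set_integrable_def by auto
        qed (use bd in \<open>auto simp: indicator_def\<close>)
        also have "(?J) = (?I n) + (?T n)"
          unfolding split by (rule set_integral_Un) (use sub in auto)
        hence "(?T n) \<le> dist (?I n) (?J)"
          by (simp add: dist_norm)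
        also have "\<dots> < e" by (rule elim)
        finally show "dist (F n s) (xi_integral s) < e" .
      qed
    qed
  qed
  thus "\<exists>d>0. cball s0 d \<subseteq> UNIV \<and> uniform_limit (cball s0 d) F xi_integral sequentially"
    by (intro exI[of _ 1]) auto
qed auto

section \<open>Mellin transform of the theta kernel over the whole line\<close>

lemma nn_integral_exp_exp:
  assumes c: "c > 0"
  shows "(\<integral>\<^sup>+u. ennreal (exp (c * u) * exp (- exp u)) \<partial>lborel) = ennreal (Gamma c)"
proof -
  define f where "f = (\<lambda>t::real. t powr (c - 1) / exp t)"
  have "(f has_integral Gamma c) {0<..}"
    using Gamma_integral_real[OF c] unfolding f_def
    by (subst has_integral_spike_set_eq[of _ "{0..}"]) (auto intro: negligible_subset[of "{0}"])
  moreover have f0: "f t \<ge> 0" for t by (simp add: f_def)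
  ultimately have "f absolutely_integrable_on {0<..} \<and> integral {0<..} f = Gamma c"
    by (auto intro!: nonnegative_absolutely_integrable_1)
  moreover have "range exp = {0::real<..}"
  proof (intro equalityI subsetI)
    fix x :: real assume "x \<in> {0<..}"
    hence "x = exp (ln x)" by simp
    thus "x \<in> range exp" by blast
  qed auto
  ultimately have "(\<lambda>u. \<bar>exp u\<bar> * f (exp u)) absolutely_integrable_on UNIV \<and>
      integral UNIV (\<lambda>u. \<bar>exp u\<bar> * f (exp u)) = Gamma c"
    by (subst has_absolute_integral_change_of_variables_1')
       (auto intro!: derivative_eq_intros simp: inj_on_def)
  hence "((\<lambda>u. \<bar>exp u\<bar> * f (exp u)) has_integral Gamma c) UNIV"
    using absolutely_integrable_on_def by (auto simp: has_integral_iff)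
  hence "((\<lambda>u. exp (c * u) * exp (- exp u)) has_integral Gamma c) UNIV"
    by (simp add: f_def powr_def exp_diff exp_minus field_simps)
  from nn_integral_has_integral_lebesgue[OF _ this] show ?thesis by simp
qed

text \<open>Euler's integral in the variable exp(u), after the substitution u -> ln a + 2u. For a =
  pi n^2 it is the Mellin transform of one theta term.\<close>

lemma nn_integral_gauss_exp:
  assumes c: "c > 0" and a: "a > 0"
  shows "(\<integral>\<^sup>+u. ennreal (2 * exp (2 * c * u) * exp (- a * exp (2 * u))) \<partial>lborel) = ennreal (Gamma c * a powr (- c))"
proof -
  let ?I = "\<integral>\<^sup>+u. ennreal (2 * exp (2 * c * u) * exp (- a * exp (2 * u))) \<partial>lborel"
  have "ennreal (Gamma c) = (\<integral>\<^sup>+u. ennreal (exp (c * u) * exp (- exp u)) \<partial>lborel)"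
    by (rule nn_integral_exp_exp[OF c, symmetric])
  also have "\<dots> = ennreal \<bar>2\<bar> * (\<integral>\<^sup>+u. ennreal (exp (c * (ln a + 2 * u)) * exp (- exp (ln a + 2 * u))) \<partial>lborel)"
    by (rule nn_integral_real_affine) auto
  also have "\<dots> = (\<integral>\<^sup>+u. ennreal (a powr c) * ennreal (2 * exp (2 * c * u) * exp (- a * exp (2 * u))) \<partial>lborel)"
  proof (subst nn_integral_cmult[symmetric], measurable, rule nn_integral_cong)
    fix u :: real
    have "\<bar>2\<bar> * (exp (c * (ln a + 2 * u)) * exp (- exp (ln a + 2 * u))) =
        a powr c * (2 * exp (2 * c * u) * exp (- a * exp (2 * u)))"
      using a by (simp add: powr_def exp_add algebra_simps)
    thus "ennreal \<bar>2\<bar> * ennreal (exp (c * (ln a + 2 * u)) * exp (- exp (ln a + 2 * u))) =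
        ennreal (a powr c) * ennreal (2 * exp (2 * c * u) * exp (- a * exp (2 * u)))"
      by (subst (1 2) ennreal_mult'[symmetric]) auto
  qed
  also have "\<dots> = ennreal (a powr c) * ?I"
    by (rule nn_integral_cmult) measurable
  finally have "ennreal (a powr (- c)) * ennreal (Gamma c) =
     ennreal (a powr (- c)) * (ennreal (a powr c) * ?I)"
    by simp
  also have "\<dots> = ?I"
    using a by (simp add: mult.assoc[symmetric] ennreal_mult'[symmetric] powr_add[symmetric])
  finally show ?thesis using a c by (simp add: ennreal_mult'[symmetric] Gamma_real_pos less_imp_le mult.commute)
qed

text \<open>All terms are nonnegative, so sum and integral may be exchanged before integrability is
  known; the finite value then yields integrability.\<close>

lemma nn_integral_xi_kernel_exp:
  assumes s: "s > 1 / 2"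
  shows "(\<integral>\<^sup>+u. ennreal (xi_kernel u * exp (s * u)) \<partial>lborel) =
    ennreal (pi powr (- (s + 1/2) / 2) * Gamma ((s + 1/2) / 2) * (\<Sum>n. real (Suc n) powr (- (s + 1/2))))"
proof -
  let ?S = "\<Sum>n. real (Suc n) powr (- (s + 1/2))"
  define c where "c = (s + 1/2) / 2"
  have c: "c > 0" using s by (simp add: c_def)
  let ?t = "\<lambda>n u. 2 * exp (2 * c * u) * exp (- (pi * (real (Suc n))^2) * exp (2 * u))"
  have "ennreal (xi_kernel u * exp (s * u)) = (\<Sum>n. ennreal (?t n u))" for u
  proof -
    have "(\<lambda>n. (2 * exp (u / 2) * exp (s * u)) * gauss (exp (2 * u)) (real (Suc n))) sums
        ((2 * exp (u / 2) * exp (s * u)) * psi (exp (2 * u)))"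
      unfolding psi_def by (intro sums_mult summable_sums summable_gauss_Suc) auto
    moreover have "(2 * exp (u / 2) * exp (s * u)) * gauss (exp (2 * u)) (real (Suc n)) = ?t n u" for n
    proof -
      have "exp (2 * c * u) = exp (u / 2) * exp (s * u)"
        unfolding c_def exp_add[symmetric] by (rule arg_cong[where f = exp]) (simp add: algebra_simps)
      thus ?thesis by (simp add: gauss_def mult_ac)
    qed
    ultimately have "(\<lambda>n. ?t n u) sums (xi_kernel u * exp (s * u))"
      by (simp add: xi_kernel_def mult_ac)
    hence "(\<Sum>n. ennreal (?t n u)) = ennreal (xi_kernel u * exp (s * u))"
      by (intro suminf_ennreal_eq) auto
    thus ?thesis ..
  qed
  hence "(\<integral>\<^sup>+u. ennreal (xi_kernel u * exp (s * u)) \<partial>lborel) = (\<integral>\<^sup>+u. (\<Sum>n. ennreal (?t n u)) \<partial>lborel)"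
    by simp
  also have "\<dots> = (\<Sum>n. \<integral>\<^sup>+u. ennreal (?t n u) \<partial>lborel)"
    by (rule nn_integral_suminf) measurable
  also have "\<dots> = (\<Sum>n. ennreal (Gamma c * (pi * (real (Suc n))^2) powr (- c)))"
    by (intro suminf_cong nn_integral_gauss_exp c) (simp add: zero_less_power2)
  also have "\<dots> = ennreal (pi powr (- c) * Gamma c * ?S)"
  proof (rule suminf_ennreal_eq)
    have "summable (\<lambda>n. real n powr (- (s + 1/2)))" using s by (subst summable_real_powr_iff) auto
    hence "summable (\<lambda>n. real (Suc n) powr (- (s + 1/2)))" by (rule summable_Suc_iff[THEN iffD2])
    from sums_mult[OF summable_sums[OF this], of "pi powr (- c) * Gamma c"]
    have "(\<lambda>n. pi powr (- c) * Gamma c * real (Suc n) powr (- (s + 1/2))) sums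
      (pi powr (- c) * Gamma c * ?S)" .
    moreover have "pi powr (- c) * Gamma c * real (Suc n) powr (- (s + 1/2)) = Gamma c * (pi * (real (Suc n))^2) powr (- c)" for n
    proof -
      have "((real (Suc n))^2) powr (- c) = real (Suc n) powr (- (s + 1/2))"
      proof -
        have "(real (Suc n))^2 = real (Suc n) powr 2" by (simp add: powr_numeral)
        moreover have "2 * (- c) = - (s + 1/2)" by (simp add: c_def field_simps)
        ultimately show ?thesis by (simp only: powr_powr)
      qed
      thus ?thesis by (simp add: powr_mult)
    qed
    ultimately show "(\<lambda>n. Gamma c * (pi * (real (Suc n))^2) powr (- c)) sums
      (pi powr (- c) * Gamma c * ?S)" by (simp only:)
    show "0 \<le> Gamma c * (pi * (real (Suc n))^2) powr (- c)" for n
      using Gamma_real_pos[OF c] by simp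
  qed
  finally show ?thesis by (simp only: c_def minus_divide_left)
qed

text \<open>The theta identity at t = exp(2u). The two exponentials come from the constant term of
  theta on either side and become the polar terms of the completed zeta-function.\<close>

lemma xi_kernel_minus: "xi_kernel (- u) = xi_kernel u + exp (u / 2) - exp (- u / 2)"
proof -
  have e: "sqrt (exp (2 * u)) = exp u" by (rule real_sqrt_unique) (auto simp flip: exp_double)
  have "1 + 2 * psi (exp (2 * u)) = (1 + 2 * psi (exp (- 2 * u))) / exp u"
    using theta_identity[of "exp (2 * u)"] e by (simp add: exp_minus inverse_eq_divide)
  hence "1 + 2 * psi (exp (- 2 * u)) = exp u * (1 + 2 * psi (exp (2 * u)))"
    by (simp add: field_simps)
  hence "exp (- u / 2) * (1 + 2 * psi (exp (- 2 * u))) = (exp (- u / 2) * exp u) * (1 + 2 * psi (exp (2 * u)))"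
    by simp
  moreover have "exp (- u / 2) * exp u = exp (u / 2)" by (simp flip: exp_add)
  ultimately show ?thesis by (simp add: xi_kernel_def algebra_simps)
qed

lemma has_bochner_integral_exp_neg:
  assumes b: "b > 0"
  shows "has_bochner_integral lborel (\<lambda>u. indicator {0..} u * exp (- b * u)) (1 / b :: real)"
proof -
  have "(\<integral>\<^sup>+u. ennreal (exp (- b * u)) * indicator {0..} u \<partial>lborel) = ennreal (0 - (- exp (- b * 0) / b))"
  proof (rule nn_integral_FTC_atLeast)
    show "((\<lambda>u. - exp (- b * u) / b) \<longlongrightarrow> 0) at_top" using b by real_asymp
  qed (use b in \<open>auto intro!: derivative_eq_intros\<close>)
  hence "(\<integral>\<^sup>+u. ennreal (indicator {0..} u * exp (- b * u)) \<partial>lborel) = ennreal (1 / b)"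
    by (simp add: ennreal_mult' mult.commute flip: ennreal_indicator)
  thus ?thesis using b by (intro has_bochner_integral_nn_integral) auto
qed

lemma xi_integral_of_real:
  "xi_integral (of_real x) = of_real ((\<integral>u. kernel_exp x u \<partial>lborel) +
      (\<integral>u. kernel_exp (- x) u \<partial>lborel))"
proof -
  have "xi_integral (of_real x) = (\<integral>u. of_real (kernel_exp x u + kernel_exp (- x) u) \<partial>lborel)"
    unfolding xi_integral_def
    by (intro Bochner_Integration.integral_cong) (auto simp: indicator_def algebra_simps exp_of_real[symmetric])
  also have "\<dots> = of_real (\<integral>u. kernel_exp x u + kernel_exp (- x) u \<partial>lborel)"
    by (rule integral_complex_of_real)
  also have "(\<integral>u. kernel_exp x u + kernel_exp (- x) u \<partial>lborel) =
    (\<integral>u. kernel_exp x u \<partial>lborel) +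
      (\<integral>u. kernel_exp (- x) u \<partial>lborel)"
    by (rule Bochner_Integration.integral_add[OF integrable_xi_kernel_exp integrable_xi_kernel_exp])
  finally show ?thesis .
qed

text \<open>The integral of \<open>xi_kernel u * exp (s * u)\<close> over the whole line is the
  right-hand side. Reflecting its half u <= 0 by \<open>xi_kernel_minus\<close> gives the second
  half of \<open>xi_integral\<close> and two exponential integrals, convergent for s > 1/2, which
  are the polar terms.\<close>

theorem xi_integral_zeta_real:
  assumes s: "s > 1 / 2"
  shows "xi_integral (of_real s) + 1 / (of_real s - 1/2) - 1 / (of_real s + 1/2) =
     of_real (pi powr (- (s + 1/2) / 2) * Gamma ((s + 1/2) / 2) * (\<Sum>n. real (Suc n) powr (- (s + 1/2))))"
proof -
  let ?n = "\<lambda>u::real. indicator {..0} u * (xi_kernel u * exp (s * u))"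
  define R where "R = pi powr (- (s + 1/2) / 2) * Gamma ((s + 1/2) / 2) * (\<Sum>n. real (Suc n) powr (- (s + 1/2)))"
  define I1 where "I1 = (\<integral>u. kernel_exp s u \<partial>lborel)"
  define I2 where "I2 = (\<integral>u. kernel_exp (- s) u \<partial>lborel)"
  have h1: "has_bochner_integral lborel (\<lambda>u. kernel_exp s u) I1"
    unfolding I1_def using integrable_xi_kernel_exp[of s] by (simp add: has_bochner_integral_iff)
  have h2: "has_bochner_integral lborel (\<lambda>u. kernel_exp (- s) u) I2"
    unfolding I2_def using integrable_xi_kernel_exp[of "- s"] by (simp add: has_bochner_integral_iff)
  have "has_bochner_integral lborel (\<lambda>u. kernel_exp (- s) u +
      indicator {0..} u * exp (- (s - 1/2) * u) - indicator {0..} u * exp (- (s + 1/2) * u)) (I2 + 1 / (s - 1/2) - 1 / (s + 1/2))"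
    by (intro has_bochner_integral_add has_bochner_integral_diff h2 has_bochner_integral_exp_neg) (use s in auto)
  moreover have "kernel_exp (- s) u +
      indicator {0..} u * exp (- (s - 1/2) * u) - indicator {0..} u * exp (- (s + 1/2) * u) =
      indicator {..0} (- u) * (xi_kernel (- u) * exp (s * (- u)))" for u :: real
  proof -
    have "exp (- (s - 1/2) * u) = exp (u / 2) * exp (- s * u)" "exp (- (s + 1/2) * u) = exp (- u / 2) * exp (- s * u)"
      by (auto simp: algebra_simps simp flip: exp_add)
    thus ?thesis by (simp add: xi_kernel_minus indicator_def algebra_simps)
  qed
  ultimately have "has_bochner_integral lborel (\<lambda>u. indicator {..0} (0 + (-1) * u) * (xi_kernel (0 + (-1) * u) * exp (s * (0 + (-1) * u))))
      ((I2 + 1 / (s - 1/2) - 1 / (s + 1/2)) /\<^sub>R \<bar>-1\<bar>)" by simp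
  hence "has_bochner_integral lborel (\<lambda>u. ?n u) (I2 + 1 / (s - 1/2) - 1 / (s + 1/2))"
    by (subst lborel_has_bochner_integral_real_affine_iff[where c = "-1" and t = 0]) auto
  from has_bochner_integral_add[OF h1 this]
  have "has_bochner_integral lborel (\<lambda>u. kernel_exp s u + ?n u)
       (I1 + (I2 + 1 / (s - 1/2) - 1 / (s + 1/2)))" .
  hence "has_bochner_integral lborel (\<lambda>u. xi_kernel u * exp (s * u)) (I1 + (I2 + 1 / (s - 1/2) - 1 / (s + 1/2)))"
  proof (rule has_bochner_integral_cong_AE[THEN iffD1, rotated 3])
    show "AE u in lborel. kernel_exp s u + ?n u = xi_kernel u * exp (s * u)"
      using AE_lborel_singleton[of 0] by eventually_elim (auto simp: indicator_def)
  qed measurable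
  moreover have "has_bochner_integral lborel (\<lambda>u. xi_kernel u * exp (s * u)) R"
  proof (rule has_bochner_integral_nn_integral)
    show "(\<integral>\<^sup>+u. ennreal (xi_kernel u * exp (s * u)) \<partial>lborel) = ennreal R"
      unfolding R_def by (rule nn_integral_xi_kernel_exp[OF s])
    show "0 \<le> R" unfolding R_def using s Gamma_real_pos[of "(s + 1/2) / 2"]
      summable_Suc_iff[THEN iffD2, of "\<lambda>n. real n powr (- (s + 1/2))"]
      by (intro mult_nonneg_nonneg suminf_nonneg) (auto simp: summable_real_powr_iff)
  qed (auto simp: xi_kernel_nonneg)
  ultimately have "R = I1 + (I2 + 1 / (s - 1/2) - 1 / (s + 1/2))" by (auto simp: has_bochner_integral_iff)
  hence "complex_of_real R = of_real (I1 + I2) + 1 / (of_real s - 1/2) - 1 / (of_real s + 1/2)" by simp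
  thus ?thesis by (simp add: xi_integral_of_real I1_def I2_def R_def)
qed

section \<open>Analytic continuation of \<open>\<zeta>\<close>\<close>

text \<open>The factor s(s - 1) turns the polar part 1/(s - 1) - 1/s into the constant 1, so the
  expression is visibly entire.\<close>

definition big_xi :: "complex \<Rightarrow> complex" where
  "big_xi s = 1 + s * (s - 1) * xi_integral (s - 1 / 2)"

text \<open>\<open>big_xi\<close> is \<open>2\<xi>\<close>, and \<open>s \<Gamma>(s/2)\<close> is written as \<open>2 \<Gamma>(s/2 + 1)\<close>, so that \<open>1\<close> is the only singular
  point; there the division by \<open>0\<close> gives \<open>zeta_cont 1 = 0\<close>, as the definition of \<open>zeta\<close> demands.\<close>

definition zeta_cont :: "complex \<Rightarrow> complex" where
  "zeta_cont s = big_xi s * of_real pi powr (s / 2) * rGamma (s / 2 + 1) / (2 * (s - 1))"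

lemma holomorphic_xi_integral_compose [holomorphic_intros]:
  "f holomorphic_on A \<Longrightarrow> (\<lambda>s. xi_integral (f s)) holomorphic_on A"
  using holomorphic_on_compose_gen[of f A xi_integral UNIV] holomorphic_xi_integral by (simp add: o_def)

lemma holomorphic_big_xi [holomorphic_intros]: "big_xi holomorphic_on A"
  unfolding big_xi_def by (intro holomorphic_intros)

lemma holomorphic_zeta_cont: "zeta_cont holomorphic_on (- {1})"
  unfolding zeta_cont_def by (intro holomorphic_intros) auto

section \<open>Agreement of the continuation with the Dirichlet series\<close>

definition dirichlet_zeta :: "complex \<Rightarrow> complex" where
  "dirichlet_zeta s = (\<Sum>n. 1 / of_nat (Suc n) powr s)"

lemma norm_dirichlet_term: "norm (1 / of_nat (Suc n) powr s :: complex) = real (Suc n) powr (- Re s)"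
proof -
  have "norm (of_nat (Suc n) powr s :: complex) = real (Suc n) powr Re s"
    using norm_powr_real_powr[of "of_nat (Suc n)" s] by simp
  thus ?thesis by (simp add: norm_divide powr_minus inverse_eq_divide)
qed

lemma summable_Suc_powr: "x > 1 \<Longrightarrow> summable (\<lambda>n. real (Suc n) powr (- x))"
  using summable_Suc_iff[of "\<lambda>n. real n powr (- x)"] by (simp add: summable_real_powr_iff)

lemma dirichlet_zeta_sums:
  assumes "Re s > 1"
  shows "(\<lambda>n. 1 / of_nat (Suc n) powr s) sums dirichlet_zeta s"
  unfolding dirichlet_zeta_def
proof (rule summable_sums, rule summable_norm_cancel)
  show "summable (\<lambda>n. norm (1 / of_nat (Suc n) powr s :: complex))"
    unfolding norm_dirichlet_term by (rule summable_Suc_powr[OF assms])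
qed

lemma holomorphic_dirichlet_zeta: "dirichlet_zeta holomorphic_on {s. Re s > 1}"
proof (rule holomorphic_uniform_sequence)
  show op: "open {s. Re s > 1}" by (rule open_halfspace_Re_gt)
  show "(\<lambda>s. \<Sum>i<n. 1 / of_nat (Suc i) powr s) holomorphic_on {s. Re s > 1}" for n
    by (intro holomorphic_intros) auto
  fix s0 assume s0: "s0 \<in> {s. Re s > 1}"
  define d where "d = (Re s0 - 1) / 2"
  have d: "d > 0" using s0 by (simp add: d_def)
  have re: "Re s \<ge> 1 + d" if "s \<in> cball s0 d" for s
    using that abs_Re_le_cmod[of "s0 - s"] by (auto simp: dist_norm d_def field_simps abs_le_iff)
  have "uniform_limit (cball s0 d) (\<lambda>n s. \<Sum>i<n. 1 / of_nat (Suc i) powr s) dirichlet_zeta sequentially"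
    unfolding dirichlet_zeta_def
  proof (rule Weierstrass_m_test)
    show "summable (\<lambda>n. real (Suc n) powr (- (1 + d)))" using d by (intro summable_Suc_powr) auto
    fix n s assume "s \<in> cball s0 d"
    from re[OF this] show "norm (1 / of_nat (Suc n) powr s :: complex) \<le> real (Suc n) powr (- (1 + d))"
      unfolding norm_dirichlet_term by (intro powr_mono) auto
  qed
  thus "\<exists>d>0. cball s0 d \<subseteq> {s. Re s > 1} \<and> uniform_limit (cball s0 d) (\<lambda>n s. \<Sum>i<n. 1 / of_nat (Suc i) powr s) dirichlet_zeta sequentially"
    using d re by (intro exI[of _ d]) force
qed

lemma big_xi_real:
  assumes x: "x > 1"
  shows "big_xi (of_real x) = of_real (x * (x - 1) * pi powr (- x / 2) * Gamma (x / 2)) * dirichlet_zeta (of_real x)"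
proof -
  define S where "S = (\<Sum>n. real (Suc n) powr (- x))"
  have "(\<lambda>n. complex_of_real (real (Suc n) powr (- x))) sums of_real S"
    unfolding S_def by (intro sums_of_real summable_sums summable_Suc_powr x)
  moreover have "complex_of_real (real (Suc n) powr (- x)) = 1 / of_nat (Suc n) powr (of_real x)" for n
    using powr_of_real[of "real (Suc n)" x] by (simp add: powr_minus inverse_eq_divide)
  ultimately have D: "dirichlet_zeta (of_real x) = of_real S"
    unfolding dirichlet_zeta_def by (simp only: sums_iff)
  define a where "a = complex_of_real (pi powr (- x / 2) * Gamma (x / 2) * S)"
  define X where "X = complex_of_real x"
  have X: "X \<noteq> 1" "X \<noteq> 0" using x by (auto simp: X_def)
  have "xi_integral (X - 1/2) + 1 / (X - 1) - 1 / X = a"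
    using xi_integral_zeta_real[of "x - 1 / 2"] x by (simp add: S_def a_def X_def)
  hence h1: "X * (X - 1) * (xi_integral (X - 1/2) + 1 / (X - 1) - 1 / X) = X * (X - 1) * a" by simp
  have h2: "X * (X - 1) * (xi_integral (X - 1/2) + 1 / (X - 1) - 1 / X) =
      X * (X - 1) * xi_integral (X - 1/2) + X - (X - 1)"
    using X by (simp add: field_simps)
  have "big_xi X = X * (X - 1) * a" unfolding h1[symmetric] h2 big_xi_def by simp
  thus ?thesis unfolding D X_def a_def by (simp add: mult_ac)
qed

lemma zeta_cont_real:
  assumes x: "x > 1"
  shows "zeta_cont (of_real x) = dirichlet_zeta (of_real x)"
proof -
  have G: "rGamma (of_real x / 2 + 1 :: complex) = of_real (2 / (x * Gamma (x / 2)))"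
  proof -
    have "Gamma (x / 2 + 1) = x / 2 * Gamma (x / 2)" using x by (intro Gamma_plus1) auto
    hence "rGamma (x / 2 + 1) = inverse (x / 2 * Gamma (x / 2))" by (simp only: rGamma_inverse_Gamma)
    hence "rGamma (x / 2 + 1) = 2 / (x * Gamma (x / 2))" by (simp add: inverse_eq_divide)
    thus ?thesis using rGamma_complex_of_real[of "x / 2 + 1"] by simp
  qed
  have P: "of_real pi powr (of_real x / 2 :: complex) = of_real (pi powr (x / 2))"
    using powr_of_real[of pi "x / 2"] by simp
  have "pi powr (x / 2) * pi powr (- x / 2) = 1" by (simp flip: powr_add)
  moreover have "Gamma (x / 2) \<noteq> 0" using x Gamma_real_pos[of "x / 2"] by linarith
  ultimately have "x * (x - 1) * pi powr (- x / 2) * Gamma (x / 2) * pi powr (x / 2) * (2 / (x * Gamma (x / 2))) = 2 * (x - 1)"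
    using x by (simp add: mult_ac)
  hence F: "of_real (x * (x - 1) * pi powr (- x / 2) * Gamma (x / 2)) * of_real (pi powr (x / 2)) *
     of_real (2 / (x * Gamma (x / 2))) = (of_real (2 * (x - 1)) :: complex)"
    unfolding of_real_mult[symmetric] by (rule arg_cong)
  have "zeta_cont (of_real x) = of_real (x * (x - 1) * pi powr (- x / 2) * Gamma (x / 2)) * of_real (pi powr (x / 2)) *
     of_real (2 / (x * Gamma (x / 2))) * dirichlet_zeta (of_real x) / (2 * (of_real x - 1))"
    unfolding zeta_cont_def big_xi_real[OF x] P G by (simp only: mult_ac)
  also have "\<dots> = dirichlet_zeta (of_real x)" unfolding F using x by simp
  finally show ?thesis .
qed

text \<open>Identity theorem in the half-plane: the real integral formula gives agreement on the ray
  x > 1, which accumulates at the interior point 2.\<close>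

lemma zeta_cont_eq_dirichlet:
  assumes "Re s > 1"
  shows "zeta_cont s = dirichlet_zeta s"
proof -
  define S where "S = {s. Re s > 1}"
  have "zeta_cont s - dirichlet_zeta s = 0"
  proof (rule analytic_continuation[where f = "\<lambda>s. zeta_cont s - dirichlet_zeta s" and w = s and S = S and U = "complex_of_real ` {1<..}" and \<xi> = 2])
    show "(\<lambda>s. zeta_cont s - dirichlet_zeta s) holomorphic_on S"
      unfolding S_def
      by (intro holomorphic_intros holomorphic_dirichlet_zeta holomorphic_on_subset[OF holomorphic_zeta_cont]) auto
    show "open S" unfolding S_def by (rule open_halfspace_Re_gt)
    show "connected S" unfolding S_def by (intro convex_connected convex_halfspace_Re_gt)
    show "2 islimpt complex_of_real ` {1<..}"
    proof (rule islimptI)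
      fix T :: "complex set" assume T: "2 \<in> T" "open T"
      then obtain e where e: "e > 0" "ball 2 e \<subseteq> T" by (auto simp: open_contains_ball)
      have "complex_of_real (2 + e / 2) \<in> ball 2 e" using e by (simp add: dist_norm)
      moreover have "complex_of_real (2 + e / 2) \<in> complex_of_real ` {1<..}" using e by (intro imageI) auto
      moreover have "complex_of_real (2 + e / 2) \<noteq> 2" using e by simp
      ultimately show "\<exists>y\<in>complex_of_real ` {1<..}. y \<in> T \<and> y \<noteq> 2" using e by blast
    qed
  qed (use assms zeta_cont_real in \<open>auto simp: S_def\<close>)
  thus ?thesis by simp
qed

text \<open>The punctured plane is connected, so any two candidates in the description agree off 1,
  and their values at 1 are prescribed.\<close>

theorem zeta_eq_zeta_cont: "zeta = zeta_cont"
  unfolding zeta_def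
proof (rule the_equality)
  show *: "zeta_cont holomorphic_on - {1} \<and> (\<forall>s. 1 < Re s \<longrightarrow> (\<lambda>n. 1 / of_nat (Suc n) powr s) sums zeta_cont s) \<and> zeta_cont 1 = 0"
    using holomorphic_zeta_cont dirichlet_zeta_sums zeta_cont_eq_dirichlet by (auto simp: zeta_cont_def)
  fix g assume g: "g holomorphic_on - {1} \<and> (\<forall>s. 1 < Re s \<longrightarrow> (\<lambda>n. 1 / of_nat (Suc n) powr s) sums g s) \<and> g 1 = 0"
  show "g = zeta_cont"
  proof
    fix s
    show "g s = zeta_cont s"
    proof (cases "s = 1")
      case False
      have "g s - zeta_cont s = 0"
      proof (rule analytic_continuation_open[where s = "{s. Re s > 1}" and s' = "- {1}" and f = "\<lambda>s. g s - zeta_cont s" and g = "\<lambda>_. 0"])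
        show "open {s. Re s > 1}" by (rule open_halfspace_Re_gt)
        have "2 \<in> {s. Re s > 1}" by simp
        thus "{s. Re s > 1} \<noteq> {}" by blast
        show "connected (- {1::complex})" by (rule connected_punctured_universe) simp
        show "(\<lambda>s. g s - zeta_cont s) holomorphic_on - {1}" using * g by (intro holomorphic_intros) auto
        show "g z - zeta_cont z = 0" if "z \<in> {s. Re s > 1}" for z
          using that * g sums_unique2[of "\<lambda>n. 1 / of_nat (Suc n) powr z" "g z" "zeta_cont z"] by auto
      qed (use False in auto)
      thus ?thesis by simp
    qed (use * g in auto)
  qed
qed

text \<open>The terms of the Dirichlet series after the first have total modulus zeta(2) - 1 =
  pi^2/6 - 1, which is less than 1.\<close>

lemma zeta_2_line_lower: "norm (zeta (2 + \<i> * of_real t)) \<ge> 2 - pi^2 / 6"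
proof -
  let ?s = "2 + \<i> * of_real t"
  let ?f = "\<lambda>n. 1 / of_nat (Suc n) powr ?s :: complex"
  have S: "?f sums zeta ?s"
    using dirichlet_zeta_sums[of ?s] by (simp add: zeta_eq_zeta_cont zeta_cont_eq_dirichlet)
  have n: "norm (?f n) = 1 / (real n + 1)^2" for n
    unfolding norm_dirichlet_term by (simp add: powr_minus inverse_eq_divide powr_numeral add.commute)
  have i: "(\<lambda>n. 1 / (real n + 1)^2) sums (pi^2 / 6)" using inverse_squares_sums by (simp add: add.commute)
  have Sn: "summable (\<lambda>n. norm (?f (Suc n)))" and T: "(\<Sum>n. norm (?f (Suc n))) = pi^2 / 6 - 1"
    unfolding n using i sums_split_initial_segment[OF i, of 1] by (auto simp: sums_iff)
  have "zeta ?s = ?f 0 + (\<Sum>n. ?f (Suc n))"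
    using S suminf_split_head[of ?f] by (simp add: sums_iff)
  hence "norm (zeta ?s) \<ge> 1 - norm (\<Sum>n. ?f (Suc n))"
    using norm_triangle_ineq2[of 1 "- (\<Sum>n. ?f (Suc n))"] by simp
  moreover have "norm (\<Sum>n. ?f (Suc n)) \<le> pi^2 / 6 - 1"
    using summable_norm[OF Sn] T by simp
  ultimately show ?thesis by linarith
qed

section \<open>Identification of \<open>xi\<close>\<close>

lemma a_fun_eq:
  assumes "s / 2 \<notin> \<int>\<^sub>\<le>\<^sub>0"
  shows "a_fun s = 2 * of_real pi powr (- s / 2) * Gamma (s / 2 + 1) * (s - 1)"
  using Gamma_plus1[of "s / 2"] assms by (simp add: a_fun_def mult_ac)

lemma a_fun_zeta:
  assumes "s / 2 \<notin> \<int>\<^sub>\<le>\<^sub>0" "s \<noteq> 1"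
  shows "a_fun s * zeta s = big_xi s"
proof -
  have "s / 2 + 1 \<notin> \<int>\<^sub>\<le>\<^sub>0" using assms(1) plus_one_in_nonpos_Ints_imp by blast
  hence "Gamma (s / 2 + 1) * rGamma (s / 2 + 1) = 1" by (simp add: rGamma_inverse_Gamma Gamma_eq_zero_iff)
  moreover have "of_real pi powr (- s / 2) * of_real pi powr (s / 2) = (1 :: complex)"
    by (simp flip: powr_add)
  moreover have "a_fun s * zeta s = big_xi s * (Gamma (s / 2 + 1) * rGamma (s / 2 + 1)) *
      (of_real pi powr (- s / 2) * of_real pi powr (s / 2)) * ((2 * (s - 1)) / (2 * (s - 1)))"
    unfolding a_fun_eq[OF assms(1)] zeta_eq_zeta_cont zeta_cont_def by (simp only: times_divide_eq_right mult_ac)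
  moreover have "(2 * (s - 1)) / (2 * (s - 1)) = 1" using assms(2) by (intro divide_self) simp
  ultimately show ?thesis by simp
qed

text \<open>\<open>remove_sings\<close> takes a limit at each point. Off the integers, a discrete
  set containing every exceptional point of the formula, it agrees with the continuous function
  \<open>big_xi\<close> / 2.\<close>

theorem xi_eq_big_xi: "2 * xi s = big_xi s"
proof -
  have "xi s = 1 / 2 * big_xi s"
    unfolding xi_def
  proof (rule remove_sings_eqI)
    have "open (- (\<int> - {s}))" by (intro open_Compl closed_subset_Ints) auto
    hence "eventually (\<lambda>z. z \<in> - (\<int> - {s}) - {s}) (at s)" by (intro eventually_at_in_open) auto
    hence ev: "eventually (\<lambda>z. 1 / 2 * big_xi z = 1 / 2 * a_fun z * zeta z) (at s)"
    proof eventually_elim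
      case (elim z)
      have "z / 2 \<notin> \<int>\<^sub>\<le>\<^sub>0"
      proof
        assume "z / 2 \<in> \<int>\<^sub>\<le>\<^sub>0"
        hence "2 * (z / 2) \<in> \<int>" by (intro Ints_mult) (auto dest: nonpos_Ints_Int)
        thus False using elim by auto
      qed
      moreover have "z \<noteq> 1" using elim by auto
      ultimately show ?case using a_fun_zeta[of z] by simp
    qed
    have "isCont big_xi s"
      using holomorphic_big_xi[of UNIV] holomorphic_on_imp_continuous_on continuous_on_eq_continuous_at[OF open_UNIV] by blast
    hence "((\<lambda>z. 1 / 2 * big_xi z) \<longlongrightarrow> 1 / 2 * big_xi s) (at s)"
      by (intro tendsto_intros) (simp add: isCont_def)
    thus "((\<lambda>z. 1 / 2 * a_fun z * zeta z) \<longlongrightarrow> 1 / 2 * big_xi s) (at s)"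
      using ev by (rule Lim_transform_eventually)
  qed
  thus ?thesis by (simp add: mult.commute)
qed

section \<open>Even entire functions with imaginary zeros\<close>

lemma deriv_even_0:
  fixes f :: "complex \<Rightarrow> complex"
  assumes f: "f holomorphic_on ball 0 R" "R > 0" and even: "\<And>s. s \<in> ball 0 R \<Longrightarrow> f (- s) = f s"
  shows "deriv f 0 = 0"
proof -
  have D: "(f has_field_derivative deriv f 0) (at 0)"
    using f by (intro holomorphic_derivI[of f "ball 0 R"]) auto
  have "((\<lambda>s. f (- s)) has_field_derivative deriv f 0 * (- 1)) (at 0)"
    by (rule DERIV_chain2[where f = f and g = uminus]) (use D in \<open>auto intro!: derivative_eq_intros\<close>)
  hence "(f has_field_derivative deriv f 0 * (- 1)) (at 0)"
    by (rule has_field_derivative_transform_within_open[where S = "ball 0 R"]) (use even f in auto)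
  from DERIV_unique[OF D this] show ?thesis by simp
qed

text \<open>The map w -> w/(2A - w) sends the half-plane Re w < A into the unit disc and fixes 0, so
  the Schwarz lemma applies to its composition with f.\<close>

lemma Borel_Caratheodory:
  fixes f :: "complex \<Rightarrow> complex"
  assumes holo: "f holomorphic_on ball 0 R" and R: "R > 0" and f0: "f 0 = 0"
    and A: "A > 0" and re: "\<And>s. norm s < R \<Longrightarrow> Re (f s) < A"
    and s: "norm s < R"
  shows "norm (f s) \<le> 2 * A * norm s / (R - norm s)"
proof -
  define g where "g = (\<lambda>z. f (of_real R * z) / (2 * of_real A - f (of_real R * z)))"
  have Rz: "norm (of_real R * z) < R" if "norm z < 1" for z :: complex
    using that R by (simp add: norm_mult)
  have nz: "2 * of_real A - f (of_real R * z) \<noteq> 0" if "norm z < 1" for z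
  proof
    assume "2 * of_real A - f (of_real R * z) = 0"
    hence "f (of_real R * z) = of_real (2 * A)" by simp
    thus False using re[OF Rz[OF that]] A by simp
  qed
  have "norm (g (s / of_real R)) \<le> norm (s / of_real R)"
  proof (rule Schwarz_Lemma(1))
    have "(\<lambda>z. f (of_real R * z)) holomorphic_on ball 0 1"
      by (rule holomorphic_on_compose_gen[OF _ holo, unfolded o_def])
         (use Rz in \<open>auto intro!: holomorphic_intros\<close>)
    thus "g holomorphic_on ball 0 1"
      unfolding g_def using nz by (intro holomorphic_intros) auto
    show "g 0 = 0" by (simp add: g_def f0)
    show "norm (g z) < 1" if "norm z < 1" for z
    proof -
      define w where "w = f (of_real R * z)"
      have "Re w < A" unfolding w_def by (rule re[OF Rz[OF that]])
      hence "(Re w)^2 < (2 * A - Re w)^2" using A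
        by (simp add: power2_diff power2_eq_square algebra_simps)
      hence lt: "norm w < norm (2 * of_real A - w)" by (simp add: cmod_def)
      hence "norm (2 * of_real A - w) > 0" using norm_ge_zero[of w] by linarith
      hence "norm w / norm (2 * of_real A - w) < 1" using lt by (subst divide_less_eq_1_pos)
      thus ?thesis by (simp add: g_def norm_divide flip: w_def)
    qed
    show "norm (s / of_real R) < 1" using s R by (simp add: norm_divide)
  qed
  moreover have "g (s / of_real R) = f s / (2 * of_real A - f s)" using R by (simp add: g_def)
  moreover have nz': "2 * of_real A - f s \<noteq> 0"
    using nz[of "s / of_real R"] s R by (simp add: norm_divide)
  ultimately have "norm (f s) / norm (2 * of_real A - f s) \<le> norm s / R"
    using R by (simp add: norm_divide)
  hence "R * norm (f s) \<le> norm s * norm (2 * of_real A - f s)"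
    using R nz' by (simp add: field_simps)
  also have "\<dots> \<le> norm s * (2 * A + norm (f s))"
    using norm_triangle_ineq4[of "2 * of_real A" "f s"] A by (intro mult_left_mono) (auto simp: norm_mult)
  finally have "norm (f s) * (R - norm s) \<le> 2 * A * norm s" by (simp add: algebra_simps)
  thus ?thesis using s by (simp add: field_simps)
qed

text \<open>By evenness \<open>ln V\<close> has no linear term at \<open>0\<close>, whence the factor \<open>\<bar>s\<bar>\<^sup>2/R\<^sup>2\<close>: it tends to \<open>0\<close> against
  \<open>ln B = o(R\<^sup>2)\<close>, where the factor \<open>\<bar>s\<bar>/R\<close> of Borel--Caratheodory would not.\<close>

lemma even_nonvanishing_growth:
  fixes V :: "complex \<Rightarrow> complex"
  assumes holo: "V holomorphic_on ball 0 R" and R: "R > 0"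
    and nz: "\<And>s. norm s < R \<Longrightarrow> V s \<noteq> 0" and even: "\<And>s. V (- s) = V s"
    and B: "\<And>s. norm s < R \<Longrightarrow> norm (V s) \<le> B"
    and s: "norm s \<le> R / 4"
  shows "\<bar>ln (norm (V s)) - ln (norm (V 0))\<bar> \<le> 64 * (ln B - ln (norm (V 0)) + 1) * (norm s)^2 / R^2"
proof -
  obtain l where l: "l holomorphic_on ball 0 R" "\<And>z. z \<in> ball 0 R \<Longrightarrow> V z = exp (l z)"
    using contractible_imp_holomorphic_log[OF holo] nz convex_imp_contractible[of "ball (0::complex) R"] by auto
  have ln_V: "ln (norm (V z)) = Re (l z)" if "norm z < R" for z
    using l(2)[of z] that by simp
  define f where "f = (\<lambda>z. l z - l 0)"
  define A where "A = ln B - ln (norm (V 0)) + 1"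
  have "norm (V 0) \<le> B" "norm (V 0) > 0" using B[of 0] nz[of 0] R by auto
  hence "ln (norm (V 0)) \<le> ln B" by (intro ln_mono) auto
  hence A: "A > 0" by (simp add: A_def)
  have hf: "f holomorphic_on ball 0 R" unfolding f_def using l by (intro holomorphic_intros)
  have bd: "norm (f z) \<le> 2 * A" if "norm z \<le> R / 2" for z
  proof -
    have "norm (f z) \<le> 2 * A * norm z / (R - norm z)"
    proof (rule Borel_Caratheodory[OF hf R _ A])
      fix w :: complex assume w: "norm w < R"
      have "ln (norm (V w)) \<le> ln B" using B[OF w] nz[OF w] by (intro ln_mono) auto
      thus "Re (f w) < A" using ln_V[OF w] ln_V[of 0] R by (simp add: f_def A_def)
    qed (use that R in \<open>auto simp: f_def\<close>)
    also have "\<dots> \<le> 2 * A * 1"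
      unfolding times_divide_eq_right[symmetric] using that A R by (intro mult_left_mono) (auto simp: divide_simps)
    finally show ?thesis by simp
  qed
  have "deriv V 0 = 0" by (rule deriv_even_0[OF holo R even])
  have d0: "deriv f 0 = 0"
  proof -
    have D: "(l has_field_derivative deriv l 0) (at 0)"
      using l R by (intro holomorphic_derivI[of l "ball 0 R"]) auto
    have "((\<lambda>z. exp (l z)) has_field_derivative exp (l 0) * deriv l 0) (at 0)"
      using D by (auto intro!: derivative_eq_intros)
    hence "(V has_field_derivative exp (l 0) * deriv l 0) (at 0)"
      by (rule has_field_derivative_transform_within_open[where S = "ball 0 R"]) (use l R in auto)
    hence "exp (l 0) * deriv l 0 = 0" using \<open>deriv V 0 = 0\<close> by (simp add: DERIV_imp_deriv)
    hence "(f has_field_derivative 0) (at 0)" unfolding f_def using D by (auto intro!: derivative_eq_intros)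
    thus ?thesis by (rule DERIV_imp_deriv)
  qed
  \<comment> \<open>Cauchy's estimate on a circle of radius R/4, which stays where |f| <= 2A: the
    constant is 2! * 2 * 4^2 = 64.\<close>
  have d2: "norm ((deriv ^^ 2) f z) \<le> 64 * A / R^2" if z: "norm z \<le> R / 4" for z
  proof -
    have sub: "cball z (R / 4) \<subseteq> ball 0 R"
    proof
      fix w assume "w \<in> cball z (R / 4)"
      thus "w \<in> ball 0 R" using z R norm_triangle_ineq2[of w z] by (simp add: dist_norm norm_minus_commute)
    qed
    have "norm ((deriv ^^ 2) f z) \<le> fact 2 * (2 * A) / (R / 4) ^ 2"
    proof (rule Cauchy_inequality)
      show "f holomorphic_on ball z (R / 4)" by (rule holomorphic_on_subset[OF hf]) (use sub in auto)
      show "continuous_on (cball z (R / 4)) f"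
        by (rule continuous_on_subset[OF holomorphic_on_imp_continuous_on[OF hf]]) (use sub in auto)
      fix w assume "norm (z - w) = R / 4"
      hence "norm w \<le> R / 2" using z norm_triangle_ineq2[of w z] by (simp add: norm_minus_commute)
      thus "norm (f w) \<le> 2 * A" by (rule bd)
    qed (use R in auto)
    also have "\<dots> = 64 * A / R^2" by (simp add: power_divide)
    finally show ?thesis .
  qed
  have "norm ((deriv ^^ 0) f s - (\<Sum>i\<le>1. (deriv ^^ i) f 0 * (s - 0) ^ i / fact i)) \<le> (64 * A / R^2) * norm (s - 0) ^ (Suc 1) / fact 1"
  proof (rule complex_Taylor)
    show "convex (cball (0::complex) (R / 4))" by simp
    fix i and x :: complex assume x: "x \<in> cball 0 (R / 4)"
    have hi: "(deriv ^^ i) f holomorphic_on ball 0 R" by (intro holomorphic_higher_deriv hf) auto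
    have "((deriv ^^ i) f has_field_derivative deriv ((deriv ^^ i) f) x) (at x)"
      using x R by (intro holomorphic_derivI[OF hi]) auto
    thus "((deriv ^^ i) f has_field_derivative (deriv ^^ Suc i) f x) (at x within cball 0 (R / 4))"
      by (auto intro: has_field_derivative_at_within)
  next
    fix x :: complex assume "x \<in> cball 0 (R / 4)"
    thus "norm ((deriv ^^ Suc 1) f x) \<le> 64 * A / R^2" using d2[of x] by (simp add: numeral_2_eq_2)
  qed (use R s in auto)
  hence "norm (f s) \<le> 64 * A / R^2 * (norm s)^2" using d0 by (simp add: power2_eq_square) (simp add: f_def)
  moreover have "\<bar>Re (f s)\<bar> \<le> norm (f s)" by (rule abs_Re_le_cmod)
  moreover have "Re (f s) = ln (norm (V s)) - ln (norm (V 0))"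
    using ln_V[of s] ln_V[of 0] s R by (simp add: f_def)
  ultimately show ?thesis by (simp add: A_def)
qed

section \<open>Division by zeros and Blaschke factors\<close>

lemma entire_divide_zeros:
  assumes "finite S" and "f holomorphic_on UNIV" and "\<And>z. z \<in> S \<Longrightarrow> f z = 0"
  shows "\<exists>k. k holomorphic_on UNIV \<and> (\<forall>s. f s = (\<Prod>z\<in>S. s - z) * k s)"
  using assms
proof (induction S)
  case empty
  thus ?case by auto
next
  case (insert a S)
  then obtain k where k: "k holomorphic_on UNIV" "\<And>s. f s = (\<Prod>z\<in>S. s - z) * k s" by auto
  have "(\<Prod>z\<in>S. a - z) \<noteq> 0" using insert by auto
  moreover have "f a = 0" using insert by auto
  ultimately have ka: "k a = 0" using k by simp
  define h where "h = (\<lambda>z. if z = a then deriv k a else (k z - k a) / (z - a))"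
  have "h holomorphic_on UNIV" unfolding h_def using k by (intro pole_lemma) auto
  moreover have "k s = (s - a) * h s" for s by (auto simp: h_def ka)
  hence "f s = (\<Prod>z\<in>insert a S. s - z) * h s" for s using insert k(2)[of s] by (simp add: mult_ac)
  ultimately show ?case by blast
qed

lemma simple_zero_quotient_nonzero:
  assumes S: "finite S" "z0 \<in> S" and k: "k holomorphic_on UNIV" "\<And>s. f s = (\<Prod>z\<in>S. s - z) * k s"
    and d: "deriv f z0 \<noteq> 0"
  shows "k z0 \<noteq> 0"
proof
  assume "k z0 = 0"
  have f: "f = (\<lambda>s. (s - z0) * ((\<Prod>z\<in>S - {z0}. s - z) * k s))"
    using k(2) S by (auto simp: fun_eq_iff prod.remove[of S z0] mult_ac)
  have "(\<lambda>s. (\<Prod>z\<in>S - {z0}. s - z) * k s) holomorphic_on UNIV"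
    by (intro holomorphic_intros k)
  then obtain D where "((\<lambda>s. (\<Prod>z\<in>S - {z0}. s - z) * k s) has_field_derivative D) (at z0)"
    by (meson UNIV_I holomorphic_derivI open_UNIV)
  hence "(f has_field_derivative (1 - 0) * ((\<Prod>z\<in>S - {z0}. z0 - z) * k z0) + D * (z0 - z0)) (at z0)"
    unfolding f by (intro DERIV_mult derivative_intros)
  hence "deriv f z0 = 0" using \<open>k z0 = 0\<close> by (simp add: DERIV_imp_deriv)
  thus False using d by simp
qed

text \<open>With p = (t - g)^2 and q = (t - b)^2, the squared ratio of distances to ig and ib is
  (x^2 + p)/(x^2 + q), which is nondecreasing in x >= 0 for p <= q. In the application ig is a zero
  and ib its reflection in the circle.\<close>

lemma vertical_ratio_mono:
  fixes g b t x y :: real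
  assumes "0 \<le> x" "x \<le> y" "(t - g)^2 \<le> (t - b)^2"
  shows "norm (Complex x t - \<i> * of_real g) * norm (Complex y t - \<i> * of_real b)
       \<le> norm (Complex y t - \<i> * of_real g) * norm (Complex x t - \<i> * of_real b)"
proof -
  have n: "norm (Complex u t - \<i> * of_real v) = sqrt (u^2 + (t - v)^2)" for u v by (simp add: cmod_def)
  have "(y^2 - x^2) * ((t - b)^2 - (t - g)^2) \<ge> 0"
    using assms by (intro mult_nonneg_nonneg) (auto intro: power_mono)
  hence "(x^2 + (t - g)^2) * (y^2 + (t - b)^2) \<le> (y^2 + (t - g)^2) * (x^2 + (t - b)^2)"
    by (simp add: algebra_simps)
  thus ?thesis unfolding n real_sqrt_mult[symmetric] by (rule real_sqrt_le_mono)
qed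

lemma entire_finite_zeros:
  assumes "f holomorphic_on UNIV" and "f 0 \<noteq> 0"
  shows "finite {s \<in> cball 0 R. f s = 0}"
proof (cases "f constant_on UNIV")
  case True
  hence "f s \<noteq> 0" for s using assms(2) unfolding constant_on_def by (metis UNIV_I)
  hence "{s \<in> cball 0 R. f s = 0} = {}" by simp
  thus ?thesis by (simp only: finite.emptyI)
next
  case False
  show ?thesis by (rule holomorphic_compact_finite_zeros[OF assms(1) _ _ _ _ False]) auto
qed

text \<open>The growth condition bounds ln |E(s)| by an arbitrarily small multiple of |s|^2 plus a
  constant, which the quadratic estimate for even functions can absorb. Simplicity ensures that
  dividing once by each zero leaves a zero-free quotient.\<close>

locale imaginary_zeros =
  fixes E :: "complex \<Rightarrow> complex"
  assumes holo: "E holomorphic_on UNIV"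
    and even: "\<And>s. E (- s) = E s"
    and E0: "E 0 \<noteq> 0"
    and zeros: "\<And>s. E s = 0 \<Longrightarrow> Re s = 0"
    and simple: "\<And>s. E s = 0 \<Longrightarrow> deriv E s \<noteq> 0"
    and growth: "\<And>e. e > 0 \<Longrightarrow> \<exists>C. \<forall>s. norm (E s) \<le> C * exp (e * (norm s)^2)"
begin

lemma zero_imaginary: "E z = 0 \<Longrightarrow> z = \<i> * of_real (Im z)"
  using zeros[of z] by (simp add: complex_eq_iff)

text \<open>\<open>W\<close> is \<open>E\<close> divided by the Blaschke product of its zeros in the disc of radius \<open>R\<close>. It need not be
  even, but \<open>V(s) = W(s) W(-s)\<close> is, and \<open>\<bar>V\<bar> = \<bar>W\<bar>\<^sup>2\<close>. The pole reflected from a zero \<open>i g\<close> is \<open>i b\<close> with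
  \<open>b = R\<^sup>2/g\<close>, so it lies farther from the line \<open>Im s = t\<close> and each Blaschke factor increases with \<open>Re s\<close>.\<close>

lemma blaschke_compare:
  fixes x y t B :: real
  defines "s0 \<equiv> Complex x t" and "s1 \<equiv> Complex y t"
  assumes R: "norm s0 \<le> R / 4" "norm s1 \<le> R / 4" "norm z0 < R"
    and xy: "0 \<le> x" "x \<le> y" and z0: "E z0 = 0" and Es: "E s0 \<noteq> 0" "E s1 \<noteq> 0"
    and B: "\<And>s. norm s \<le> R \<Longrightarrow> norm (E s) \<le> B"
  shows "norm (E s0) * norm (s1 - z0) * norm (1 - cnj z0 * s0 / R^2) \<le>
         norm (E s1) * norm (s0 - z0) * norm (1 - cnj z0 * s1 / R^2) *
         exp (32 * (2 * ln B - 2 * ln (norm (E 0)) + 1) * ((norm s0)^2 + (norm s1)^2) / R^2)"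
proof -
  have Rpos: "R > 0" using R(3) norm_ge_zero[of z0] by linarith
  have t: "2 * \<bar>t\<bar> < R"
  proof -
    have "\<bar>t\<bar> \<le> R / 4" using R(1) abs_Im_le_cmod[of s0] by (simp add: s0_def)
    thus ?thesis using Rpos by simp
  qed
  define S where "S = {z \<in> ball 0 R. E z = 0}"
  have fS: "finite S" by (rule finite_subset[OF _ entire_finite_zeros[OF holo E0, of R]]) (auto simp: S_def)
  have z0S: "z0 \<in> S" using R z0 by (auto simp: S_def)
  have SE: "E z = 0" "norm z < R" "z \<noteq> 0" if "z \<in> S" for z using that E0 by (auto simp: S_def)
  have bij: "bij_betw uminus S S"
    by (rule bij_betw_byWitness[where f' = uminus]) (auto simp: S_def even)
  \<comment> \<open>The quotient (s - z) / \<open>p z s\<close> is the Blaschke factor of the disc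
    for z; numerator and denominator have equal modulus on |s| = R. Working with \<open>k\<close> =
    E/Q keeps W = k P defined at the zeros themselves.\<close>
  define p where "p = (\<lambda>z s. (of_real (R^2) - cnj z * s) / of_real R)"
  define P where "P = (\<lambda>s. \<Prod>z\<in>S. p z s)"
  define Q where "Q = (\<lambda>s. \<Prod>z\<in>S. s - z)"
  obtain k where k: "k holomorphic_on UNIV" "\<And>s. E s = Q s * k s"
    using entire_divide_zeros[OF fS holo] SE unfolding Q_def by auto
  define W where "W = (\<lambda>s. k s * P s)"
  have hW: "W holomorphic_on A" for A
    unfolding W_def P_def p_def using Rpos holomorphic_on_subset[OF k(1)] by (intro holomorphic_intros) auto
  have pnz: "p z s \<noteq> 0" if "z \<in> S" "norm s \<le> R" for z s
  proof
    assume "p z s = 0"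
    hence "cnj z * s = of_real (R^2)" using Rpos by (simp add: p_def)
    hence "norm z * norm s = R^2" by (metis norm_mult complex_mod_cnj norm_of_real abs_power2)
    moreover have "norm z * norm s < R * R"
    proof -
      have "norm z * norm s \<le> norm z * R" using that(2) by (intro mult_left_mono) auto
      also have "\<dots> < R * R" using SE(2)[OF that(1)] Rpos by (intro mult_strict_right_mono) auto
      finally show ?thesis .
    qed
    ultimately show False by (simp add: power2_eq_square)
  qed
  have Pnz: "P s \<noteq> 0" if "norm s \<le> R" for s using pnz that fS by (auto simp: P_def)
  have knz: "k s \<noteq> 0" if "norm s < R" for s
  proof (cases "s \<in> S")
    case True
    show ?thesis
      by (rule simple_zero_quotient_nonzero[OF fS True k(1), of E])
         (use k(2) simple SE(1)[OF True] in \<open>auto simp: Q_def\<close>)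
  next
    case False
    thus ?thesis using that k(2)[of s] by (auto simp: S_def)
  qed
  have WQ: "norm (W s) * norm (Q s) = norm (E s) * norm (P s)" for s
    by (simp add: W_def k(2) norm_mult)
  have p_boundary: "norm (p z s) = norm (s - z)" if "norm s = R" for z s
  proof -
    have "of_real (R^2) = s * cnj s" using complex_norm_square[of s] that by simp
    hence e: "p z s = s * cnj (s - z) / of_real R" by (simp add: p_def algebra_simps)
    show ?thesis unfolding e norm_divide norm_mult complex_mod_cnj norm_of_real that using Rpos by simp
  qed
  have WB: "norm (W s) \<le> B" if "norm s \<le> R" for s
  proof (rule maximum_modulus_frontier[where S = "cball 0 R" and f = W])
    fix z :: complex assume "z \<in> frontier (cball 0 R)"
    hence z: "norm z = R" using Rpos by (simp add: frontier_cball)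
    have "norm (P z) = norm (Q z)" unfolding P_def Q_def prod_norm[symmetric]
      by (intro prod.cong refl p_boundary z)
    moreover have "P z \<noteq> 0" by (rule Pnz) (use z in simp)
    moreover from calculation have "Q z \<noteq> 0" by (metis norm_eq_zero)
    ultimately have "norm (W z) = norm (E z)" using WQ[of z] by simp
    thus "norm (W z) \<le> B" using B[of z] z by simp
  qed (use that hW in \<open>auto intro: holomorphic_on_imp_continuous_on\<close>)
  have Wsym: "norm (W (- s)) = norm (W s)" if "Q s \<noteq> 0" for s
  proof -
    have q: "norm (Q (- s)) = norm (Q s)"
    proof -
      have "norm (Q (- s)) = (\<Prod>z\<in>S. norm (s - (- z)))"
        unfolding Q_def prod_norm[symmetric]
        by (intro prod.cong refl) (metis add.commute diff_minus_eq_add minus_add_distrib minus_diff_eq norm_minus_cancel uminus_add_conv_diff)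
      also have "\<dots> = (\<Prod>z\<in>S. norm (s - z))" by (rule prod.reindex_bij_betw[OF bij])
      finally show ?thesis by (simp add: Q_def prod_norm)
    qed
    have "P (- s) = (\<Prod>z\<in>S. p (- z) s)" unfolding P_def by (intro prod.cong refl) (simp add: p_def)
    also have "\<dots> = P s" unfolding P_def by (rule prod.reindex_bij_betw[OF bij])
    finally have "norm (W (- s)) * norm (Q s) = norm (W s) * norm (Q s)"
      using WQ[of s] WQ[of "- s"] q even[of s] by simp
    thus ?thesis using that by simp
  qed
  define V where "V = (\<lambda>s. W s * W (- s))"
  have hV: "V holomorphic_on ball 0 R"
    unfolding V_def by (intro holomorphic_intros hW holomorphic_on_compose_gen[OF _ hW[of UNIV], unfolded o_def]) auto
  define A where "A = 2 * ln B - 2 * ln (norm (E 0)) + 1"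
  have Q0: "Q s \<noteq> 0" if "E s \<noteq> 0" for s using that k(2) by auto
  have Bpos: "B > 0" using B[of 0] E0 Rpos by (smt (verit) norm_zero zero_less_norm_iff)
  \<comment> \<open>At the origin a Blaschke factor has modulus |z|/R < 1, so dividing by it can
    only increase the value. This bounds \<open>V 0\<close> from below independently of R.\<close>
  have W0: "norm (W 0) \<ge> norm (E 0)"
  proof -
    have "norm (Q 0) \<le> norm (P 0)" unfolding Q_def P_def prod_norm[symmetric]
    proof (rule prod_mono)
      fix z assume "z \<in> S"
      thus "0 \<le> norm (0 - z) \<and> norm (0 - z) \<le> norm (p z 0)"
        using SE[of z] Rpos by (simp add: p_def power2_eq_square)
    qed
    hence "norm (E 0) * norm (Q 0) \<le> norm (W 0) * norm (Q 0)"
      unfolding WQ by (intro mult_left_mono) auto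
    thus ?thesis using Q0[OF E0] by simp
  qed
  have lnV: "\<bar>2 * ln (norm (W s)) - ln (norm (V 0))\<bar> \<le> 64 * A * (norm s)^2 / R^2"
    if s: "norm s \<le> R / 4" "E s \<noteq> 0" for s
  proof -
    have "\<bar>ln (norm (V s)) - ln (norm (V 0))\<bar> \<le> 64 * (ln (B^2) - ln (norm (V 0)) + 1) * (norm s)^2 / R^2"
    proof (rule even_nonvanishing_growth[OF hV Rpos])
      fix s :: complex assume s: "norm s < R"
      show "V s \<noteq> 0" using knz[of s] knz[of "- s"] Pnz[of s] Pnz[of "- s"] s by (simp add: V_def W_def)
      have "norm (V s) \<le> B * B" unfolding V_def norm_mult
        using s WB[of s] WB[of "- s"] Bpos by (intro mult_mono) auto
      thus "norm (V s) \<le> B^2" by (simp add: power2_eq_square)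
    qed (use s in \<open>auto simp: V_def mult.commute\<close>)
    also have "\<dots> \<le> 64 * A * (norm s)^2 / R^2"
    proof -
      have "norm (V 0) \<ge> norm (E 0) * norm (E 0)"
        unfolding V_def norm_mult using W0 by (intro mult_mono) auto
      hence "ln (norm (V 0)) \<ge> ln (norm (E 0) * norm (E 0))" using E0 by (intro ln_mono) auto
      hence "ln (norm (V 0)) \<ge> 2 * ln (norm (E 0))" using E0 by (simp add: ln_mult)
      moreover have "ln (B^2) = 2 * ln B" using Bpos by (simp add: ln_realpow)
      ultimately show ?thesis unfolding A_def
        by (intro divide_right_mono mult_right_mono mult_left_mono) auto
    qed
    also have "norm (V s) = (norm (W s))^2"
      using Wsym[OF Q0[OF s(2)]] by (simp add: V_def norm_mult power2_eq_square)
    also have "ln ((norm (W s))^2) = 2 * ln (norm (W s))"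
    proof -
      have "norm s < R" using s(1) Rpos by linarith
      hence "W s \<noteq> 0" using knz[of s] Pnz[of s] by (simp add: W_def)
      thus ?thesis by (simp add: ln_realpow)
    qed
    finally show ?thesis .
  qed
  have sR: "norm s0 < R" "norm s1 < R" using R Rpos by linarith+
  have Wnz: "W s0 \<noteq> 0" "W s1 \<noteq> 0"
    using knz[OF sR(1)] Pnz[of s0] knz[OF sR(2)] Pnz[of s1] sR by (auto simp: W_def)
  define D where "D = 32 * A * ((norm s0)^2 + (norm s1)^2) / R^2"
  have "ln (norm (W s0)) - ln (norm (W s1)) \<le> D"
  proof -
    define a where "a = 64 * A * (norm s0)^2 / R^2"
    define b where "b = 64 * A * (norm s1)^2 / R^2"
    have "2 * D = a + b" using Rpos by (simp add: D_def a_def b_def field_simps)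
    moreover have "\<bar>2 * ln (norm (W s0)) - ln (norm (V 0))\<bar> \<le> a" unfolding a_def by (rule lnV[OF R(1) Es(1)])
    moreover have "\<bar>2 * ln (norm (W s1)) - ln (norm (V 0))\<bar> \<le> b" unfolding b_def by (rule lnV[OF R(2) Es(2)])
    ultimately show ?thesis by linarith
  qed
  hence "ln (norm (W s0)) \<le> ln (norm (W s1) * exp D)" using Wnz by (simp add: ln_mult)
  hence W01: "norm (W s0) \<le> norm (W s1) * exp D" using Wnz by (subst (asm) ln_le_cancel_iff) auto
  define Q' where "Q' = (\<lambda>s. \<Prod>z\<in>S - {z0}. norm (s - z))"
  define P' where "P' = (\<lambda>s. \<Prod>z\<in>S - {z0}. norm (p z s))"
  have Q': "norm (Q s) = norm (s - z0) * Q' s" for s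
    unfolding Q_def Q'_def prod_norm[symmetric] using fS z0S by (rule prod.remove)
  have P': "norm (P s) = norm (p z0 s) * P' s" for s
    unfolding P_def P'_def prod_norm[symmetric] using fS z0S by (rule prod.remove)
  have P'pos: "P' s > 0" if "norm s < R" for s
    unfolding P'_def using pnz that by (intro prod_pos) auto
  \<comment> \<open>Only the zeros other than \<open>z0\<close> are compared here; the factor of
    \<open>z0\<close> stays explicit in the conclusion, as it supplies the gain far to the
    right.\<close>
  have QP: "Q' s0 * P' s1 \<le> Q' s1 * P' s0"
    unfolding Q'_def P'_def prod.distrib[symmetric]
  proof (rule prod_mono, safe)
    fix z assume z: "z \<in> S"
    define g where "g = Im z"
    have zg: "z = \<i> * of_real g" using zero_imaginary[OF SE(1)[OF z]] by (simp add: g_def)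
    have g: "g \<noteq> 0" "\<bar>g\<bar> < R" using SE[OF z] zg by (auto simp: norm_mult)
    define b where "b = R^2 / g"
    have pz: "p z s = (\<i> * of_real (g / R)) * (s - \<i> * of_real b)" for s
      using Rpos g by (simp add: p_def zg b_def field_simps)
    \<comment> \<open>The reflected ordinate b has the sign of g, and |b| >= R > 2|t|. So t lies on
      the same side of the midpoint (g + b)/2 as g.\<close>
    have "(t - g)^2 \<le> (t - b)^2"
    proof (cases "g > 0")
      case True
      have "R * g \<le> R * R" using True g Rpos by (intro mult_left_mono) auto
      hence "b \<ge> R" using True by (simp add: b_def field_simps power2_eq_square)
      hence "(b - g) * (b + g - 2 * t) \<ge> 0" using True g t by (intro mult_nonneg_nonneg) (auto simp: abs_if split: if_splits)
      thus ?thesis by (simp add: power2_eq_square algebra_simps)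
    next
      case False
      hence g': "- g > 0" using g by simp
      have "R * (- g) \<le> R * R" using g' g Rpos by (intro mult_left_mono) auto
      hence "- b \<ge> R" using g' by (simp add: b_def field_simps power2_eq_square)
      hence "(- b + g) * (- b - g + 2 * t) \<ge> 0" using g' g t by (intro mult_nonneg_nonneg) (auto simp: abs_if split: if_splits)
      thus ?thesis by (simp add: power2_eq_square algebra_simps)
    qed
    from vertical_ratio_mono[OF xy this]
    have "norm (s0 - z) * norm (s1 - \<i> * of_real b) \<le> norm (s1 - z) * norm (s0 - \<i> * of_real b)"
      by (simp add: zg s0_def s1_def)
    hence "norm (\<i> * of_real (g / R) :: complex) * (norm (s0 - z) * norm (s1 - \<i> * of_real b)) \<le>
        norm (\<i> * of_real (g / R) :: complex) * (norm (s1 - z) * norm (s0 - \<i> * of_real b))"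
      by (rule mult_left_mono) simp
    thus "norm (s0 - z) * norm (p z s1) \<le> norm (s1 - z) * norm (p z s0)"
      unfolding pz norm_mult by (simp only: mult_ac)
  qed simp
  have e0: "norm (E s0) * (norm (p z0 s0) * P' s0) = norm (W s0) * (norm (s0 - z0) * Q' s0)"
    using WQ[of s0] unfolding Q' P' by simp
  have e1: "norm (E s1) * (norm (p z0 s1) * P' s1) = norm (W s1) * (norm (s1 - z0) * Q' s1)"
    using WQ[of s1] unfolding Q' P' by simp
  let ?a = "norm (E s0) * norm (s1 - z0) * norm (p z0 s0)"
  let ?b = "norm (E s1) * norm (s0 - z0) * norm (p z0 s1)"
  let ?w = "norm (W s0) * norm (s0 - z0) * norm (s1 - z0) * norm (W s1)"
  have "?a * norm (W s1) * (P' s0 * P' s1)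
      = (norm (E s0) * (norm (p z0 s0) * P' s0)) * (norm (s1 - z0) * norm (W s1) * P' s1)" by (simp only: mult_ac)
  also have "\<dots> = ?w * (Q' s0 * P' s1)"
    unfolding e0 by (simp only: mult_ac)
  also have "\<dots> \<le> ?w * (Q' s1 * P' s0)"
    using QP by (intro mult_left_mono) auto
  also have "\<dots> = (norm (W s0) * norm (s0 - z0) * P' s0) * (norm (W s1) * (norm (s1 - z0) * Q' s1))" by (simp only: mult_ac)
  also have "\<dots> = ?b * norm (W s0) * (P' s0 * P' s1)"
    unfolding e1[symmetric] by (simp only: mult_ac)
  finally have "?a * norm (W s1) \<le>
     ?b * norm (W s0)"
    using P'pos[OF sR(1)] P'pos[OF sR(2)] by (simp only: mult_le_cancel_right_pos mult_pos_pos)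
  also have "\<dots> \<le> ?b * (norm (W s1) * exp D)"
    using W01 by (intro mult_left_mono) auto
  finally have "?a * norm (W s1) \<le>
     (?b * exp D) * norm (W s1)" by (simp only: mult_ac)
  hence "?a \<le> ?b * exp D"
    using Wnz by (subst (asm) mult_le_cancel_right_pos) auto
  moreover have "norm (p z0 s) = R * norm (1 - cnj z0 * s / R^2)" for s
  proof -
    have "p z0 s = of_real R * (1 - cnj z0 * s / R^2)"
      using Rpos by (simp add: p_def field_simps power2_eq_square)
    thus ?thesis using Rpos by (simp add: norm_mult)
  qed
  ultimately have "R * (norm (E s0) * norm (s1 - z0) * norm (1 - cnj z0 * s0 / R^2)) \<le>
       R * (norm (E s1) * norm (s0 - z0) * norm (1 - cnj z0 * s1 / R^2) * exp D)" by (simp only: mult_ac)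
  thus ?thesis using Rpos unfolding D_def A_def by (subst (asm) mult_le_cancel_left_pos) auto
qed

text \<open>Two limits in \<open>blaschke_compare\<close>. With the growth rate e fixed and R
  tending to infinity, the reflected factors tend to 1 and the error exponent to 64 e N, because ln
  B = ln C + e R^2 is divided by R^2. Then e tends to 0.\<close>

theorem norm_vertical_ratio:
  fixes x y t :: real
  assumes xy: "0 \<le> x" "x \<le> y" and z0: "E z0 = 0"
  shows "norm (E (Complex x t)) * norm (Complex y t - z0) \<le> norm (E (Complex y t)) * norm (Complex x t - z0)"
proof (cases "E (Complex x t) = 0 \<or> E (Complex y t) = 0")
  case True
  thus ?thesis
  proof
    assume "E (Complex y t) = 0"
    hence "x = y" using zeros[of "Complex y t"] xy by simp
    thus ?thesis by simp
  qed simp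
next
  case False
  define s0 where "s0 = Complex x t"
  define s1 where "s1 = Complex y t"
  define N where "N = (norm s0)^2 + (norm s1)^2"
  have lim_e: "norm (E s0) * norm (s1 - z0) \<le> norm (E s1) * norm (s0 - z0) * exp (64 * e * N)" if e: "e > 0" for e
  proof -
    from growth[OF e] obtain C where C: "\<And>s. norm (E s) \<le> C * exp (e * (norm s)^2)" by blast
    have Cpos: "C > 0"
    proof -
      have "norm (E 0) > 0" using E0 by simp
      also have "norm (E 0) \<le> C" using C[of 0] by simp
      finally show ?thesis .
    qed
    define c0 where "c0 = 2 * ln C - 2 * ln (norm (E 0)) + 1"
    let ?l = "\<lambda>R::real. norm (E s0) * norm (s1 - z0) * norm (1 - cnj z0 * s0 * of_real (1 / R^2))"
    let ?r = "\<lambda>R::real. norm (E s1) * norm (s0 - z0) * norm (1 - cnj z0 * s1 * of_real (1 / R^2)) *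
            exp (32 * ((c0 + 2 * e * R^2) / R^2) * N)"
    have "(?l \<longlongrightarrow>
            norm (E s0) * norm (s1 - z0) * norm (1 - cnj z0 * s0 * of_real 0)) at_top"
      by (intro tendsto_intros) real_asymp
    moreover have "(?r \<longlongrightarrow>
            norm (E s1) * norm (s0 - z0) * norm (1 - cnj z0 * s1 * of_real 0) * exp (32 * (2 * e) * N)) at_top"
      by (intro tendsto_intros) real_asymp+
    moreover have "eventually (\<lambda>R. ?l R \<le> ?r R) at_top"
      using eventually_ge_at_top[of "4 * norm s0"] eventually_ge_at_top[of "4 * norm s1"] eventually_gt_at_top[of "norm z0"]
    proof eventually_elim
      case (elim R)
      have "norm (E s0) * norm (s1 - z0) * norm (1 - cnj z0 * s0 / R^2) \<le>
         norm (E s1) * norm (s0 - z0) * norm (1 - cnj z0 * s1 / R^2) *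
         exp (32 * (2 * ln (C * exp (e * R^2)) - 2 * ln (norm (E 0)) + 1) * ((norm s0)^2 + (norm s1)^2) / R^2)"
        unfolding s0_def s1_def
      proof (rule blaschke_compare[OF _ _ _ xy z0])
        fix s :: complex assume "norm s \<le> R"
        hence "e * (norm s)^2 \<le> e * R^2" using e by (intro mult_left_mono power_mono) auto
        hence "C * exp (e * (norm s)^2) \<le> C * exp (e * R^2)" using Cpos by simp
        thus "norm (E s) \<le> C * exp (e * R^2)" using C[of s] by linarith
      qed (use elim False in \<open>auto simp: s0_def s1_def\<close>)
      moreover have "2 * ln (C * exp (e * R^2)) - 2 * ln (norm (E 0)) + 1 = c0 + 2 * e * R^2"
        using Cpos by (simp add: ln_mult c0_def)
      ultimately show ?case by (simp add: N_def)
    qed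
    ultimately have "norm (E s0) * norm (s1 - z0) * norm (1 - cnj z0 * s0 * of_real 0) \<le>
        norm (E s1) * norm (s0 - z0) * norm (1 - cnj z0 * s1 * of_real 0) * exp (32 * (2 * e) * N)"
      by (intro tendsto_le[OF _ _ ]) auto
    thus ?thesis by simp
  qed
  have "((\<lambda>e. norm (E s1) * norm (s0 - z0) * exp (64 * e * N)) \<longlongrightarrow> norm (E s1) * norm (s0 - z0) * exp (64 * 0 * N)) (at_right 0)"
    by (intro tendsto_intros)
  moreover have "eventually (\<lambda>e. norm (E s0) * norm (s1 - z0) \<le> norm (E s1) * norm (s0 - z0) * exp (64 * e * N)) (at_right 0)"
    using eventually_at_right_less[of 0] by eventually_elim (rule lim_e)
  ultimately have "norm (E s0) * norm (s1 - z0) \<le> norm (E s1) * norm (s0 - z0) * exp (64 * 0 * N)"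
    by (intro tendsto_lowerbound) auto
  thus ?thesis by (simp add: s0_def s1_def)
qed

end

section \<open>The zeros of \<open>\<xi>\<close>\<close>

text \<open>The function E of the overview, 2 xi(1/2 + s), by \<open>xi_eq_big_xi\<close>.\<close>

definition Xi :: "complex \<Rightarrow> complex" where
  "Xi s = big_xi (1 / 2 + s)"

lemma Xi_eq: "Xi s = 1 + (s^2 - 1 / 4) * xi_integral s"
  by (simp add: Xi_def big_xi_def power2_eq_square algebra_simps)

lemma n_fun_eq: "n_fun s = sin (of_real pi * s / 4) * Xi s"
  by (simp add: n_fun_def xi_eq_big_xi Xi_def)

lemma holomorphic_Xi: "Xi holomorphic_on A"
  unfolding Xi_eq[abs_def] by (intro holomorphic_intros)

lemma Xi_even: "Xi (- s) = Xi s"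
  by (simp add: Xi_eq xi_integral_even)

section \<open>Nonvanishing on the real axis and growth\<close>

lemma xi_kernel_integral_nonneg: "(\<integral>u. kernel_exp r u \<partial>lborel) \<ge> (0::real)"
  by (intro Bochner_Integration.integral_nonneg) (auto simp: xi_kernel_nonneg)

text \<open>By \<open>psi_le\<close> and exp(2u) >= 1 + 2u the integrand is at most (2/e) exp(-u),
  so the half-line integral is at most 2/e < 2. The threshold 4 is what 1 + (x^2 - 1/4) L > 0
  requires at x = 0.\<close>

lemma norm_xi_integral_strip:
  assumes "\<bar>Re s\<bar> \<le> 1 / 2"
  shows "norm (xi_integral s) < 4"
proof -
  have "(\<integral>u. kernel_exp (1/2) u \<partial>lborel) \<le> (\<integral>u. 2 * exp (-1) * (indicator {0..} u * exp (- 1 * u)) \<partial>lborel)"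
  proof (rule integral_mono)
    show "integrable lborel (\<lambda>u. kernel_exp (1/2) u)" by (rule integrable_xi_kernel_exp)
    show "integrable lborel (\<lambda>u. 2 * exp (-1) * (indicator {0..} u * exp (- 1 * u)) :: real)"
      using has_bochner_integral_exp_neg[of 1] by (intro integrable_mult_right) (simp add: has_bochner_integral_iff)
    fix u :: real
    show "kernel_exp (1/2) u \<le> 2 * exp (-1) * (indicator {0..} u * exp (- 1 * u))"
    proof (cases "u \<ge> 0")
      case True
      have "xi_kernel u * exp (1/2 * u) \<le> (2 * exp (u / 2) * exp (- exp (2 * u))) * exp (1/2 * u)"
        unfolding xi_kernel_def using True by (intro mult_right_mono mult_left_mono psi_le) auto
      also have "\<dots> = 2 * exp (u / 2 - exp (2 * u) + 1/2 * u)" by (simp flip: exp_add)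
      also have "\<dots> \<le> 2 * exp (- 1 + - 1 * u)"
      proof -
        have "u / 2 - exp (2 * u) + 1/2 * u \<le> - 1 + - 1 * u"
          using exp_ge_add_one_self[of "2 * u"] by linarith
        thus ?thesis by simp
      qed
      also have "\<dots> = 2 * exp (-1) * exp (- 1 * u)" by (simp flip: exp_add)
      finally show ?thesis using True by simp
    qed auto
  qed
  also have "\<dots> = 2 * exp (-1)"
    using has_bochner_integral_exp_neg[of 1] by (simp add: has_bochner_integral_iff)
  also have "\<dots> < 2" by simp
  finally show ?thesis using norm_xi_integral_le[OF assms] by linarith
qed

text \<open>Positivity of the kernel gives L >= 0, which settles |x| > 1/2. For smaller |x| the
  coefficient of L is at least -1/4, and L < 4.\<close>

lemma Xi_real_nonzero: "Xi (of_real x) \<noteq> 0"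
proof -
  define L where "L = (\<integral>u. kernel_exp x u \<partial>lborel) +
      (\<integral>u. kernel_exp (- x) u \<partial>lborel)"
  have L: "L \<ge> 0" unfolding L_def by (intro add_nonneg_nonneg xi_kernel_integral_nonneg)
  have X: "Xi (of_real x) = of_real (1 + (x^2 - 1 / 4) * L)"
    by (simp add: Xi_eq xi_integral_of_real L_def)
  have "1 + (x^2 - 1 / 4) * L > 0"
  proof (cases "\<bar>x\<bar> \<le> 1 / 2")
    case True
    have "norm (xi_integral (of_real x)) < 4" using True by (intro norm_xi_integral_strip) auto
    hence "L < 4" using L unfolding xi_integral_of_real L_def[symmetric] by simp
    moreover have "(x^2 - 1 / 4) * L \<ge> (- 1 / 4) * L" using L by (intro mult_right_mono) auto
    ultimately show ?thesis by simp
  next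
    case False
    have "(1 / 2)^2 \<le> \<bar>x\<bar>^2" using False by (intro power_mono) auto
    hence "x^2 - 1 / 4 \<ge> 0" by (simp add: power2_eq_square)
    thus ?thesis using L by (simp add: add_pos_nonneg)
  qed
  thus ?thesis unfolding X using of_real_eq_0_iff by (metis less_irrefl)
qed

text \<open>With Gaussian decay of rate A = 1/e, the inequality r u <= (e/2) r^2 + u^2/(2e) leaves a
  convergent Gaussian and the factor Y = exp(e r^2 / 2). A second factor Y pays for the quadratic
  polynomial in front of the integral.\<close>

lemma Xi_growth:
  assumes e: "e > 0"
  shows "\<exists>C. \<forall>s. norm (Xi s) \<le> C * exp (e * (norm s)^2)"
proof -
  define A where "A = 1 / e"
  have A: "A > 0" using e by (simp add: A_def)
  from xi_kernel_decay[of A] A obtain C where C: "C \<ge> 0" "\<And>u. u \<ge> 0 \<Longrightarrow> xi_kernel u \<le> C * exp (- A * u^2)"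
    by auto
  define K where "K = C * (\<integral>u. exp (- (A / 2) * u^2) \<partial>(lborel :: real measure))"
  have K: "K \<ge> 0" unfolding K_def using C by (intro mult_nonneg_nonneg Bochner_Integration.integral_nonneg) auto
  have "norm (Xi s) \<le> (1 + (2 / e + 1 / 4) * (2 * K)) * exp (e * (norm s)^2)" for s
  proof -
    define r where "r = norm s"
    define Y where "Y = exp (e / 2 * r^2)"
    have "(\<integral>u. kernel_exp r u \<partial>lborel) \<le>
          (\<integral>u. C * Y * exp (- (A / 2) * u^2) \<partial>lborel)"
    proof (rule integral_mono)
      show "integrable lborel (\<lambda>u. kernel_exp r u)"
        by (rule integrable_xi_kernel_exp)
      show "integrable lborel (\<lambda>u::real. C * Y * exp (- (A / 2) * u^2))"
        using A by (intro integrable_mult_right integrable_gauss) auto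
      fix u :: real
      show "kernel_exp r u \<le> C * Y * exp (- (A / 2) * u^2)"
      proof (cases "u \<ge> 0")
        case True
        have "r * u \<le> e / 2 * r^2 + A / 2 * u^2"
        proof -
          have "0 \<le> (e * r - u)^2 / (2 * e)" using e by simp
          thus ?thesis using e by (simp add: A_def power2_eq_square field_simps)
        qed
        hence *: "- A * u^2 + r * u \<le> e / 2 * r^2 + - (A / 2) * u^2" by (simp add: algebra_simps)
        have "xi_kernel u * exp (r * u) \<le> C * exp (- A * u^2) * exp (r * u)"
          using C True by (intro mult_right_mono) auto
        also have "\<dots> = C * exp (- A * u^2 + r * u)" by (simp flip: exp_add)
        also have "\<dots> \<le> C * exp (e / 2 * r^2 + - (A / 2) * u^2)" using C * by (intro mult_left_mono) auto
        also have "\<dots> = C * Y * exp (- (A / 2) * u^2)" unfolding Y_def exp_add by (simp add: mult.assoc)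
        finally show ?thesis using True by simp
      qed (use C in \<open>auto simp: Y_def\<close>)
    qed
    also have "\<dots> = K * Y" by (simp add: K_def)
    finally have "norm (xi_integral s) \<le> 2 * (K * Y)"
      using norm_xi_integral_le[of s r] abs_Re_le_cmod[of s] by (simp add: r_def)
    moreover have "norm (s^2 - 1 / 4) \<le> r^2 + 1 / 4"
      using norm_triangle_ineq4[of "s^2" "1 / 4"] by (simp add: r_def norm_power)
    ultimately have 1: "norm (Xi s) \<le> 1 + (r^2 + 1 / 4) * (2 * (K * Y))"
      unfolding Xi_eq by (intro order_trans[OF norm_triangle_ineq]) (auto simp: norm_mult intro!: mult_mono)
    have Y1: "Y \<ge> 1" using e by (simp add: Y_def)
    have "e / 2 * r^2 \<le> Y" unfolding Y_def using exp_ge_add_one_self[of "e / 2 * r^2"] by linarith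
    hence "r^2 \<le> 2 / e * Y" using e by (simp add: field_simps)
    hence "r^2 + 1 / 4 \<le> (2 / e + 1 / 4) * Y" using Y1 by (simp add: distrib_right)
    hence "(r^2 + 1 / 4) * (2 * (K * Y)) \<le> (2 / e + 1 / 4) * Y * (2 * (K * Y))"
      using K Y1 by (intro mult_right_mono) auto
    moreover have "1 \<le> Y * Y" using Y1 mult_mono[of 1 Y 1 Y] by simp
    ultimately have "norm (Xi s) \<le> (1 + (2 / e + 1 / 4) * (2 * K)) * (Y * Y)" using 1 by (simp add: algebra_simps)
    also have "Y * Y = exp (e * (norm s)^2)" by (simp add: Y_def r_def flip: exp_add)
    finally show ?thesis .
  qed
  thus ?thesis by blast
qed

section \<open>Zeros of \<open>Xi\<close> against zeros of \<open>zeta\<close>\<close>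

lemma nonreal_half_not_nonpos_Int: "Im s \<noteq> 0 \<Longrightarrow> s / 2 \<notin> \<int>\<^sub>\<le>\<^sub>0"
  by (auto elim!: nonpos_Ints_cases simp: complex_eq_iff)

lemma a_fun_nonzero:
  assumes "Im s \<noteq> 0"
  shows "a_fun s \<noteq> 0"
  using nonreal_half_not_nonpos_Int[OF assms] assms by (auto simp: a_fun_def Gamma_eq_zero_iff)

lemma Xi_a_fun_zeta: "Im s \<noteq> 0 \<Longrightarrow> Xi s = a_fun (1 / 2 + s) * zeta (1 / 2 + s)"
  unfolding Xi_def by (rule a_fun_zeta[symmetric]) (auto simp: nonreal_half_not_nonpos_Int complex_eq_iff)

lemma Xi_zero_iff: "Xi s = 0 \<longleftrightarrow> s \<in> Z_i"
proof (cases "Im s = 0")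
  case True
  hence "s = of_real (Re s)" by (simp add: complex_eq_iff)
  hence "Xi s \<noteq> 0" using Xi_real_nonzero by metis
  thus ?thesis using True by (simp add: Z_i_def)
next
  case False
  thus ?thesis using a_fun_nonzero[of "1 / 2 + s"] by (simp add: Xi_a_fun_zeta Z_i_def)
qed

lemma deriv_Xi_zero:
  assumes "Xi s = 0"
  shows "deriv Xi s = a_fun (1 / 2 + s) * deriv zeta (1 / 2 + s)"
proof -
  have s: "Im s \<noteq> 0" "zeta (1 / 2 + s) = 0" using assms by (auto simp: Xi_zero_iff Z_i_def)
  have op: "open {s. Im s \<noteq> 0}"
  proof -
    have "{s. Im s \<noteq> 0} = - {s. Im s = 0}" by auto
    moreover have "closed {s. Im s = 0}" by (intro closed_Collect_eq continuous_intros)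
    ultimately show ?thesis by (simp add: open_Compl)
  qed
  have hz: "(\<lambda>s. zeta (1 / 2 + s)) holomorphic_on {s. Im s \<noteq> 0}"
    unfolding zeta_eq_zeta_cont
    by (rule holomorphic_on_compose_gen[OF _ holomorphic_zeta_cont, unfolded o_def])
       (auto intro!: holomorphic_intros simp: complex_eq_iff)
  have "(\<lambda>s. a_fun (1 / 2 + s)) holomorphic_on {s. Im s \<noteq> 0}"
    unfolding a_fun_def using nonreal_half_not_nonpos_Int[of "1 / 2 + s" for s]
    by (intro holomorphic_intros) auto
  then obtain D where D: "((\<lambda>s. a_fun (1 / 2 + s)) has_field_derivative D) (at s)"
    using op s by (meson holomorphic_derivI mem_Collect_eq)
  have "zeta field_differentiable at (1 / 2 + s)"
    unfolding zeta_eq_zeta_cont using holomorphic_zeta_cont s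
    by (intro holomorphic_on_imp_differentiable_at[of _ "- {1}"]) (auto simp: complex_eq_iff)
  hence "(zeta has_field_derivative deriv zeta (1 / 2 + s)) (at (1 / 2 + s))"
    by (simp add: DERIV_deriv_iff_field_differentiable)
  hence "((\<lambda>s. zeta (1 / 2 + s)) has_field_derivative deriv zeta (1 / 2 + s)) (at s)"
    using DERIV_shift[of zeta "deriv zeta (1 / 2 + s)" s "1 / 2"] by (simp add: add.commute)
  from DERIV_mult[OF D this]
  have "((\<lambda>s. a_fun (1 / 2 + s) * zeta (1 / 2 + s)) has_field_derivative a_fun (1 / 2 + s) * deriv zeta (1 / 2 + s)) (at s)"
    using s by (simp add: mult.commute)
  hence "(Xi has_field_derivative a_fun (1 / 2 + s) * deriv zeta (1 / 2 + s)) (at s)"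
    by (rule has_field_derivative_transform_within_open[OF _ op]) (use s Xi_a_fun_zeta in auto)
  thus ?thesis by (rule DERIV_imp_deriv)
qed

text \<open>Infinitude of S follows from \<open>mono\<close>: if nothing lay above
  \<open>p n\<close>, nothing would lie above \<open>p (Suc n)\<close> either, and two successive
  terms would be the same infimum of the empty set. Finiteness below each T makes the infima
  minima.\<close>

lemma iterated_Inf_enumerates:
  fixes p :: "nat \<Rightarrow> real" and S :: "real set"
  assumes S: "\<And>t. t \<in> S \<Longrightarrow> t > 0" "\<And>T. finite {t \<in> S. t \<le> T}"
    and p: "p 0 = 0" "\<And>n. p (Suc n) = Inf {t \<in> S. t > p n}"
    and mono: "\<And>n. p (Suc n) < p (Suc (Suc n))"
  shows "strict_mono p" and "range (\<lambda>n. p (Suc n)) = S"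
proof -
  have ne: "{t \<in> S. t > p n} \<noteq> {}" for n
  proof
    assume e: "{t \<in> S. t > p n} = {}"
    have "{t \<in> S. t > p (Suc n)} = {}"
    proof (cases n)
      case 0
      hence "S = {}" using e S(1) p(1) by auto
      thus ?thesis by simp
    next
      case (Suc m)
      thus ?thesis using e mono[of m] by force
    qed
    hence "p (Suc (Suc n)) = p (Suc n)" using e p(2)[of n] p(2)[of "Suc n"] by metis
    thus False using mono[of n] by simp
  qed
  have attained: "p (Suc n) \<in> S \<and> p n < p (Suc n) \<and> (\<forall>t\<in>S. p n < t \<longrightarrow> p (Suc n) \<le> t)" for n
  proof -
    let ?A = "{t \<in> S. t > p n}"
    obtain a where a: "a \<in> ?A" using ne[of n] by blast
    have fin: "finite {t \<in> ?A. t \<le> a}" by (rule finite_subset[OF _ S(2)[of a]]) auto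
    define m where "m = Min {t \<in> ?A. t \<le> a}"
    have m: "m \<in> {t \<in> ?A. t \<le> a}" unfolding m_def using fin a by (intro Min_in) auto
    have le: "m \<le> t" if "t \<in> ?A" for t
    proof (cases "t \<le> a")
      case True thus ?thesis unfolding m_def using fin that by (intro Min_le) auto
    next
      case False thus ?thesis using m by auto
    qed
    have "Inf ?A = m" using m le by (intro cInf_eq_minimum) auto
    thus ?thesis using m le p(2)[of n] by auto
  qed
  show sm: "strict_mono p" using attained by (simp add: strict_mono_Suc_iff)
  show "range (\<lambda>n. p (Suc n)) = S"
  proof (intro equalityI subsetI)
    fix t assume t: "t \<in> S"
    show "t \<in> range (\<lambda>n. p (Suc n))"
    proof (rule ccontr)
      assume nt: "t \<notin> range (\<lambda>n. p (Suc n))"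
      have lt: "p n < t" for n
      proof (induction n)
        case 0 thus ?case using S(1)[OF t] p by simp
      next
        case (Suc n)
        thus ?case using attained[of n] t nt by (metis order_le_less rangeI)
      qed
      have "range (\<lambda>n. p (Suc n)) \<subseteq> {t' \<in> S. t' \<le> t}" using attained lt by (auto simp: less_imp_le)
      hence "finite (range (\<lambda>n. p (Suc n)))" using S(2) finite_subset by blast
      moreover have "inj (\<lambda>n. p (Suc n))" using sm by (auto simp: inj_def strict_mono_eq)
      ultimately show False using finite_imageD infinite_UNIV_nat by blast
    qed
  qed (use attained in auto)
qed

section \<open>Bounds for \<open>\<Gamma>\<close> and rectangular contours\<close>

text \<open>By Euler's limit formula the ratio is the product of (c + k) / |c + k + iy| over k, and
  each factor is nondecreasing in c.\<close>

lemma norm_Gamma_ratio_mono: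
  fixes a b y :: real
  assumes ab: "0 < a" "a \<le> b"
  shows "norm (Gamma (Complex a y)) / Gamma a \<le> norm (Gamma (Complex b y)) / Gamma b"
proof -
  have G: "norm (Gamma_series (Complex c y) n) / Gamma_series c n = (\<Prod>k<Suc n. (c + real k) / norm (Complex (c + real k) y))"
    if c: "c > 0" for c n
  proof -
    have 1: "norm (pochhammer (Complex c y) (Suc n)) = (\<Prod>k<Suc n. norm (Complex (c + real k) y))"
      unfolding pochhammer_prod prod_norm[symmetric] atLeast0LessThan
      by (intro prod.cong refl arg_cong[where f = norm]) (simp add: complex_eq_iff)
    have 2: "pochhammer c (Suc n) = (\<Prod>k<Suc n. c + real k)"
      unfolding pochhammer_prod atLeast0LessThan by simp
    have pos: "(\<Prod>k<Suc n. c + real k) > 0" using c by (intro prod_pos) auto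
    have "norm (exp (Complex c y * of_real (ln (real n)))) = exp (c * ln (real n))" by simp
    hence "norm (Gamma_series (Complex c y) n) = fact n * exp (c * ln (real n)) / (\<Prod>k<Suc n. norm (Complex (c + real k) y))"
      unfolding Gamma_series_def norm_divide norm_mult using 1 by simp
    moreover have "Gamma_series c n = fact n * exp (c * ln (real n)) / (\<Prod>k<Suc n. c + real k)"
      unfolding Gamma_series_def using 2 by simp
    ultimately show ?thesis using pos by (simp add: prod_dividef)
  qed
  have lim: "(\<lambda>n. norm (Gamma_series (Complex c y) n) / Gamma_series c n) \<longlonglongrightarrow> norm (Gamma (Complex c y)) / Gamma c"
    if c: "c > 0" for c
    using Gamma_real_pos[OF c] by (intro tendsto_intros Gamma_series_LIMSEQ) linarith
  have "norm (Gamma_series (Complex a y) n) / Gamma_series a n \<le> norm (Gamma_series (Complex b y) n) / Gamma_series b n" for n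
    unfolding G[OF ab(1)] G[OF order_less_le_trans[OF ab]]
  proof (rule prod_mono, safe)
    fix k :: nat
    define u where "u = a + real k"
    define v where "v = b + real k"
    have uv: "0 < u" "u \<le> v" using ab by (auto simp: u_def v_def)
    have "u * norm (Complex v y) \<le> v * norm (Complex u y)"
    proof -
      have "u^2 * y^2 \<le> v^2 * y^2" using uv by (intro mult_right_mono power_mono) auto
      hence "(u * norm (Complex v y))^2 \<le> (v * norm (Complex u y))^2"
        by (simp add: power_mult_distrib cmod_power2 algebra_simps)
      thus ?thesis using uv by (auto intro: power2_le_imp_le)
    qed
    moreover have "norm (Complex u y) > 0" "norm (Complex v y) > 0" using uv by (auto simp: complex_eq_iff)
    ultimately show "(a + real k) / norm (Complex (a + real k) y) \<le> (b + real k) / norm (Complex (b + real k) y)"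
      unfolding u_def[symmetric] v_def[symmetric] by (simp add: field_simps)
    show "0 \<le> (a + real k) / norm (Complex (a + real k) y)" using uv by (simp add: u_def)
  qed
  thus ?thesis using ab by (intro LIMSEQ_le[OF lim lim]) auto
qed

text \<open>The reflection formula at z = iy: Gamma(1 + iy) Gamma(1 - iy) is the squared
  modulus.\<close>

lemma norm_Gamma_one_line:
  assumes y: "y \<noteq> 0"
  shows "(norm (Gamma (Complex 1 y)))^2 = pi * y / sinh (pi * y)"
proof -
  define z where "z = \<i> * complex_of_real y"
  have z: "z \<noteq> 0" "z \<notin> \<int>\<^sub>\<le>\<^sub>0" "- z \<notin> \<int>\<^sub>\<le>\<^sub>0" using y by (auto simp: z_def complex_eq_iff elim!: nonpos_Ints_cases)
  have "Gamma (z + 1) = z * Gamma z" "Gamma (- z + 1) = - z * Gamma (- z)"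
    by (rule Gamma_plus1[OF z(2)], rule Gamma_plus1[OF z(3)])
  hence "Gamma (z + 1) * Gamma (- z + 1) = - (z * z) * (Gamma z * Gamma (- z))" by simp
  also have "\<dots> = of_real pi * z / sin (of_real pi * z)"
    unfolding Gamma_reflection_complex' using z by simp
  also have "sin (of_real pi * z) = \<i> * of_real (sinh (pi * y))"
  proof -
    have "sinh (complex_of_real (pi * y)) = - \<i> * sin (\<i> * of_real (pi * y))" by (rule sinh_conv_sin)
    hence "sin (of_real pi * z) = \<i> * sinh (complex_of_real (pi * y))" by (simp add: z_def mult_ac)
    also have "sinh (complex_of_real (pi * y)) = of_real (sinh (pi * y))"
      by (simp add: sinh_field_def exp_of_real flip: of_real_minus of_real_mult)
    finally show ?thesis .
  qed
  also have "of_real pi * z / (\<i> * of_real (sinh (pi * y))) = of_real (pi * y / sinh (pi * y))"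
    by (simp add: z_def)
  finally have "Gamma (z + 1) * Gamma (- z + 1) = of_real (pi * y / sinh (pi * y))" .
  moreover have "z + 1 = Complex 1 y" "- z + 1 = cnj (Complex 1 y)" by (auto simp: z_def complex_eq_iff)
  ultimately have "Gamma (Complex 1 y) * cnj (Gamma (Complex 1 y)) = of_real (pi * y / sinh (pi * y))"
    by (simp add: cnj_Gamma)
  thus ?thesis by (metis complex_norm_square of_real_eq_iff)
qed

text \<open>With z = pi y / 2 the square of the left side is z tanh z. Thus the decay of Gamma
  cancels the growth of the sine on horizontal lines.\<close>

lemma sinh_mult_Gamma_ge:
  assumes y: "y \<ge> 1"
  shows "sinh (pi * y / 2) * norm (Gamma (Complex 1 y)) \<ge> 1 / 2"
proof (rule power2_le_imp_le)
  define z where "z = pi * y / 2"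
  have z: "z \<ge> 1" using y pi_gt3 mult_mono[of 2 pi 1 y] by (simp add: z_def)
  have s2: "sinh (pi * y) = 2 * sinh z * cosh z" using sinh_double[of z] by (simp add: z_def)
  have e: "exp (2 * z) \<ge> 3" using exp_ge_add_one_self[of "2 * z"] z by linarith
  have "exp (- z) * 3 \<le> exp (- z) * exp (2 * z)" using e by (intro mult_left_mono) auto
  also have "\<dots> = exp z" by (simp flip: exp_add)
  finally have sc: "sinh z \<ge> cosh z / 2" by (simp add: sinh_field_def cosh_field_def)
  have c: "cosh z > 0" by (rule cosh_real_pos)
  have s: "sinh z > 0" using sc c by linarith
  have "(sinh z * norm (Gamma (Complex 1 y)))^2 = (sinh z)^2 * (2 * z / (2 * sinh z * cosh z))"
    unfolding power_mult_distrib using y by (subst norm_Gamma_one_line) (auto simp: s2 z_def)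
  also have "\<dots> = z * (sinh z / cosh z)" using s by (simp add: power2_eq_square)
  also have "\<dots> \<ge> 1 * (1 / 2)" using z sc c by (intro mult_mono) (auto simp: field_simps)
  finally show "(1 / 2)^2 \<le> (sinh (pi * y / 2) * norm (Gamma (Complex 1 y)))^2" by (simp add: power2_eq_square z_def)
  show "0 \<le> sinh (pi * y / 2) * norm (Gamma (Complex 1 y))" using s by (simp add: z_def)
qed

text \<open>The counterpart for vertical lines: for y nonzero and z = pi |y| / 2 the square is z
  coth z, and sinh z <= z cosh z by the mean value theorem.\<close>

lemma cosh_mult_Gamma_ge: "cosh (pi * y / 2) * norm (Gamma (Complex 1 y)) \<ge> 1"
proof (rule power2_le_imp_le)
  show "1^2 \<le> (cosh (pi * y / 2) * norm (Gamma (Complex 1 y)))^2"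
  proof (cases "y = 0")
    case True
    moreover have "Complex 1 0 = 1" by (simp add: complex_eq_iff)
    ultimately show ?thesis by simp
  next
    case False
    define z where "z = pi * \<bar>y\<bar> / 2"
    have z: "z > 0" using False by (simp add: z_def)
    have sc: "sinh z \<le> z * cosh z"
    proof -
      have "(sinh has_real_derivative cosh x) (at x)" for x :: real
        by (auto intro!: derivative_eq_intros)
      then obtain w where w: "0 < w" "w < z" "sinh z - sinh 0 = (z - 0) * cosh w"
        using MVT2[OF z, of sinh cosh] by blast
      have "cosh w \<le> cosh z" using w by (subst cosh_real_nonneg_le_iff) auto
      thus ?thesis using w z by (simp add: mult_left_mono)
    qed
    have s: "sinh z > 0" using z by simp
    have "pi * y / sinh (pi * y) = pi * \<bar>y\<bar> / sinh (pi * \<bar>y\<bar>)" by (simp add: abs_if)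
    also have "\<dots> = 2 * z / (2 * sinh z * cosh z)" using sinh_double[of z] by (simp add: z_def)
    finally have g: "(norm (Gamma (Complex 1 y)))^2 = z / (sinh z * cosh z)"
      using norm_Gamma_one_line[OF False] by simp
    have c: "cosh (pi * y / 2) = cosh z" by (simp add: z_def abs_if)
    have "(cosh (pi * y / 2) * norm (Gamma (Complex 1 y)))^2 = z * cosh z / sinh z"
      unfolding power_mult_distrib g c by (simp add: power2_eq_square)
    also have "\<dots> \<ge> 1" using sc s by simp
    finally show ?thesis by simp
  qed
qed simp

section \<open>The sine on the sides of the boxes; contour integrals around rectangles\<close>

lemma norm_sin_ge_sinh:
  "\<bar>sinh (Im z)\<bar> \<le> norm (sin z)"
proof (rule power2_le_imp_le)
  have "(sinh (Im z))^2 = (exp (2 * Im z) + inverse (exp (2 * Im z)) - 2) / 4"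
    unfolding sinh_field_def exp_minus exp_double by (simp add: power2_eq_square field_simps)
  also have "\<dots> \<le> (norm (sin z))^2"
    unfolding norm_sin_squared by (intro divide_right_mono diff_left_mono) auto
  finally show "\<bar>sinh (Im z)\<bar>^2 \<le> (norm (sin z))^2" by simp
qed simp

text \<open>The hypothesis holds for z = pi s / 4 on the lines Re s = 4N + 2, midway between zeros
  of the sine.\<close>

lemma norm_sin_eq_cosh:
  assumes "cos (2 * Re z) = - 1"
  shows "norm (sin z) = cosh (Im z)"
proof (rule power2_eq_imp_eq)
  show "(norm (sin z))^2 = (cosh (Im z))^2"
    unfolding norm_sin_squared assms cosh_field_def exp_minus exp_double
    by (simp add: power2_eq_square field_simps)
qed auto

lemma norm_contour_integral_rectpath_le:
  assumes ab: "Re a \<le> Re b" "Im a \<le> Im b"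
    and f: "continuous_on (path_image (rectpath a b)) f"
    and B: "B \<ge> 0" "\<And>z. z \<in> path_image (rectpath a b) \<Longrightarrow> norm (f z) \<le> B"
  shows "norm (contour_integral (rectpath a b) f) \<le> B * (2 * (Re b - Re a) + 2 * (Im b - Im a))"
proof -
  define c d where "c = Complex (Re b) (Im a)" and "d = Complex (Re a) (Im b)"
  have R: "rectpath a b = linepath a c +++ linepath c b +++ linepath b d +++ linepath d a"
    by (simp add: rectpath_def Let_def c_def d_def)
  have P: "path_image (rectpath a b) = closed_segment a c \<union> closed_segment c b \<union> closed_segment b d \<union> closed_segment d a"
    unfolding R by (simp add: path_image_join Un_assoc)
  have I: "f contour_integrable_on linepath p q" and L: "norm (contour_integral (linepath p q) f) \<le> B * norm (q - p)"
    if "closed_segment p q \<subseteq> path_image (rectpath a b)" for p q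
  proof -
    show "f contour_integrable_on linepath p q"
      by (intro contour_integrable_continuous_linepath continuous_on_subset[OF f that])
    thus "norm (contour_integral (linepath p q) f) \<le> B * norm (q - p)"
      using that B by (intro contour_integral_bound_linepath) auto
  qed
  have sub: "closed_segment a c \<subseteq> path_image (rectpath a b)" "closed_segment c b \<subseteq> path_image (rectpath a b)"
    "closed_segment b d \<subseteq> path_image (rectpath a b)" "closed_segment d a \<subseteq> path_image (rectpath a b)"
    unfolding P by auto
  have "contour_integral (rectpath a b) f = contour_integral (linepath a c) f + (contour_integral (linepath c b) f
      + (contour_integral (linepath b d) f + contour_integral (linepath d a) f))"
    unfolding R using I sub by simp
  also have "norm \<dots> \<le> B * norm (c - a) + (B * norm (b - c) + (B * norm (d - b) + B * norm (a - d)))"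
    by (intro order_trans[OF norm_triangle_ineq] add_mono L sub)
  also have "c - a = of_real (Re b - Re a)" by (simp add: c_def complex_eq_iff)
  also have "b - c = \<i> * of_real (Im b - Im a)" by (simp add: c_def complex_eq_iff)
  also have "d - b = of_real (Re a - Re b)" by (simp add: d_def complex_eq_iff)
  also have "a - d = \<i> * of_real (Im a - Im b)" by (simp add: d_def complex_eq_iff)
  finally show ?thesis using ab by (simp add: norm_mult algebra_simps del: of_real_diff)
qed

text \<open>The integrand has residue 1/n(s) at s and 1/(n'(p) (p - s)) at each zero p; the minus
  sign restores the form c(p)/(s - p) of the partial fractions.\<close>

lemma residue_sum_rectpath:
  assumes holo: "n holomorphic_on UNIV" and fin: "\<And>R. finite {w \<in> cball 0 R. n w = 0}"
    and simple: "\<And>w. n w = 0 \<Longrightarrow> deriv n w \<noteq> 0"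
    and box: "s \<in> box a b" and s: "n s \<noteq> 0"
    and path: "\<And>w. w \<in> path_image (rectpath a b) \<Longrightarrow> n w \<noteq> 0"
  shows "contour_integral (rectpath a b) (\<lambda>w. 1 / (n w * (w - s))) =
           2 * of_real pi * \<i> * (1 / n s - (\<Sum>p | p \<in> box a b \<and> n p = 0. 1 / (deriv n p * (s - p))))"
proof -
  have ab: "Re a < Re b" "Im a < Im b" using box by (auto simp: in_box_complex_iff)
  obtain r where r: "cbox a b \<subseteq> ball 0 r" "r > 0"
    using bounded_subset_ballD[OF bounded_cbox] by metis
  \<comment> \<open>The residue theorem is applied in a disc around the box; the zeros of this disc
    outside the box have winding number 0.\<close>
  define Z where "Z = {w \<in> ball 0 r. n w = 0}"
  have fZ: "finite Z" by (rule finite_subset[OF _ fin[of r]]) (auto simp: Z_def)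
  let ?F = "\<lambda>w. 1 / (n w * (w - s))"
  have sub: "path_image (rectpath a b) \<subseteq> cbox a b" using ab by (intro path_image_rectpath_subset_cbox) auto
  have nb: "path_image (rectpath a b) \<inter> box a b = {}" using ab by (intro path_image_rectpath_inter_box) auto
  have sZ: "s \<notin> Z" using s by (simp add: Z_def)
  have "contour_integral (rectpath a b) ?F = 2 * pi * \<i> * (\<Sum>p\<in>insert s Z. winding_number (rectpath a b) p * residue ?F p)"
  proof (rule Residue_theorem)
    show "finite (insert s Z)" using fZ by simp
    show "?F holomorphic_on ball 0 r - insert s Z"
      by (intro holomorphic_intros holomorphic_on_subset[OF holo]) (auto simp: Z_def)
    show "path_image (rectpath a b) \<subseteq> ball 0 r - insert s Z"
      using sub r nb box path by (auto simp: Z_def)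
    show "\<forall>z. z \<notin> ball 0 r \<longrightarrow> winding_number (rectpath a b) z = 0"
      using r ab by (auto intro!: winding_number_rectpath_outside)
  qed auto
  also have "(\<Sum>p\<in>insert s Z. winding_number (rectpath a b) p * residue ?F p) =
      winding_number (rectpath a b) s * residue ?F s + (\<Sum>p\<in>Z. winding_number (rectpath a b) p * residue ?F p)"
    using fZ sZ by (rule sum.insert)
  also have "winding_number (rectpath a b) s * residue ?F s = 1 / n s"
  proof -
    have cont: "isCont n s" using holo by (meson UNIV_I continuous_on_eq_continuous_at holomorphic_on_imp_continuous_on open_UNIV)
    then obtain e where e: "e > 0" "\<And>w. dist s w < e \<Longrightarrow> n w \<noteq> 0"
      using continuous_at_avoid[OF cont s] by blast
    have "residue (\<lambda>w. (1 / n w) / (w - s)) s = (1 / n s) / 1"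
    proof (rule residue_simple_pole_deriv)
      show "(\<lambda>w. 1 / n w) holomorphic_on ball s e"
        using e by (intro holomorphic_intros holomorphic_on_subset[OF holo]) auto
      show "((\<lambda>w. w - s) has_field_derivative 1) (at s)" by (auto intro!: derivative_eq_intros)
    qed (use e s in \<open>auto intro!: holomorphic_intros\<close>)
    thus ?thesis using winding_number_rectpath[OF box] by simp
  qed
  also have "(\<Sum>p\<in>Z. winding_number (rectpath a b) p * residue ?F p) = (\<Sum>p | p \<in> box a b \<and> n p = 0. - (1 / (deriv n p * (s - p))))"
  proof (rule sum.mono_neutral_cong_right[OF fZ])
    show "{p. p \<in> box a b \<and> n p = 0} \<subseteq> Z" using r box_subset_cbox[of a b] by (auto simp: Z_def)
    show "\<forall>p\<in>Z - {p. p \<in> box a b \<and> n p = 0}. winding_number (rectpath a b) p * residue ?F p = 0"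
    proof
      fix p assume p: "p \<in> Z - {p. p \<in> box a b \<and> n p = 0}"
      hence "p \<notin> box a b" "n p = 0" by (auto simp: Z_def)
      hence "p \<notin> cbox a b" using path[of p] path_image_rectpath_cbox_minus_box[of a b] ab by auto
      thus "winding_number (rectpath a b) p * residue ?F p = 0"
        using ab by (simp add: winding_number_rectpath_outside)
    qed
    fix p assume p: "p \<in> {p. p \<in> box a b \<and> n p = 0}"
    hence ps: "p \<noteq> s" using s by auto
    have "residue (\<lambda>w. (1 / (w - s)) / n w) p = (1 / (p - s)) / deriv n p"
    proof (rule residue_simple_pole_deriv)
      show "(\<lambda>w. 1 / (w - s)) holomorphic_on ball p (dist p s)"
        by (intro holomorphic_intros) auto
      show "n holomorphic_on ball p (dist p s)" by (rule holomorphic_on_subset[OF holo]) auto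
      show "(n has_field_derivative deriv n p) (at p)" using holo by (intro holomorphic_derivI) auto
    qed (use ps p simple in auto)
    hence "residue ?F p = (1 / (p - s)) / deriv n p" by (simp add: mult.commute)
    moreover have "(1 / (p - s)) / deriv n p = - (1 / (deriv n p * (s - p)))"
      using ps by (metis (no_types, lifting) divide_divide_eq_left minus_diff_eq minus_divide_right mult.commute mult_minus_right)
    ultimately show "winding_number (rectpath a b) p * residue ?F p = - (1 / (deriv n p * (s - p)))"
      using p winding_number_rectpath[of p a b] by simp
  qed
  finally show ?thesis by (simp add: sum_negf)
qed

section \<open>Lower bounds for \<open>n\<close>\<close>

text \<open>The instance sigma = 1. The bound is nonnegative whatever \<open>gam k\<close> is, since
  \<open>powr\<close> never returns a negative value, so positivity is available before anything is
  known about the ordinates.\<close>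

lemma lower_exponent_imp_pos:
  assumes "lower_exponent u \<epsilon>" "k \<ge> 1"
  shows "u k > 0"
proof -
  obtain K where "K > 0" "u k > K * gam k powr (- (\<epsilon> + 1))"
    using assms unfolding lower_exponent_def by (metis zero_less_one)
  moreover have "K * gam k powr (- (\<epsilon> + 1)) \<ge> 0" using \<open>K > 0\<close> by simp
  ultimately show ?thesis by linarith
qed

section \<open>Symmetry, derivative and zeros of n\<close>

lemma n_fun_odd: "n_fun (- s) = - n_fun s"
  by (simp add: n_fun_eq Xi_even)

lemma holomorphic_n_fun: "n_fun holomorphic_on A"
  unfolding n_fun_eq[abs_def] by (intro holomorphic_intros holomorphic_Xi) auto

lemma n_fun_has_deriv:
  "(n_fun has_field_derivative
     of_real pi / 4 * cos (of_real pi * s / 4) * Xi s + sin (of_real pi * s / 4) * deriv Xi s) (at s)"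
proof -
  have "(Xi has_field_derivative deriv Xi s) (at s)"
    by (rule holomorphic_derivI[OF holomorphic_Xi[of UNIV]]) auto
  thus ?thesis unfolding n_fun_eq[abs_def] by (auto intro!: derivative_eq_intros)
qed

lemma deriv_n_fun: "deriv n_fun s = of_real pi / 4 * cos (of_real pi * s / 4) * Xi s + sin (of_real pi * s / 4) * deriv Xi s"
  using n_fun_has_deriv by (rule DERIV_imp_deriv)

lemma deriv_Xi_minus: "deriv Xi (- s) = - deriv Xi s"
proof -
  have D: "(Xi has_field_derivative deriv Xi (- s)) (at (- s))"
    by (rule holomorphic_derivI[OF holomorphic_Xi[of UNIV]]) auto
  have "((\<lambda>z. Xi (- z)) has_field_derivative deriv Xi (- s) * (- 1)) (at s)"
    by (rule DERIV_chain2[where f = Xi and g = uminus]) (use D in \<open>auto intro!: derivative_eq_intros\<close>)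
  hence "(Xi has_field_derivative deriv Xi (- s) * (- 1)) (at s)" by (simp add: Xi_even)
  from DERIV_imp_deriv[OF this] show ?thesis by simp
qed

lemma c_coeff_even: "c_coeff (- s) = c_coeff s"
  by (simp add: c_coeff_def deriv_n_fun Xi_even deriv_Xi_minus)

lemma sin_quarter_zero_iff: "sin (of_real pi * s / 4 :: complex) = 0 \<longleftrightarrow> (\<exists>w::int. s = 4 * of_int w)"
proof
  assume "sin (of_real pi * s / 4) = 0"
  then obtain w :: int where "of_real pi * s / 4 = of_real (of_int w * pi)"
    unfolding sin_eq_0 by auto
  hence "of_real pi * s = of_real pi * (4 * of_int w)" by (simp add: field_simps)
  thus "\<exists>w::int. s = 4 * of_int w" by auto
next
  assume "\<exists>w::int. s = 4 * of_int w"
  then obtain w :: int where "s = 4 * of_int w" by blast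
  thus "sin (of_real pi * s / 4) = 0" unfolding sin_eq_0 by (intro exI[of _ w]) simp
qed

lemma n_fun_zero_iff: "n_fun s = 0 \<longleftrightarrow> s \<in> Z_circ"
  unfolding n_fun_eq Z_circ_def mult_eq_0_iff sin_quarter_zero_iff Xi_zero_iff by auto

section \<open>The Gamma factor against the sine\<close>

lemma norm_a_fun: "norm (a_fun s) = pi powr (- Re s / 2) * norm s * norm (Gamma (s / 2)) * norm (s - 1)"
proof -
  have "norm (of_real pi powr (- s / 2) :: complex) = pi powr (- Re s / 2)"
    using norm_powr_real_powr[of "of_real pi" "- s / 2"] by simp
  thus ?thesis by (simp add: a_fun_def norm_mult)
qed

text \<open>At abscissa 3/2 zeta is evaluated on the line of real part 2. Gamma cancels cosh, and |s
  - 1| leaves a factor 1 + |t|, which is later spent in \<open>Xi_far_right\<close>.\<close>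

lemma n_fun_vertical_lower_aux:
  "norm (Xi (Complex (3/2) t)) * cosh (pi * t / 4) \<ge> (2 - pi^2 / 6) / pi * ((1 + \<bar>t\<bar>) / 2)"
proof -
  have s: "1 / 2 + Complex (3/2) t = 2 + \<i> * of_real t" by (simp add: complex_eq_iff)
  define s where "s = 2 + \<i> * complex_of_real t"
  have s2: "s / 2 = Complex 1 (t / 2)" by (simp add: s_def complex_eq_iff)
  have "Xi (Complex (3/2) t) = a_fun s * zeta s"
    unfolding Xi_def s s_def
    by (rule a_fun_zeta[symmetric]) (auto elim!: nonpos_Ints_cases simp: complex_eq_iff)
  moreover have "norm (a_fun s) = 1 / pi * norm s * norm (Gamma (Complex 1 (t / 2))) * norm (s - 1)"
    unfolding norm_a_fun s2 by (simp add: s_def powr_minus inverse_eq_divide)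
  ultimately have eq: "norm (Xi (Complex (3/2) t)) * cosh (pi * t / 4) =
      (1 / pi * norm s * norm (s - 1)) * (cosh (pi * (t / 2) / 2) * norm (Gamma (Complex 1 (t / 2)))) * norm (zeta s)"
    by (simp add: norm_mult mult_ac)
  have "(1 / pi * norm s * norm (s - 1)) * (cosh (pi * (t / 2) / 2) * norm (Gamma (Complex 1 (t / 2)))) * norm (zeta s)
      \<ge> (1 / pi * 1 * ((1 + \<bar>t\<bar>) / 2)) * 1 * (2 - pi^2 / 6)"
  proof (intro mult_mono cosh_mult_Gamma_ge)
    show "2 - pi^2 / 6 \<le> norm (zeta s)" unfolding s_def by (rule zeta_2_line_lower)
    show "1 \<le> norm s" using abs_Re_le_cmod[of s] by (simp add: s_def)
    show "(1 + \<bar>t\<bar>) / 2 \<le> norm (s - 1)"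
      using abs_Re_le_cmod[of "s - 1"] abs_Im_le_cmod[of "s - 1"] by (simp add: s_def)
    have "pi^2 \<le> (32 / 10)^2" using pi_approx by (intro power_mono) auto
    thus "0 \<le> 2 - pi^2 / 6" by (simp add: power2_eq_square)
  qed auto
  moreover have "(2 - pi^2 / 6) / pi * ((1 + \<bar>t\<bar>) / 2) = (1 / pi * 1 * ((1 + \<bar>t\<bar>) / 2)) * 1 * (2 - pi^2 / 6)"
    by simp
  ultimately show ?thesis unfolding eq by (simp only:)
qed

lemma vertical_const_pos: "(2 - pi^2 / 6) / pi > 0"
proof -
  have "pi^2 \<le> (32 / 10)^2" using pi_approx by (intro power_mono) auto
  hence "2 - pi^2 / 6 > 0" by (simp add: power2_eq_square)
  thus ?thesis by simp
qed

text \<open>\<open>norm_Gamma_ratio_mono\<close> bounds Gamma from below only when moving to the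
  right from abscissa 1, so 1/4 is reached from 5/4 by the functional equation, at the cost of 1 +
  |y|.\<close>

lemma norm_Gamma_quarter_ge:
  "norm (Gamma (Complex (1/4) y)) \<ge> Gamma (5/4) * norm (Gamma (Complex 1 y)) / (1 + \<bar>y\<bar>)"
proof -
  define z where "z = Complex (1/4) y"
  have z: "z \<notin> \<int>\<^sub>\<le>\<^sub>0" by (auto simp: z_def complex_eq_iff elim!: nonpos_Ints_cases)
  have "Gamma (5/4::real) * norm (Gamma (Complex 1 y)) \<le> norm (Gamma (Complex (5/4) y))"
    using norm_Gamma_ratio_mono[of 1 "5/4" y] Gamma_real_pos[of "5/4"] by (simp add: field_simps)
  also have "Complex (5/4) y = z + 1" by (simp add: z_def complex_eq_iff)
  also have "norm (Gamma (z + 1)) = norm z * norm (Gamma z)" using Gamma_plus1[OF z] by (simp add: norm_mult)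
  also have "\<dots> \<le> (1 + \<bar>y\<bar>) * norm (Gamma z)"
    using cmod_le[of z] by (intro mult_right_mono) (auto simp: z_def)
  finally show ?thesis by (simp add: z_def field_simps)
qed

text \<open>On the critical line s/2 has real part 1/4. The factors s and s - 1 give T^2, the
  passage from 1/4 to 1 in Gamma costs 1 + T/2, and T >= 2 leaves one power of T.\<close>

lemma Xi_imaginary_lower:
  assumes T: "T \<ge> 2"
  shows "sinh (pi * T / 4) * norm (Xi (Complex 0 T)) \<ge>
           pi powr (- 1 / 4) * Gamma (5/4) / 2 * T * norm (zeta (1 / 2 + Complex 0 T))"
proof -
  let ?K = "pi powr (- 1 / 4) * Gamma (5/4 :: real)"
  let ?G = "norm (Gamma (Complex 1 (T / 2)))"
  define s where "s = 1 / 2 + Complex 0 T"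
  have s2: "s / 2 = Complex (1/4) (T / 2)" by (simp add: s_def complex_eq_iff)
  have X: "Xi (Complex 0 T) = a_fun s * zeta s" unfolding s_def by (rule Xi_a_fun_zeta) (use T in auto)
  have "norm (a_fun s) = pi powr (- 1 / 4) * norm s * norm (Gamma (Complex (1/4) (T / 2))) * norm (s - 1)"
    unfolding norm_a_fun s2 by (simp add: s_def)
  also have "\<dots> \<ge> pi powr (- 1 / 4) * T * (Gamma (5/4) * ?G / (1 + \<bar>T / 2\<bar>)) * T"
    using T abs_Im_le_cmod[of s] abs_Im_le_cmod[of "s - 1"] Gamma_real_pos[of "5/4"]
    by (intro mult_mono norm_Gamma_quarter_ge) (auto simp: s_def intro!: mult_nonneg_nonneg divide_nonneg_nonneg)
  finally have "sinh (pi * T / 4) * norm (a_fun s) \<ge>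
     sinh (pi * T / 4) * (pi powr (- 1 / 4) * T * (Gamma (5/4) * ?G / (1 + \<bar>T / 2\<bar>)) * T)"
    using T by (intro mult_left_mono) auto
  also have "sinh (pi * T / 4) * (pi powr (- 1 / 4) * T * (Gamma (5/4) * ?G / (1 + \<bar>T / 2\<bar>)) * T)
     = ?K * (sinh (pi * (T / 2) / 2) * ?G) * (T * (T / (1 + T / 2)))"
    using T by (simp add: mult_ac)
  finally have "sinh (pi * T / 4) * norm (a_fun s) \<ge>
      ?K * (sinh (pi * (T / 2) / 2) * ?G) * (T * (T / (1 + T / 2)))" .
  moreover have "?K * (sinh (pi * (T / 2) / 2) * ?G) * (T * (T / (1 + T / 2)))
      \<ge> ?K * (1 / 2) * (T * 1)"
    using T Gamma_real_pos[of "5/4"]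
    by (intro mult_mono sinh_mult_Gamma_ge) (auto simp: field_simps intro!: mult_nonneg_nonneg)
  ultimately have "?K * (1 / 2) * (T * 1) \<le> sinh (pi * T / 4) * norm (a_fun s)"
    by linarith
  hence "?K * (1 / 2) * (T * 1) * norm (zeta s) \<le> sinh (pi * T / 4) * norm (a_fun s) * norm (zeta s)"
    by (intro mult_right_mono) auto
  thus ?thesis unfolding X norm_mult s_def[symmetric] by (simp add: mult_ac)
qed

section \<open>Consequences of RH and C3: ordinates and simple zeros\<close>

locale simple_zeros_on_critical_line =
  assumes rh: RH and c3: C3
begin

lemma delta_pos: "k \<ge> 1 \<Longrightarrow> delta k > 0"
  using c3 lower_exponent_imp_pos unfolding C3_def by blast

lemma zeta_deriv_pos: "k \<ge> 1 \<Longrightarrow> zeta_deriv_at k > 0"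
  using c3 lower_exponent_imp_pos unfolding C3_def by blast

lemma gam_Suc: "gam (int (Suc n)) = pos_ordinate (Suc n)"
  by (simp only: gam_def nat_int) simp

lemma delta_le_gap: "delta (int (Suc n)) \<le> pos_ordinate (Suc (Suc n)) - pos_ordinate (Suc n)"
proof -
  have "next_index (int (Suc n)) = int (Suc (Suc n))" by (simp add: next_index_def)
  thus ?thesis unfolding delta_def by (simp only: gam_Suc)
qed

lemma delta_le_gap': "delta (int (Suc (Suc n))) \<le> pos_ordinate (Suc (Suc n)) - pos_ordinate (Suc n)"
proof -
  have "prev_index (int (Suc (Suc n))) = int (Suc n)" by (simp add: prev_index_def)
  thus ?thesis unfolding delta_def by (simp only: gam_Suc)
qed

lemma ordinates_iff: "t \<in> ordinates \<longleftrightarrow> t > 0 \<and> Xi (\<i> * of_real t) = 0"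
proof
  assume "t \<in> ordinates"
  then obtain \<rho> where r: "zeta \<rho> = 0" "t = Im \<rho>" "Im \<rho> > 0" by (auto simp: ordinates_def)
  hence "Re \<rho> = 1 / 2" using rh unfolding RH_def by auto
  hence "\<rho> = 1 / 2 + \<i> * of_real t" using r by (simp add: complex_eq_iff)
  thus "t > 0 \<and> Xi (\<i> * of_real t) = 0" using r by (simp add: Xi_zero_iff Z_i_def)
next
  assume "t > 0 \<and> Xi (\<i> * of_real t) = 0"
  hence "t > 0" "zeta (1 / 2 + \<i> * of_real t) = 0" by (auto simp: Xi_zero_iff Z_i_def)
  thus "t \<in> ordinates" unfolding ordinates_def by (intro CollectI exI[of _ "1 / 2 + \<i> * of_real t"]) auto
qed

lemma finite_ordinates: "finite {t \<in> ordinates. t \<le> T}"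
proof (rule finite_subset)
  show "finite (Im ` {s \<in> cball 0 T. Xi s = 0})"
    using Xi_real_nonzero[of 0] by (intro finite_imageI entire_finite_zeros holomorphic_Xi) simp
  show "{t \<in> ordinates. t \<le> T} \<subseteq> Im ` {s \<in> cball 0 T. Xi s = 0}"
  proof
    fix t assume "t \<in> {t \<in> ordinates. t \<le> T}"
    hence "\<i> * of_real t \<in> {s \<in> cball 0 T. Xi s = 0}" by (auto simp: ordinates_iff norm_mult)
    thus "t \<in> Im ` {s \<in> cball 0 T. Xi s = 0}" by (intro image_eqI[of _ _ "\<i> * of_real t"]) auto
  qed
qed

text \<open>Positivity of \<open>delta\<close> gives the strict increase that
  \<open>iterated_Inf_enumerates\<close> asks for, and with it the infinitude of the
  ordinates.\<close>

lemma strict_mono_pos_ordinate: "strict_mono pos_ordinate"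
  and range_pos_ordinate: "range (\<lambda>n. pos_ordinate (Suc n)) = ordinates"
proof -
  have gap: "pos_ordinate (Suc n) < pos_ordinate (Suc (Suc n))" for n
    using delta_le_gap[of n] delta_pos[of "int (Suc n)"] by (simp del: pos_ordinate.simps)
  have pos: "t > 0" if "t \<in> ordinates" for t using that by (simp add: ordinates_iff)
  note enum = iterated_Inf_enumerates[OF pos finite_ordinates pos_ordinate.simps(1) pos_ordinate.simps(2) gap]
  show "strict_mono pos_ordinate" "range (\<lambda>n. pos_ordinate (Suc n)) = ordinates"
    by (rule enum; assumption)+
qed

text \<open>Counted from 0: \<open>ord n\<close> is the ordinate of index n + 1.\<close>

definition ord :: "nat \<Rightarrow> real" where
  "ord n = pos_ordinate (Suc n)"

lemma ord_pos: "ord n > 0"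
  using strict_monoD[OF strict_mono_pos_ordinate, of 0 "Suc n"] by (simp add: ord_def)

lemma ord_less_iff: "ord m < ord n \<longleftrightarrow> m < n" and ord_le_iff: "ord m \<le> ord n \<longleftrightarrow> m \<le> n"
  using strict_mono_less[OF strict_mono_pos_ordinate] strict_mono_less_eq[OF strict_mono_pos_ordinate]
  by (auto simp: ord_def simp del: pos_ordinate.simps)

lemma gam_ord: "gam (int (Suc n)) = ord n"
  by (simp only: gam_Suc ord_def)

lemma Xi_zero_ord_iff: "Xi s = 0 \<longleftrightarrow> (\<exists>n. s = \<i> * of_real (ord n) \<or> s = - (\<i> * of_real (ord n)))"
proof
  assume z: "Xi s = 0"
  hence zi: "zeta (1 / 2 + s) = 0" "Im s \<noteq> 0" by (auto simp: Xi_zero_iff Z_i_def)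
  hence "Re (1 / 2 + s) = 1 / 2" using rh unfolding RH_def by (metis Im_complex_of_real add_0 of_real_divide of_real_1 of_real_numeral plus_complex.sel(2))
  hence s: "s = \<i> * of_real (Im s)" by (simp add: complex_eq_iff)
  have ex: "\<exists>n. t = ord n" if "t > 0" "Xi (\<i> * of_real t) = 0" for t
    using that ordinates_iff range_pos_ordinate unfolding ord_def by blast
  show "\<exists>n. s = \<i> * of_real (ord n) \<or> s = - (\<i> * of_real (ord n))"
  proof (cases "Im s > 0")
    case True
    thus ?thesis using ex[of "Im s"] s z by metis
  next
    case False
    hence "- Im s > 0" using zi by simp
    moreover have "Xi (\<i> * of_real (- Im s)) = 0" using z s Xi_even[of s] by (metis mult_minus_right of_real_minus)
    ultimately obtain n where "- Im s = ord n" using ex by blast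
    hence "s = - (\<i> * of_real (ord n))" using s by (metis add.inverse_inverse mult_minus_right of_real_minus)
    thus ?thesis by blast
  qed
next
  have "Xi (\<i> * of_real (ord n)) = 0" for n
    using range_pos_ordinate ordinates_iff[of "ord n"] unfolding ord_def by blast
  moreover assume "\<exists>n. s = \<i> * of_real (ord n) \<or> s = - (\<i> * of_real (ord n))"
  ultimately show "Xi s = 0" by (auto simp: Xi_even)
qed

lemma deriv_Xi_nonzero:
  assumes "Xi s = 0"
  shows "deriv Xi s \<noteq> 0"
proof -
  have "deriv Xi (\<i> * of_real (ord n)) \<noteq> 0" for n
  proof -
    have "zeta_deriv_at (int (Suc n)) > 0" by (rule zeta_deriv_pos) simp
    hence "deriv zeta (1 / 2 + \<i> * of_real (ord n)) \<noteq> 0" unfolding zeta_deriv_at_def gam_ord by simp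
    moreover have "a_fun (1 / 2 + \<i> * of_real (ord n)) \<noteq> 0" using ord_pos[of n] by (intro a_fun_nonzero) auto
    moreover have "Xi (\<i> * of_real (ord n)) = 0" using Xi_zero_ord_iff by blast
    ultimately show ?thesis by (simp add: deriv_Xi_zero)
  qed
  thus ?thesis using assms by (auto simp: Xi_zero_ord_iff deriv_Xi_minus)
qed

section \<open>Transport of lower bounds along horizontal lines\<close>

sublocale imaginary_zeros Xi
proof
  show "Xi 0 \<noteq> 0" using Xi_real_nonzero[of 0] by simp
  show "Xi s = 0 \<Longrightarrow> Re s = 0" for s by (auto simp: Xi_zero_ord_iff)
qed (auto simp: Xi_even deriv_Xi_nonzero Xi_growth intro: holomorphic_Xi)

definition z0 :: complex where "z0 = \<i> * of_real (ord 0)"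

lemma Xi_z0: "Xi z0 = 0"
  using Xi_zero_ord_iff z0_def by blast

text \<open>The distance to \<open>z0\<close> itself increases with x, so it may be cancelled from
  \<open>norm_vertical_ratio\<close>.\<close>

lemma Xi_right_mono:
  assumes "0 \<le> x"
  shows "norm (Xi (Complex 0 t)) \<le> norm (Xi (Complex x t))"
proof (cases "x = 0")
  case False
  have "norm (Xi (Complex 0 t)) * norm (Complex x t - z0) \<le> norm (Xi (Complex x t)) * norm (Complex 0 t - z0)"
    by (rule norm_vertical_ratio[OF _ assms Xi_z0]) simp
  also have "\<dots> \<le> norm (Xi (Complex x t)) * norm (Complex x t - z0)"
    by (intro mult_left_mono) (auto simp: cmod_def z0_def)
  finally show ?thesis using False by (subst (asm) mult_le_cancel_right) (auto simp: z0_def complex_eq_iff)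
qed simp

lemma Xi_horizontal_mono: "norm (Xi (Complex 0 t)) \<le> norm (Xi (Complex x t))"
proof (cases "x \<ge> 0")
  case False
  have "norm (Xi (Complex 0 (- t))) \<le> norm (Xi (Complex (- x) (- t)))"
    using False by (intro Xi_right_mono) auto
  thus ?thesis using Xi_even[of "Complex 0 t"] Xi_even[of "Complex x t"] by (simp add: complex_minus)
qed (rule Xi_right_mono)

text \<open>Here the distance to \<open>z0\<close> is kept: it is at least X at abscissa X and at
  most D (1 + |t|) at abscissa 3/2. The growth in t from \<open>n_fun_vertical_lower_aux\<close>
  compensates the latter.\<close>

lemma Xi_far_right:
  "\<exists>c>0. \<forall>X\<ge>3/2. \<forall>t. norm (Xi (Complex X t)) * cosh (pi * t / 4) \<ge> c * X"
proof -
  define c0 where "c0 = (2 - pi^2 / 6) / pi / 2"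
  have c0: "c0 > 0" using vertical_const_pos unfolding c0_def by (rule half_gt_zero)
  define D where "D = 3 / 2 + ord 0 + 1"
  have D: "D > 0" using ord_pos[of 0] by (simp add: D_def)
  have "norm (Xi (Complex X t)) * cosh (pi * t / 4) \<ge> c0 / D * X" if X: "X \<ge> 3/2" for X t
  proof -
    have "norm (Xi (Complex (3/2) t)) * norm (Complex X t - z0) \<le> norm (Xi (Complex X t)) * norm (Complex (3/2) t - z0)"
      by (rule norm_vertical_ratio[OF _ X Xi_z0]) simp
    also have "\<dots> \<le> norm (Xi (Complex X t)) * (D * (1 + \<bar>t\<bar>))"
    proof (rule mult_left_mono)
      have "norm (Complex (3/2) t - z0) \<le> 3 / 2 + \<bar>t - ord 0\<bar>"
        using cmod_le[of "Complex (3/2) t - z0"] by (simp add: z0_def)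
      also have "\<dots> \<le> D + \<bar>t\<bar>" using ord_pos[of 0] unfolding D_def by linarith
      also have "\<dots> \<le> D * (1 + \<bar>t\<bar>)"
        using mult_right_mono[of 1 D "\<bar>t\<bar>"] ord_pos[of 0] by (simp add: distrib_left D_def)
      finally show "norm (Complex (3/2) t - z0) \<le> D * (1 + \<bar>t\<bar>)" .
    qed simp
    finally have 1: "norm (Xi (Complex (3/2) t)) * norm (Complex X t - z0) \<le> norm (Xi (Complex X t)) * (D * (1 + \<bar>t\<bar>))" .
    have "(c0 * (1 + \<bar>t\<bar>)) * X \<le> (norm (Xi (Complex (3/2) t)) * cosh (pi * t / 4)) * norm (Complex X t - z0)"
    proof (rule mult_mono)
      show "c0 * (1 + \<bar>t\<bar>) \<le> norm (Xi (Complex (3/2) t)) * cosh (pi * t / 4)"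
        using n_fun_vertical_lower_aux[of t] by (simp add: c0_def)
      show "X \<le> norm (Complex X t - z0)" using abs_Re_le_cmod[of "Complex X t - z0"] by (simp add: z0_def)
    qed (use X in \<open>auto\<close>)
    also have "\<dots> = (norm (Xi (Complex (3/2) t)) * norm (Complex X t - z0)) * cosh (pi * t / 4)" by simp
    also have "\<dots> \<le> (norm (Xi (Complex X t)) * (D * (1 + \<bar>t\<bar>))) * cosh (pi * t / 4)"
      using 1 by (intro mult_right_mono) auto
    finally have "(1 + \<bar>t\<bar>) * (c0 * X) \<le> (1 + \<bar>t\<bar>) * (D * (norm (Xi (Complex X t)) * cosh (pi * t / 4)))"
      by (simp only: mult_ac)
    hence "c0 * X \<le> D * (norm (Xi (Complex X t)) * cosh (pi * t / 4))"
      by (subst (asm) mult_le_cancel_left_pos) auto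
    thus ?thesis using D by (simp add: field_simps)
  qed
  thus ?thesis using c0 D by (intro exI[of _ "c0 / D"]) auto
qed

lemma n_fun_vertical_lower:
  "\<exists>c>0. \<forall>N t. norm (n_fun (Complex (4 * real N + 2) t)) \<ge> c * (4 * real N + 2) \<and>
              norm (n_fun (Complex (- (4 * real N + 2)) t)) \<ge> c * (4 * real N + 2)"
proof -
  obtain c where c: "c > 0" "\<And>X t. X \<ge> 3/2 \<Longrightarrow> norm (Xi (Complex X t)) * cosh (pi * t / 4) \<ge> c * X"
    using Xi_far_right by blast
  have right: "norm (n_fun (Complex (4 * real N + 2) t)) \<ge> c * (4 * real N + 2)" for N t
  proof -
    define w where "w = of_real pi * Complex (4 * real N + 2) t / 4"
    have w: "Re w = pi * (4 * real N + 2) / 4" "Im w = pi * t / 4" by (auto simp: w_def)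
    have "2 * Re w = pi * real (2 * N + 1)" unfolding w by (simp add: field_simps)
    hence "cos (2 * Re w) = - 1" using cos_npi2[of "2 * N + 1"] by simp
    hence "norm (sin w) = cosh (pi * t / 4)" using norm_sin_eq_cosh[of w] w by simp
    hence "norm (n_fun (Complex (4 * real N + 2) t)) = norm (Xi (Complex (4 * real N + 2) t)) * cosh (pi * t / 4)"
      unfolding n_fun_eq norm_mult w_def[symmetric] by simp
    thus ?thesis using c(2)[of "4 * real N + 2" t] by simp
  qed
  have "norm (n_fun (Complex (- (4 * real N + 2)) t)) = norm (n_fun (Complex (4 * real N + 2) (- t)))" for N t
    using n_fun_odd[of "Complex (4 * real N + 2) (- t)"] by (simp add: complex_minus)
  thus ?thesis using c right by metis
qed

text \<open>The case t = 0, which bounds the coefficients c(4w) of the real partial fraction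
  series.\<close>

lemma Xi_even_lower: "\<exists>c>0. \<forall>w::nat. norm (Xi (4 * of_nat (Suc w))) \<ge> c * real (Suc w)"
proof -
  obtain c where c: "c > 0" "\<And>X t. X \<ge> 3/2 \<Longrightarrow> norm (Xi (Complex X t)) * cosh (pi * t / 4) \<ge> c * X"
    using Xi_far_right by blast
  have "norm (Xi (4 * of_nat (Suc w))) \<ge> c * real (Suc w)" for w
  proof -
    have "Complex (4 * real (Suc w)) 0 = 4 * of_nat (Suc w)" by (simp add: complex_eq_iff)
    hence "norm (Xi (4 * of_nat (Suc w))) \<ge> c * (4 * real (Suc w))" using c(2)[of "4 * real (Suc w)" 0] by simp
    moreover have "c * (4 * real (Suc w)) \<ge> c * real (Suc w)" using c by simp
    ultimately show ?thesis by linarith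
  qed
  thus ?thesis using c by blast
qed

end

section \<open>The partial fraction expansion\<close>

lemma sum_plus_minus:
  fixes h :: "'i \<Rightarrow> complex"
  assumes "finite I" "inj_on h I" "\<And>i j. i \<in> I \<Longrightarrow> j \<in> I \<Longrightarrow> h i \<noteq> - h j"
  shows "(\<Sum>p\<in>h ` I \<union> (\<lambda>i. - h i) ` I. f p) = (\<Sum>i\<in>I. f (h i) + f (- h i))"
proof -
  have "(\<Sum>p\<in>h ` I \<union> (\<lambda>i. - h i) ` I. f p) = (\<Sum>p\<in>h ` I. f p) + (\<Sum>p\<in>(\<lambda>i. - h i) ` I. f p)"
    using assms by (intro sum.union_disjoint) auto
  also have "(\<Sum>p\<in>h ` I. f p) = (\<Sum>i\<in>I. f (h i))" using assms by (simp add: sum.reindex)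
  also have "(\<Sum>p\<in>(\<lambda>i. - h i) ` I. f p) = (\<Sum>i\<in>I. f (- h i))"
    using assms by (subst sum.reindex) (auto simp: inj_on_def)
  finally show ?thesis by (simp add: sum.distrib)
qed

section \<open>Midpoints between ordinates and the boxes through them\<close>

context simple_zeros_on_critical_line
begin

definition mid :: "nat \<Rightarrow> real" where
  "mid m = (ord m + ord (Suc m)) / 2"

text \<open>Chosen so that 4 \<open>half_width m\<close> + 2 lies between \<open>mid m\<close> and
  \<open>mid m + 6\<close>: the box is nearly square, and its vertical sides run midway between
  zeros of the sine.\<close>

definition half_width :: "nat \<Rightarrow> nat" where
  "half_width m = nat \<lceil>mid m / 4\<rceil>"

lemma ord_eq_iff: "ord m = ord n \<longleftrightarrow> m = n"
  using ord_le_iff[of m n] ord_le_iff[of n m] by auto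

lemma filterlim_ord: "filterlim ord at_top sequentially"
proof (rule filterlim_at_top[THEN iffD2, rule_format])
  fix B :: real
  have "ord ` {n. ord n \<le> B} \<subseteq> {t \<in> ordinates. t \<le> B}"
    using range_pos_ordinate unfolding ord_def by auto
  hence "finite (ord ` {n. ord n \<le> B})" using finite_ordinates finite_subset by blast
  hence "finite {n. ord n \<le> B}" by (rule finite_imageD) (auto simp: inj_on_def ord_eq_iff)
  then obtain M where "\<And>n. ord n \<le> B \<Longrightarrow> n \<le> M" by (metis finite_nat_set_iff_bounded_le mem_Collect_eq)
  thus "\<forall>\<^sub>F n in sequentially. B \<le> ord n"
    unfolding eventually_sequentially by (metis le_cases not_less_eq_eq)
qed

lemma mid_ord: "k \<le> m \<longleftrightarrow> ord k < mid m"
proof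
  assume "k \<le> m"
  hence "ord k \<le> ord m" "ord m < ord (Suc m)" by (auto simp: ord_le_iff ord_less_iff)
  thus "ord k < mid m" by (simp add: mid_def)
next
  assume lt: "ord k < mid m"
  show "k \<le> m"
  proof (rule ccontr)
    assume "\<not> k \<le> m"
    hence "ord (Suc m) \<le> ord k" "ord m < ord (Suc m)" by (auto simp: ord_le_iff ord_less_iff)
    thus False using lt by (simp add: mid_def)
  qed
qed

lemma ord_le_mid: "ord m \<le> mid m"
  using mid_ord[of m m] by simp

lemma filterlim_mid: "filterlim mid at_top sequentially"
  using filterlim_at_top_mono[OF filterlim_ord] ord_le_mid by (simp add: always_eventually)

lemma mid_pos: "mid m > 0"
  using ord_pos[of m] ord_pos[of "Suc m"] by (simp add: mid_def)

text \<open>Since \<alpha> < 1/2, the detour of the C1 path around an ordinate stays closer to it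
  than \<open>delta k / 2\<close>, whereas a midpoint is at least that far from every
  ordinate.\<close>

lemma mid_avoids:
  assumes \<alpha>: "0 < \<alpha>" "\<alpha> < 1 / 2" and k: "k \<ge> 1"
  shows "\<bar>mid m - gam k\<bar> > \<alpha> * delta' k"
proof -
  obtain n where n: "k = int (Suc n)" using k by (intro that[of "nat k - 1"]) auto
  have d: "delta k > 0" by (rule delta_pos[OF k])
  have "\<alpha> * delta' k \<le> \<alpha> * delta k" using \<alpha> by (intro mult_left_mono) (auto simp: delta'_def)
  also have "\<dots> < delta k / 2" using \<alpha> d mult_strict_right_mono[of \<alpha> "1/2" "delta k"] by simp
  also have "delta k / 2 \<le> \<bar>mid m - gam k\<bar>"
  proof (cases "n \<le> m")
    case True
    have g: "delta k \<le> ord (Suc n) - ord n" using delta_le_gap[of n] by (simp add: n ord_def del: pos_ordinate.simps)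
    have "ord n < ord (Suc n)" by (simp add: ord_less_iff)
    moreover have "mid m \<ge> mid n"
      using True ord_le_iff[of n m] ord_le_iff[of "Suc n" "Suc m"] unfolding mid_def by simp
    ultimately show ?thesis using g unfolding n gam_ord mid_def by (simp add: abs_if field_simps)
  next
    case False
    then obtain l where l: "n = Suc l" by (cases n) auto
    have g: "delta k \<le> ord (Suc l) - ord l" using delta_le_gap'[of l] by (simp add: n l ord_def del: pos_ordinate.simps)
    have "ord l < ord (Suc l)" by (simp add: ord_less_iff)
    moreover have "mid m \<le> mid l"
      using False l ord_le_iff[of m l] ord_le_iff[of "Suc m" "Suc l"] unfolding mid_def by simp
    ultimately show ?thesis using g unfolding n gam_ord mid_def l by (simp add: abs_if field_simps)
  qed
  finally show ?thesis .
qed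

lemma s_path_mid:
  assumes "0 < \<alpha>" "\<alpha> < 1 / 2"
  shows "s_path \<alpha> (mid m) = Complex 0 (mid m)"
proof -
  have "\<not> (\<exists>k\<ge>1. \<bar>mid m - gam k\<bar> \<le> \<alpha> * delta' k)"
    using mid_avoids[OF assms] by (meson not_le)
  hence "x_path \<alpha> (mid m) = 0" unfolding x_path_def by (rule if_not_P)
  thus ?thesis by (simp add: s_path_def)
qed

text \<open>On Im s = T the sine is at least sinh(pi T / 4) and |Xi| is least at iT, so the estimate
  at the midpoint holds along the whole line. The exponent \<eta> is 1 - \<epsilon>.\<close>

lemma n_fun_horizontal_lower:
  assumes \<alpha>: "0 < \<alpha>" "\<alpha> < 1 / 2" and c1: "C1 \<alpha>"
  shows "\<exists>c>0. \<exists>\<eta>>0. \<forall>\<^sub>F m in sequentially. \<forall>x.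
           norm (n_fun (Complex x (mid m))) \<ge> c * mid m powr \<eta> \<and>
           norm (n_fun (Complex x (- mid m))) \<ge> c * mid m powr \<eta>"
proof -
  obtain \<epsilon> where e: "\<epsilon> \<in> C1_exponents \<alpha>" "\<epsilon> < 3 / 4"
    using c1 cInf_lessD[of "C1_exponents \<alpha>" "3 / 4"] unfolding C1_def by blast
  then obtain c where c: "c > 0" "\<And>t. t > t_one \<alpha> \<Longrightarrow> norm (zeta (1 / 2 + s_path \<alpha> t)) > c * t powr (- \<epsilon>)"
    unfolding C1_exponents_def by blast
  define K where "K = pi powr (- 1 / 4) * Gamma (5/4) / 2"
  have K: "K > 0" using Gamma_real_pos[of "5/4"] by (simp add: K_def)
  have "\<forall>\<^sub>F m in sequentially. \<forall>x.
           norm (n_fun (Complex x (mid m))) \<ge> (K * c) * mid m powr (1 - \<epsilon>) \<and>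
           norm (n_fun (Complex x (- mid m))) \<ge> (K * c) * mid m powr (1 - \<epsilon>)"
    using filterlim_at_top_dense[THEN iffD1, OF filterlim_mid, rule_format, of "t_one \<alpha>"]
      filterlim_at_top[THEN iffD1, OF filterlim_mid, rule_format, of 2]
  proof eventually_elim
    case (elim m)
    define T where "T = mid m"
    have T: "T \<ge> 2" using elim by (simp add: T_def)
    have z: "norm (zeta (1 / 2 + Complex 0 T)) \<ge> c * T powr (- \<epsilon>)"
      using c(2)[of T] elim s_path_mid[OF \<alpha>, of m] by (simp add: T_def)
    have "T * T powr (- \<epsilon>) = T powr (1 - \<epsilon>)" using T by (simp add: powr_diff powr_minus field_simps)
    hence "(K * c) * T powr (1 - \<epsilon>) = K * T * (c * T powr (- \<epsilon>))" by (simp add: mult_ac)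
    also have "\<dots> \<le> K * T * norm (zeta (1 / 2 + Complex 0 T))" using z K T by (intro mult_left_mono) auto
    also have "\<dots> \<le> sinh (pi * T / 4) * norm (Xi (Complex 0 T))"
      unfolding K_def by (rule Xi_imaginary_lower[OF T])
    finally have 1: "(K * c) * T powr (1 - \<epsilon>) \<le> sinh (pi * T / 4) * norm (Xi (Complex 0 T))" .
    have up: "norm (n_fun (Complex x T)) \<ge> (K * c) * T powr (1 - \<epsilon>)" for x
    proof -
      have "sinh (pi * T / 4) \<le> norm (sin (of_real pi * Complex x T / 4))"
        using norm_sin_ge_sinh[of "of_real pi * Complex x T / 4"] by simp
      hence "sinh (pi * T / 4) * norm (Xi (Complex 0 T)) \<le> norm (n_fun (Complex x T))"
        unfolding n_fun_eq norm_mult using T by (intro mult_mono Xi_horizontal_mono) auto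
      thus ?thesis using 1 by linarith
    qed
    moreover have "norm (n_fun (Complex x (- T))) = norm (n_fun (Complex (- x) T))" for x
      using n_fun_odd[of "Complex (- x) T"] by (simp add: complex_minus)
    ultimately show ?case unfolding T_def by simp
  qed
  moreover have "K * c > 0" "1 - \<epsilon> > 0" using K c e by auto
  ultimately show ?thesis by blast
qed

lemma half_width_bounds: "mid m \<le> 4 * real (half_width m) + 2" "4 * real (half_width m) + 2 \<le> mid m + 6"
proof -
  have "real (half_width m) = of_int \<lceil>mid m / 4\<rceil>"
    unfolding half_width_def using mid_pos[of m] by (intro of_nat_nat) auto
  thus "mid m \<le> 4 * real (half_width m) + 2" "4 * real (half_width m) + 2 \<le> mid m + 6"
    using ceiling_correct[of "mid m / 4"] by linarith+
qed

lemma filterlim_half_width: "filterlim half_width at_top sequentially"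
proof (rule filterlim_at_top[THEN iffD2, rule_format])
  fix B :: nat
  have "eventually (\<lambda>m. mid m \<ge> 4 * real B + 2) sequentially"
    using filterlim_mid by (auto simp: filterlim_at_top)
  thus "\<forall>\<^sub>F m in sequentially. B \<le> half_width m"
  proof eventually_elim
    case (elim m)
    thus ?case using half_width_bounds(1)[of m] by linarith
  qed
qed

definition corner :: "nat \<Rightarrow> complex" where
  "corner m = Complex (4 * real (half_width m) + 2) (mid m)"

definition box_path :: "nat \<Rightarrow> real \<Rightarrow> complex" where
  "box_path m = rectpath (- corner m) (corner m)"

lemma n_fun_box_path_lower:
  assumes \<alpha>: "0 < \<alpha>" "\<alpha> < 1 / 2" and c1: "C1 \<alpha>"
  shows "\<exists>\<mu>. filterlim \<mu> at_top sequentially \<and>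
          (\<forall>\<^sub>F m in sequentially. \<forall>w\<in>path_image (box_path m). norm (n_fun w) \<ge> \<mu> m)"
proof -
  obtain c \<eta> where c: "c > 0" "\<eta> > 0" and h: "\<forall>\<^sub>F m in sequentially. \<forall>x.
           norm (n_fun (Complex x (mid m))) \<ge> c * mid m powr \<eta> \<and>
           norm (n_fun (Complex x (- mid m))) \<ge> c * mid m powr \<eta>"
    using n_fun_horizontal_lower[OF assms] by blast
  obtain d where d: "d > 0" and v: "\<And>N t. norm (n_fun (Complex (4 * real N + 2) t)) \<ge> d * (4 * real N + 2)"
      "\<And>N t. norm (n_fun (Complex (- (4 * real N + 2)) t)) \<ge> d * (4 * real N + 2)"
    using n_fun_vertical_lower by blast
  define \<mu> where "\<mu> = (\<lambda>m. min (c * mid m powr \<eta>) (d * mid m))"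
  have "filterlim (\<lambda>x. c * x powr \<eta>) at_top at_top" using c by real_asymp
  hence "filterlim (\<lambda>m. c * mid m powr \<eta>) at_top sequentially"
    by (rule filterlim_compose[OF _ filterlim_mid])
  moreover have "filterlim (\<lambda>m. d * mid m) at_top sequentially"
    using d by (intro filterlim_tendsto_pos_mult_at_top[OF tendsto_const] filterlim_mid) auto
  ultimately have "filterlim \<mu> at_top sequentially"
    unfolding \<mu>_def filterlim_at_top by (auto intro: eventually_conj)
  moreover have "\<forall>\<^sub>F m in sequentially. \<forall>w\<in>path_image (box_path m). norm (n_fun w) \<ge> \<mu> m"
    using h
  proof eventually_elim
    case (elim m)
    define X where "X = 4 * real (half_width m) + 2"
    have X: "mid m \<le> X" "X > 0" using half_width_bounds(1)[of m] by (auto simp: X_def)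
    have dX: "d * mid m \<le> d * X" using X d by (intro mult_left_mono) auto
    show ?case
    proof
      fix w assume "w \<in> path_image (box_path m)"
      hence "w \<in> {z. Re z \<in> {- X, X} \<and> Im z \<in> {- mid m..mid m}} \<union> {z. Im z \<in> {- mid m, mid m} \<and> Re z \<in> {- X..X}}"
        unfolding box_path_def using X mid_pos[of m] by (subst (asm) path_image_rectpath) (auto simp: corner_def X_def)
      then consider "Re w = X" | "Re w = - X" | "Im w = mid m" | "Im w = - mid m" by auto
      thus "norm (n_fun w) \<ge> \<mu> m"
      proof cases
        case 1
        hence "w = Complex X (Im w)" by (simp add: complex_eq_iff)
        hence "norm (n_fun w) \<ge> d * X" using v(1)[of "half_width m" "Im w"] unfolding X_def by metis
        thus ?thesis using dX by (simp add: \<mu>_def)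
      next
        case 2
        hence "w = Complex (- X) (Im w)" by (simp add: complex_eq_iff)
        hence "norm (n_fun w) \<ge> d * X" using v(2)[of "half_width m" "Im w"] unfolding X_def by metis
        thus ?thesis using dX by (simp add: \<mu>_def)
      next
        case 3
        hence "w = Complex (Re w) (mid m)" by (simp add: complex_eq_iff)
        hence "norm (n_fun w) \<ge> c * mid m powr \<eta>" using elim by metis
        thus ?thesis by (simp add: \<mu>_def)
      next
        case 4
        hence "w = Complex (Re w) (- mid m)" by (simp add: complex_eq_iff)
        hence "norm (n_fun w) \<ge> c * mid m powr \<eta>" using elim by metis
        thus ?thesis by (simp add: \<mu>_def)
      qed
    qed
  qed
  ultimately show ?thesis by blast
qed

text \<open>For T >= 2 the perimeter 4X + 4T is at most 20T, as X <= T + 6, and |w - s| >= T/2.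
  Together they contribute the constant 40, against 1/\<open>\<mu> m\<close>.\<close>

lemma contour_integral_tendsto_0:
  assumes \<alpha>: "0 < \<alpha>" "\<alpha> < 1 / 2" and c1: "C1 \<alpha>"
  shows "(\<lambda>m. contour_integral (box_path m) (\<lambda>w. 1 / (n_fun w * (w - s)))) \<longlonglongrightarrow> 0"
proof -
  obtain \<mu> where \<mu>: "filterlim \<mu> at_top sequentially"
      "\<forall>\<^sub>F m in sequentially. \<forall>w\<in>path_image (box_path m). norm (n_fun w) \<ge> \<mu> m"
    using n_fun_box_path_lower[OF assms] by blast
  show ?thesis
  proof (rule tendsto_0_le[where K = 1])
    have "((\<lambda>x::real. 40 * inverse x) \<longlongrightarrow> 40 * 0) at_top"
      by (intro tendsto_intros tendsto_inverse_0_at_top filterlim_ident)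
    thus "(\<lambda>m. 40 * inverse (\<mu> m)) \<longlonglongrightarrow> 0" using filterlim_compose[OF _ \<mu>(1)] by fastforce
    have "eventually (\<lambda>m. mid m \<ge> max 2 (2 * norm s)) sequentially"
      by (rule filterlim_at_top[THEN iffD1, OF filterlim_mid, rule_format])
    moreover have "eventually (\<lambda>m. \<mu> m > 0) sequentially"
      by (rule filterlim_at_top_dense[THEN iffD1, OF \<mu>(1), rule_format])
    ultimately show "\<forall>\<^sub>F m in sequentially. norm (contour_integral (box_path m) (\<lambda>w. 1 / (n_fun w * (w - s)))) \<le> norm (40 * inverse (\<mu> m)) * 1"
      using \<mu>(2)
    proof eventually_elim
      case (elim m)
      define T where "T = mid m"
      define X where "X = 4 * real (half_width m) + 2"
      have T: "T \<ge> 2" "T \<ge> 2 * norm s" using elim by (auto simp: T_def)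
      have X: "T \<le> X" "X \<le> T + 6" using half_width_bounds[of m] by (auto simp: T_def X_def)
      have cn: "Re (corner m) = X" "Im (corner m) = T" by (auto simp: corner_def X_def T_def)
      have w: "norm (n_fun w) \<ge> \<mu> m" "norm (w - s) \<ge> T / 2" if "w \<in> path_image (box_path m)" for w
      proof -
        show "norm (n_fun w) \<ge> \<mu> m" using elim that by blast
        from that have "w \<in> {z. Re z \<in> {- X, X} \<and> Im z \<in> {- T..T}} \<union> {z. Im z \<in> {- T, T} \<and> Re z \<in> {- X..X}}"
          unfolding box_path_def using X T by (subst (asm) path_image_rectpath) (auto simp: cn)
        hence "\<bar>Re w\<bar> \<ge> T \<or> \<bar>Im w\<bar> \<ge> T" using X T by auto
        hence "norm w \<ge> T" using abs_Re_le_cmod[of w] abs_Im_le_cmod[of w] by linarith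
        thus "norm (w - s) \<ge> T / 2" using norm_triangle_ineq2[of w s] T by linarith
      qed
      have nz: "n_fun w \<noteq> 0" "w - s \<noteq> 0" if "w \<in> path_image (box_path m)" for w
        using w[OF that] elim T by auto
      have "norm (contour_integral (box_path m) (\<lambda>w. 1 / (n_fun w * (w - s)))) \<le>
         (1 / (\<mu> m * (T / 2))) * (2 * (Re (corner m) - Re (- corner m)) + 2 * (Im (corner m) - Im (- corner m)))"
        unfolding box_path_def
      proof (rule norm_contour_integral_rectpath_le)
        show "continuous_on (path_image (rectpath (- corner m) (corner m))) (\<lambda>w. 1 / (n_fun w * (w - s)))"
          using nz unfolding box_path_def
          by (intro continuous_intros holomorphic_on_imp_continuous_on[OF holomorphic_n_fun]) auto
        fix w assume "w \<in> path_image (rectpath (- corner m) (corner m))"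
        hence pw: "w \<in> path_image (box_path m)" by (simp add: box_path_def)
        have "\<mu> m * (T / 2) \<le> norm (n_fun w) * norm (w - s)"
          using w[OF pw] elim T by (intro mult_mono) auto
        thus "norm (1 / (n_fun w * (w - s))) \<le> 1 / (\<mu> m * (T / 2))"
          unfolding norm_divide norm_mult norm_one using elim T by (intro frac_le) auto
      qed (use elim T X cn in auto)
      also have "2 * (Re (corner m) - Re (- corner m)) + 2 * (Im (corner m) - Im (- corner m)) = 4 * X + 4 * T"
        by (simp add: cn)
      also have "(1 / (\<mu> m * (T / 2))) * (4 * X + 4 * T) \<le> (1 / (\<mu> m * (T / 2))) * (20 * T)"
        using X T elim by (intro mult_left_mono) auto
      also have "\<dots> = 40 * inverse (\<mu> m)" using T elim by (simp add: field_simps)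
      finally show ?case by simp
    qed
  qed
qed

text \<open>\<open>ord\<close> counts from 0, so the ordinates below \<open>mid m\<close> are
  \<open>ord 0\<close> to \<open>ord m\<close>, whence the index set
  \<open>{..<Suc m}\<close>.\<close>

lemma zeros_in_box:
  "{p. p \<in> box (- corner m) (corner m) \<and> n_fun p = 0} =
     insert 0 ((\<lambda>w. 4 * of_nat (Suc w)) ` {..<half_width m} \<union> (\<lambda>w. - (4 * of_nat (Suc w))) ` {..<half_width m})
     \<union> ((\<lambda>k. \<i> * of_real (ord k)) ` {..<Suc m} \<union> (\<lambda>k. - (\<i> * of_real (ord k))) ` {..<Suc m})"
    (is "?L = ?A \<union> ?B")
proof (intro equalityI subsetI)
  fix p assume "p \<in> ?L"
  hence box: "\<bar>Re p\<bar> < 4 * real (half_width m) + 2" "\<bar>Im p\<bar> < mid m" and z: "n_fun p = 0"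
    by (auto simp: in_box_complex_iff corner_def)
  from z have "(\<exists>w::int. p = 4 * of_int w) \<or> Xi p = 0"
    unfolding n_fun_eq mult_eq_0_iff sin_quarter_zero_iff .
  thus "p \<in> ?A \<union> ?B"
  proof
    assume "\<exists>w::int. p = 4 * of_int w"
    then obtain w :: int where w: "p = 4 * of_int w" by blast
    have bw: "\<bar>w\<bar> \<le> int (half_width m)" using box(1) unfolding w by simp
    show ?thesis
    proof (cases "w = 0")
      case False
      define n where "n = nat (\<bar>w\<bar> - 1)"
      have n: "n < half_width m" "\<bar>w\<bar> = int (Suc n)" using bw False by (auto simp: n_def)
      hence "w = int (Suc n) \<or> w = - int (Suc n)" by linarith
      hence "p = 4 * of_nat (Suc n) \<or> p = - (4 * of_nat (Suc n))" unfolding w by auto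
      thus ?thesis using n(1) by blast
    qed (simp add: w)
  next
    assume "Xi p = 0"
    then obtain n where n: "p = \<i> * of_real (ord n) \<or> p = - (\<i> * of_real (ord n))"
      using Xi_zero_ord_iff by blast
    hence "ord n < mid m" using box(2) ord_pos[of n] by auto
    hence "n < Suc m" using mid_ord by (simp add: less_Suc_eq_le)
    thus ?thesis using n by blast
  qed
next
  fix p assume p: "p \<in> ?A \<union> ?B"
  have A: "q \<in> ?L" if "\<exists>w. q = 4 * of_int w \<and> \<bar>w\<bar> \<le> int (half_width m)" for q
  proof -
    from that obtain w where w: "q = 4 * of_int w" "\<bar>w\<bar> \<le> int (half_width m)" by blast
    have "n_fun q = 0" unfolding n_fun_eq mult_eq_0_iff sin_quarter_zero_iff using w by blast
    thus ?thesis using w mid_pos[of m] by (auto simp: in_box_complex_iff corner_def)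
  qed
  have B: "q \<in> ?L" if "\<exists>k\<le>m. q = \<i> * of_real (ord k) \<or> q = - (\<i> * of_real (ord k))" for q
  proof -
    from that obtain k where k: "k \<le> m" "q = \<i> * of_real (ord k) \<or> q = - (\<i> * of_real (ord k))" by blast
    have "n_fun q = 0" unfolding n_fun_eq mult_eq_0_iff Xi_zero_ord_iff using k by blast
    thus ?thesis using k mid_ord[of k m] ord_pos[of k] mid_pos[of m] by (auto simp: in_box_complex_iff corner_def)
  qed
  from p consider "p = 0" | w where "w < half_width m" "p = 4 * of_nat (Suc w) \<or> p = - (4 * of_nat (Suc w))"
    | k where "k \<le> m" "p = \<i> * of_real (ord k) \<or> p = - (\<i> * of_real (ord k))"
    by (auto simp: less_Suc_eq_le)
  thus "p \<in> ?L"
  proof cases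
    case 1 thus ?thesis by (intro A exI[of _ 0]) simp
  next
    case (2 w)
    show ?thesis
    proof (rule A)
      show "\<exists>v. p = 4 * of_int v \<and> \<bar>v\<bar> \<le> int (half_width m)"
        using 2 by (elim disjE) (rule exI[of _ "int (Suc w)"], simp, rule exI[of _ "- int (Suc w)"], simp)
    qed
  next
    case (3 k) thus ?thesis by (intro B) blast
  qed
qed

section \<open>From residues to partial fractions\<close>

definition real_term :: "complex \<Rightarrow> nat \<Rightarrow> complex" where
  "real_term s w = c_coeff (4 * of_nat (Suc w)) * (1 / (s - 4 * of_nat (Suc w)) + 1 / (s + 4 * of_nat (Suc w)))"

definition imag_term :: "complex \<Rightarrow> nat \<Rightarrow> complex" where
  "imag_term s k = c_coeff (\<i> * of_real (ord k)) * (1 / (s - \<i> * of_real (ord k)) + 1 / (s + \<i> * of_real (ord k)))"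

text \<open>n is odd, so its derivative and \<open>c_coeff\<close> are even, and the residues at p
  and -p combine into the paired terms of \<open>p_r\<close> and \<open>p_i\<close>.\<close>

lemma residue_sum_box:
  "(\<Sum>p | p \<in> box (- corner m) (corner m) \<and> n_fun p = 0. 1 / (deriv n_fun p * (s - p))) =
     c_coeff 0 / s + (\<Sum>w<half_width m. real_term s w) + (\<Sum>k<Suc m. imag_term s k)"
proof -
  define t where "t = (\<lambda>p. 1 / (deriv n_fun p * (s - p)))"
  have t: "t p = c_coeff p / (s - p)" for p by (simp add: t_def c_coeff_def)
  have tt: "t p + t (- p) = c_coeff p * (1 / (s - p) + 1 / (s + p))" for p
    by (simp add: t c_coeff_even distrib_left)
  let ?h = "\<lambda>w::nat. 4 * of_nat (Suc w) :: complex"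
  let ?g = "\<lambda>k. \<i> * of_real (ord k) :: complex"
  let ?A = "?h ` {..<half_width m} \<union> (\<lambda>w. - ?h w) ` {..<half_width m}"
  let ?B = "?g ` {..<Suc m} \<union> (\<lambda>k. - ?g k) ` {..<Suc m}"
  have hr: "Re (?h w) > 0" for w by auto
  have gi: "Im (?g k) > 0" for k using ord_pos[of k] by simp
  have disj: "insert 0 ?A \<inter> ?B = {}"
  proof -
    have "Im p = 0" if "p \<in> insert 0 ?A" for p using that by auto
    moreover have "Im p \<noteq> 0" if "p \<in> ?B" for p
    proof -
      from that obtain k where "p = ?g k \<or> p = - ?g k" by blast
      thus ?thesis using ord_pos[of k] by auto
    qed
    ultimately show ?thesis by blast
  qed
  have z: "0 \<notin> ?A"
  proof
    assume "0 \<in> ?A"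
    then obtain w where "0 = ?h w \<or> 0 = - ?h w" by blast
    hence "Re (?h w) = 0" by (metis neg_equal_0_iff_equal zero_complex.sel(1))
    thus False using hr[of w] by simp
  qed
  have "(\<Sum>p\<in>insert 0 ?A \<union> ?B. t p) = (\<Sum>p\<in>insert 0 ?A. t p) + (\<Sum>p\<in>?B. t p)"
    by (intro sum.union_disjoint disj) auto
  also have "(\<Sum>p\<in>insert 0 ?A. t p) = t 0 + (\<Sum>p\<in>?A. t p)" using z by (intro sum.insert) auto
  also have "(\<Sum>p\<in>?A. t p) = (\<Sum>w<half_width m. t (?h w) + t (- ?h w))"
  proof (rule sum_plus_minus)
    show "inj_on ?h {..<half_width m}" by (auto simp: inj_on_def)
    show "?h i \<noteq> - ?h j" for i j
    proof
      assume "?h i = - ?h j"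
      hence "Re (?h i) = - Re (?h j)" by (metis uminus_complex.sel(1))
      thus False using hr[of i] hr[of j] by linarith
    qed
  qed auto
  also have "(\<Sum>p\<in>?B. t p) = (\<Sum>k<Suc m. t (?g k) + t (- ?g k))"
  proof (rule sum_plus_minus)
    show "inj_on ?g {..<Suc m}" by (auto simp: inj_on_def ord_eq_iff)
    show "?g i \<noteq> - ?g j" for i j
    proof
      assume "?g i = - ?g j"
      hence "Im (?g i) = - Im (?g j)" by (metis uminus_complex.sel(2))
      thus False using gi[of i] gi[of j] by linarith
    qed
  qed auto
  finally have "(\<Sum>p\<in>insert 0 ?A \<union> ?B. t p) = t 0 + (\<Sum>w<half_width m. real_term s w) + (\<Sum>k<Suc m. imag_term s k)"
    unfolding tt real_term_def imag_term_def .
  thus ?thesis unfolding zeros_in_box t_def[symmetric] by (simp add: t)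
qed

text \<open>At h = 4w the derivative of n is, up to sign, (pi/4) Xi(h), so the coefficients are
  bounded, and the paired fractions 2s/(s^2 - h^2) are of order 1/w^2.\<close>

lemma summable_real_term:
  assumes s: "n_fun s \<noteq> 0"
  shows "summable (real_term s)"
proof -
  obtain c where c: "c > 0" "\<And>w::nat. norm (Xi (4 * of_nat (Suc w))) \<ge> c * real (Suc w)"
    using Xi_even_lower by blast
  obtain W :: nat where W: "real W \<ge> norm s" using real_arch_simple by blast
  show ?thesis
  proof (rule summable_comparison_test)
    show "summable (\<lambda>w. (4 / (pi * c) * (2 * norm s)) * (1 / (real (Suc w))^2))"
      using inverse_squares_sums by (intro summable_mult) (simp add: sums_iff add.commute)
    have "norm (real_term s w) \<le> (4 / (pi * c) * (2 * norm s)) * (1 / (real (Suc w))^2)" if w: "w \<ge> W" for w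
    proof -
      define n where "n = real (Suc w)"
      define h where "h = (4 * of_nat (Suc w) :: complex)"
      have hn: "h = of_real (4 * n)" by (simp add: h_def n_def)
      have n: "n \<ge> 1" "n \<ge> norm s" using w W by (auto simp: n_def)
      have ph: "of_real pi * h / 4 = of_real (pi * real (Suc w))" by (simp add: hn n_def)
      have "cos (of_real pi * h / 4) = of_real ((- 1) ^ Suc w)" "sin (of_real pi * h / 4) = 0"
        unfolding ph cos_of_real sin_of_real by (simp_all only: cos_npi2 sin_npi2 of_real_0)
      hence "norm (deriv n_fun h) = pi / 4 * norm (Xi h)"
        by (simp add: deriv_n_fun norm_mult norm_power)
      also have "\<dots> \<ge> pi / 4 * (c * n)" using c(2)[of w] by (intro mult_left_mono) (auto simp: h_def n_def)
      finally have "norm (c_coeff h) \<le> 1 / (pi / 4 * (c * n))"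
        unfolding c_coeff_def norm_divide using c n by (intro frac_le) auto
      also have "\<dots> \<le> 4 / (pi * c)" using c n by (simp add: field_simps)
      finally have 1: "norm (c_coeff h) \<le> 4 / (pi * c)" .
      have ne: "s \<noteq> h" "s \<noteq> - h"
        using n n_fun_odd norm_of_real[of "4 * n"] by (auto simp: hn)
      have "1 / (s - h) + 1 / (s + h) = 2 * s / (s^2 - h^2)"
        using ne by (simp add: field_simps power2_eq_square add_eq_0_iff)
      moreover have "norm (2 * s / (s^2 - h^2)) \<le> 2 * norm s / n^2"
      proof -
        have "(norm s)^2 \<le> n^2" using n by (intro power_mono) auto
        moreover have "norm (h^2) = 16 * n^2" using n by (simp add: hn norm_power power_mult_distrib del: of_real_mult)
        moreover have "norm (h^2) - (norm s)^2 \<le> norm (s^2 - h^2)"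
          using norm_triangle_ineq2[of "h^2" "s^2"] by (simp add: norm_minus_commute norm_power)
        ultimately have "n^2 \<le> norm (s^2 - h^2)"
          using zero_le_power2[of n] by linarith
        thus ?thesis unfolding norm_divide using n by (intro frac_le) (auto simp: norm_mult)
      qed
      ultimately have "norm (real_term s w) \<le> 4 / (pi * c) * (2 * norm s / n^2)"
        unfolding real_term_def h_def[symmetric] norm_mult using 1 c by (intro mult_mono) auto
      thus ?thesis by (simp add: n_def)
    qed
    thus "\<exists>N. \<forall>n\<ge>N. norm (real_term s n) \<le> (4 / (pi * c) * (2 * norm s)) * (1 / (real (Suc n))^2)" by blast
  qed
qed

text \<open>The boxes truncate both series at once, so the residue theorem gives only a joint limit.
  As the real series converges by itself, subtracting it shows that the series over the ordinates
  converges, in their increasing order, to the remainder.\<close>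

theorem f_fun_eq_p_fun:
  assumes \<alpha>: "0 < \<alpha>" "\<alpha> < 1 / 2" and c1: "C1 \<alpha>" and s: "n_fun s \<noteq> 0"
  shows "f_fun s = p_fun s"
proof -
  define I where "I = (\<lambda>m. contour_integral (box_path m) (\<lambda>w. 1 / (n_fun w * (w - s))))"
  define S where "S = (\<lambda>m. c_coeff 0 / s + (\<Sum>w<half_width m. real_term s w) + (\<Sum>k<Suc m. imag_term s k))"
  have I0: "I \<longlonglongrightarrow> 0" unfolding I_def by (rule contour_integral_tendsto_0[OF \<alpha> c1])
  obtain \<mu> where \<mu>: "filterlim \<mu> at_top sequentially"
      "\<forall>\<^sub>F m in sequentially. \<forall>w\<in>path_image (box_path m). norm (n_fun w) \<ge> \<mu> m"
    using n_fun_box_path_lower[OF \<alpha> c1] by blast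
  have fin: "finite {w \<in> cball 0 R. n_fun w = 0}" for R
  proof (rule holomorphic_compact_finite_zeros[OF holomorphic_n_fun])
    show "\<not> n_fun constant_on UNIV"
    proof
      assume "n_fun constant_on UNIV"
      hence "n_fun s = n_fun 0" by (auto simp: constant_on_def)
      thus False using s by (simp add: n_fun_eq)
    qed
  qed auto
  have simple_n: "deriv n_fun w \<noteq> 0" if "n_fun w = 0" for w
  proof (cases "Xi w = 0")
    case True
    hence "Im w \<noteq> 0" by (simp add: Xi_zero_iff Z_i_def)
    hence "sin (of_real pi * w / 4) \<noteq> 0" unfolding sin_quarter_zero_iff by auto
    thus ?thesis using True deriv_Xi_nonzero by (simp add: deriv_n_fun)
  next
    case False
    hence "sin (of_real pi * w / 4) = 0" using that by (simp add: n_fun_eq)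
    moreover have "cos (of_real pi * w / 4) \<noteq> 0"
      using calculation sin_cos_squared_add[of "of_real pi * w / 4"] by auto
    ultimately show ?thesis using False by (simp add: deriv_n_fun)
  qed
  have "eventually (\<lambda>m. mid m > norm s) sequentially" "eventually (\<lambda>m. \<mu> m > 0) sequentially"
    using filterlim_mid \<mu>(1) by (auto simp: filterlim_at_top_dense)
  hence "eventually (\<lambda>m. 1 / n_fun s - I m / (2 * of_real pi * \<i>) = S m) sequentially"
    using \<mu>(2)
  proof eventually_elim
    case (elim m)
    have "s \<in> box (- corner m) (corner m)"
      using elim(1) abs_Re_le_cmod[of s] abs_Im_le_cmod[of s] half_width_bounds(1)[of m]
      by (auto simp: in_box_complex_iff corner_def)
    moreover have "n_fun w \<noteq> 0" if "w \<in> path_image (rectpath (- corner m) (corner m))" for w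
      using elim(2,3) that unfolding box_path_def by force
    ultimately have "I m = 2 * of_real pi * \<i> * (1 / n_fun s - S m)"
      unfolding I_def box_path_def S_def residue_sum_box[symmetric]
      by (intro residue_sum_rectpath holomorphic_n_fun fin simple_n s)
    thus ?case by simp
  qed
  moreover have "(\<lambda>m. 1 / n_fun s - I m / (2 * of_real pi * \<i>)) \<longlonglongrightarrow> 1 / n_fun s - 0 / (2 * of_real pi * \<i>)"
    by (intro tendsto_intros I0) auto
  ultimately have S: "S \<longlonglongrightarrow> f_fun s"
    by (simp add: f_fun_def) (rule Lim_transform_eventually)
  have R: "(\<lambda>m. \<Sum>w<half_width m. real_term s w) \<longlonglongrightarrow> (\<Sum>w. real_term s w)"
    by (rule filterlim_compose[OF summable_LIMSEQ[OF summable_real_term[OF s]] filterlim_half_width])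
  have "(\<lambda>m. S m - c_coeff 0 / s - (\<Sum>w<half_width m. real_term s w)) \<longlonglongrightarrow> f_fun s - c_coeff 0 / s - (\<Sum>w. real_term s w)"
    by (intro tendsto_intros S R)
  hence "(\<lambda>m. \<Sum>k<Suc m. imag_term s k) \<longlonglongrightarrow> f_fun s - c_coeff 0 / s - (\<Sum>w. real_term s w)"
    by (simp add: S_def)
  hence "(\<lambda>m. \<Sum>k<m. imag_term s k) \<longlonglongrightarrow> f_fun s - c_coeff 0 / s - (\<Sum>w. real_term s w)"
    by (rule LIMSEQ_imp_Suc)
  hence "(\<Sum>k. imag_term s k) = f_fun s - c_coeff 0 / s - (\<Sum>w. real_term s w)"
    using sums_unique unfolding sums_def by metis
  moreover have "p_i s = (\<Sum>k. imag_term s k)"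
    unfolding p_i_def Let_def gam_ord imag_term_def ..
  moreover have "p_r s = c_coeff 0 / s + (\<Sum>w. real_term s w)"
    unfolding p_r_def real_term_def ..
  ultimately show ?thesis by (simp add: p_fun_def)
qed

end

text \<open>As f - p vanishes off \<open>Z_circ\<close>, the zero function meets the description of
  \<open>Delta\<close>. Any other entire candidate vanishes on the nonempty open set where n is
  nonzero, hence everywhere.\<close>

theorem Delta_eq_0:
  assumes "hypothesis_C_hat"
  shows "Delta = (\<lambda>_. 0)"
proof -
  obtain \<alpha> where \<alpha>: "0 < \<alpha>" "\<alpha> < 1 / 2" "RH" "C1 \<alpha>" "C3"
    using assms unfolding hypothesis_C_hat_def by blast
  interpret simple_zeros_on_critical_line by unfold_locales (use \<alpha> in auto)
  have fp: "f_fun s = p_fun s" if "s \<notin> Z_circ" for s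
    by (rule f_fun_eq_p_fun[OF \<alpha>(1,2,4)]) (use that in \<open>simp add: n_fun_zero_iff\<close>)
  show ?thesis unfolding Delta_def
  proof (rule the_equality)
    show "(\<lambda>_. 0) holomorphic_on UNIV \<and> (\<forall>s. s \<notin> Z_circ \<longrightarrow> 0 = f_fun s - p_fun s)"
      using fp by auto
    fix D assume D: "D holomorphic_on UNIV \<and> (\<forall>s. s \<notin> Z_circ \<longrightarrow> D s = f_fun s - p_fun s)"
    show "D = (\<lambda>_. 0)"
    proof
      fix s
      show "D s = 0"
      proof (rule analytic_continuation_open[where s = "{w. n_fun w \<noteq> 0}" and s' = UNIV and f = D and g = "\<lambda>_. 0"])
        have "closed {w. n_fun w = 0}"
          by (intro closed_Collect_eq holomorphic_on_imp_continuous_on[OF holomorphic_n_fun] continuous_intros)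
        moreover have "{w. n_fun w \<noteq> 0} = - {w. n_fun w = 0}" by auto
        ultimately show "open {w. n_fun w \<noteq> 0}" by (simp add: open_Compl)
        have "n_fun 1 \<noteq> 0"
        proof -
          have "(1::complex) \<noteq> 4 * of_int w" for w :: int
          proof
            assume "(1::complex) = 4 * of_int w"
            hence "of_int 1 = (of_int (4 * w) :: complex)" by simp
            hence "1 = 4 * w" by (simp only: of_int_eq_iff)
            thus False by presburger
          qed
          hence "sin (of_real pi * 1 / 4 :: complex) \<noteq> 0" unfolding sin_quarter_zero_iff by blast
          thus ?thesis using Xi_real_nonzero[of 1] by (simp add: n_fun_eq)
        qed
        thus "{w. n_fun w \<noteq> 0} \<noteq> {}" by blast
        show "D z = 0" if "z \<in> {w. n_fun w \<noteq> 0}" for z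
          using that D fp[of z] by (simp add: n_fun_zero_iff)
      qed (use D in auto)
    qed
  qed
qed

text \<open>The filter \<open>at_infinity\<close> on the complex plane expresses the uniform limit:
  for each \<epsilon> > 0 there is R with |Delta s| < \<epsilon> whenever |s| >= R.\<close>

theorem mainTheorem4:
  assumes "hypothesis_C_hat"
  shows "(Delta \<longlongrightarrow> 0) at_infinity"
  unfolding Delta_eq_0[OF assms] by simp

end
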